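(* Assume that $\|\hat A\|_{\max}=o(1)$ as $n\to\infty$, and let $X\sim P_n$. Then for any positive integer $k$ and any indices $j_1,\dots,j_k\in\{1,\dots,n\}$ (distinct), as $n\to\infty$, $$(w_{j_1}X_{j_1},\dots,w_{j_k}X_{j_k})\to(Y_1,\dots,Y_k)$$ in distribution, where $Y_1,\dots,Y_k$ are i.i.d. exponential random variables with parameter $1$.
   Context: Standing setting: $m\ge 1$ is fixed; for each $n>m$, $A=A^{(n)}$ is a real $m\times n$ matrix of rank $m$ and $b=b^{(n)}\in\mathbb{R}^m$, and $K_n:=\{x\in\mathbb{R}^n: x\ge 0,\ Ax=b\}$ is compact and contains a point all of whose coordinates are strictly positive. $P_n$ is the uniform distribution on $K_n$: $P_n(E)=H^{n-m}(E\cap K_n)/H^{n-m}(K_n)$, where $H^{n-m}$ is the $(n-m)$-dimensional Hausdorff measure. Throughout, $w$ denotes the unique vector with all $w_j>0$, lying in the row span of $A$, such that $\sum_j A_{lj}/w_j=b_l$ for $l=1,\dots,m$. Define $\tilde A_{ij}:=A_{ij}/w_j$ and $\hat A:=(\tilde A\tilde A^t)^{-1/2}\tilde A$. $\|M\|_{\max}$ denotes the maximal absolute value of the entries of a matrix $M$. *)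

theory Defs
  imports "HOL-Probability.Probability"
begin

text \<open>Conventions. The row index set of A (of size m, fixed) is a finite type 'm.
  A vector in R^n is a function nat \<Rightarrow> real, coordinates 0..n-1 (index j+1 of the paper
  is j here); coordinates j \<ge> n are irrelevant / set to 0.
  The matrix A^(n) is  A n :: 'm \<Rightarrow> nat \<Rightarrow> real  (entry (l,j) is A n l j), b^(n) is b n.\<close>

definition dist_n :: "nat \<Rightarrow> (nat \<Rightarrow> real) \<Rightarrow> (nat \<Rightarrow> real) \<Rightarrow> real" where
  "dist_n n x y = sqrt (\<Sum>j<n. (x j - y j)^2)"

definition diam_n :: "nat \<Rightarrow> (nat \<Rightarrow> real) set \<Rightarrow> real" where
  "diam_n n C = (if C = {} then 0 else Sup {dist_n n x y | x y. x \<in> C \<and> y \<in> C})"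

definition hausdorff_const :: "real \<Rightarrow> real" where
  "hausdorff_const s = pi powr (s/2) / (2 powr s * Gamma (s/2 + 1))"

definition hausdorff_n :: "nat \<Rightarrow> real \<Rightarrow> (nat \<Rightarrow> real) set \<Rightarrow> ennreal" where
  "hausdorff_n n s E = (SUP \<delta>\<in>{0<..}. INF C\<in>{C :: nat \<Rightarrow> (nat \<Rightarrow> real) set.
       E \<subseteq> (\<Union>i. C i) \<and> (\<forall>i. \<forall>x\<in>C i. \<forall>y\<in>C i. dist_n n x y \<le> \<delta>)}.
       (\<Sum>i. ennreal (hausdorff_const s * diam_n n (C i) powr s)))"

definition K_set :: "nat \<Rightarrow> ('m::finite \<Rightarrow> nat \<Rightarrow> real) \<Rightarrow> ('m \<Rightarrow> real) \<Rightarrow> (nat \<Rightarrow> real) set" where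
  "K_set n A b = {x. (\<forall>j\<ge>n. x j = 0) \<and> (\<forall>j<n. x j \<ge> 0) \<and> (\<forall>l. (\<Sum>j<n. A l j * x j) = b l)}"

definition P_unif :: "nat \<Rightarrow> ('m::finite \<Rightarrow> nat \<Rightarrow> real) \<Rightarrow> ('m \<Rightarrow> real) \<Rightarrow> (nat \<Rightarrow> real) measure" where
  "P_unif n A b = measure_of (K_set n A b)
      (sets (restrict_space (PiM UNIV (\<lambda>_::nat. borel :: real measure)) (K_set n A b)))
      (\<lambda>E. hausdorff_n n (real n - real CARD('m)) E / hausdorff_n n (real n - real CARD('m)) (K_set n A b))"

definition w_vec :: "nat \<Rightarrow> ('m::finite \<Rightarrow> nat \<Rightarrow> real) \<Rightarrow> ('m \<Rightarrow> real) \<Rightarrow> nat \<Rightarrow> real" where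
  "w_vec n A b = (THE w. (\<forall>j<n. w j > 0) \<and> (\<forall>j\<ge>n. w j = 0)
      \<and> (\<exists>c::'m \<Rightarrow> real. \<forall>j<n. w j = (\<Sum>l\<in>UNIV. c l * A l j))
      \<and> (\<forall>l. (\<Sum>j<n. A l j / w j) = b l))"

definition pos_def_mat :: "real^'m^'m \<Rightarrow> bool" where
  "pos_def_mat M \<longleftrightarrow> transpose M = M \<and> (\<forall>v. v \<noteq> 0 \<longrightarrow> v \<bullet> (M *v v) > 0)"

definition mat_sqrt :: "real^'m^'m \<Rightarrow> real^'m^'m" where
  "mat_sqrt M = (THE S. pos_def_mat S \<and> S ** S = M)"

definition A_tilde :: "nat \<Rightarrow> ('m::finite \<Rightarrow> nat \<Rightarrow> real) \<Rightarrow> ('m \<Rightarrow> real) \<Rightarrow> 'm \<Rightarrow> nat \<Rightarrow> real" where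
  "A_tilde n A b l j = A l j / w_vec n A b j"

definition A_hat :: "nat \<Rightarrow> ('m::finite \<Rightarrow> nat \<Rightarrow> real) \<Rightarrow> ('m \<Rightarrow> real) \<Rightarrow> 'm \<Rightarrow> nat \<Rightarrow> real" where
  "A_hat n A b l j =
     (let G = (\<chi> p q. \<Sum>i<n. A_tilde n A b p i * A_tilde n A b q i) :: real^'m^'m;
          R = matrix_inv (mat_sqrt G)
      in \<Sum>l'\<in>UNIV. R $ l $ l' * A_tilde n A b l' j)"

definition max_norm :: "nat \<Rightarrow> ('m::finite \<Rightarrow> nat \<Rightarrow> real) \<Rightarrow> real" where
  "max_norm n M = Max {\<bar>M l j\<bar> | l j. j < n}"

definition conv_distr :: "(nat \<Rightarrow> 'a::topological_space measure) \<Rightarrow> 'a measure \<Rightarrow> bool" where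
  "conv_distr Ms M \<longleftrightarrow> (\<forall>f::'a \<Rightarrow> real. continuous_on UNIV f \<and> bounded (range f) \<longrightarrow>
      (\<lambda>n. integral\<^sup>L (Ms n) f) \<longlonglongrightarrow> integral\<^sup>L M f)"

definition iid_exp_law :: "(real^'k) measure" where
  "iid_exp_law = distr (PiM UNIV (\<lambda>_::'k. density lborel (exponential_density 1))) borel
                       (\<lambda>y. \<chi> i. y i)"

end

theory Submission
  imports Defs
begin

text \<open>
  Let \<open>V\<close> have i.i.d. standard exponential coordinates and let \<open>a\<^sub>j\<close> be the columns of \<open>A_hat\<close>, so that
  \<open>\<Sum>\<^sub>j a\<^sub>j a\<^sub>j\<^sup>t = I\<close>. As \<open>w\<close> lies in the row span of \<open>A\<close>, the density of \<open>V\<close> is constant on the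
  slices \<open>S = s\<close> of \<open>S = \<Sum>\<^sub>j (V\<^sub>j - 1) a\<^sub>j\<close>, and \<open>w X\<close> is \<open>V\<close> conditioned on \<open>S = 0\<close>.
  Hausdorff measure on the kernel of \<open>A\<close> is a translation invariant Borel measure, hence its product with
  Lebesgue measure in \<open>s\<close> is a multiple of Lebesgue measure; mollifying with a Gaussian in \<open>s\<close> gives
  \<open>E f(w X) = \<integral> E[e\<^bsup>i t \<bullet> S\<^esup> f(V)] dt / \<integral> E[e\<^bsup>i t \<bullet> S\<^esup>] dt\<close> when \<open>f\<close> depends on the selected coordinates.
  The remaining coordinates contribute \<open>\<Prod>\<^sub>j e\<^bsup>-i\<theta>\<^sub>j\<^esup> / (1 - i\<theta>\<^sub>j)\<close> with \<open>\<theta>\<^sub>j = t \<bullet> a\<^sub>j\<close>, which tends to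
  \<open>e\<^bsup>-|t|^2/2\<^esup>\<close> and is dominated by a multiple of \<open>(1 + |t|^2)\<^bsup>-m\<^esup>\<close> because all \<open>\<theta>\<^sub>j\<close> are small while
  \<open>\<Sum>\<^sub>j \<theta>\<^sub>j\<^sup>2 = |t|^2\<close>; the selected coordinates decouple in the limit.
\<close>

section \<open>Hausdorff measure\<close>

text \<open>The slice S = 0 is a null set of R^n, so conditioning on it needs a pointwise meaning.
  The Fubini identity between slices and Lebesgue measure determines slice integrals only for almost
  every s; the value at s = 0 is recovered because the slice integral is continuous there, which in
  turn rests on the boundary of the orthant being null in the central slice. Uniqueness of Haar
  measure stands in for the area formula: no Jacobian and no exact Hausdorff constant is computed,
  and it suffices that Hausdorff measure on the kernel is translation invariant, nonzero and finite
  on bounded sets. The unknown factors (the Haar constant, the normalising constant of the Gaussian,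
  exp(-n) from the exponential density) are the same for every test function, and they cancel
  against the test function 1. The same comparison shows that the uniform law has total mass 1.
  Slices are integrals of nonnegative functions with values in \<open>ennreal\<close>, so a bounded
  test function is shifted by a constant to become nonnegative.\<close>

text \<open>Caratheodory's theorem on metric outer measures, with the metric replaced by the values
  of one function \<open>g\<close>: superadditivity is assumed only for sets whose
  \<open>g\<close>-values are a positive distance apart. The part of \<open>T\<close> above level
  \<open>a\<close> is cut into shells \<open>R i\<close> accumulating at \<open>a\<close>. Shells of
  equal parity are separated, so the measures of the shells have a finite sum; those close to
  \<open>a\<close> carry little mass, and what lies above \<open>a\<close> is nearly the separated
  set \<open>U k\<close>.\<close>

lemma caratheodory_sublevel_set:
  fixes f :: "'a set \<Rightarrow> ennreal" and g :: "'a \<Rightarrow> real"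
  assumes emp: "f {} = 0"
    and inc: "\<And>A B. A \<subseteq> B \<Longrightarrow> f A \<le> f B"
    and csub: "\<And>R :: nat \<Rightarrow> 'a set. f (\<Union>i. R i) \<le> (\<Sum>i. f (R i))"
    and sep: "\<And>E F r. r > 0 \<Longrightarrow> (\<And>x y. x \<in> E \<Longrightarrow> y \<in> F \<Longrightarrow> g x + r \<le> g y) \<Longrightarrow> f E + f F \<le> f (E \<union> F)"
  shows "{x. g x \<le> a} \<in> lambda_system UNIV (Pow UNIV) f"
proof -
  interpret sigma_algebra UNIV "Pow (UNIV :: 'a set)" by (rule sigma_algebra_Pow)
  have sub: "f (A \<union> B) \<le> f A + f B" for A B
  proof -
    have "f (A \<union> B) = f (\<Union>i. binaryset A B i)" by (simp add: UN_binaryset_eq)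
    also have "\<dots> \<le> (\<Sum>i. f (binaryset A B i))" by (rule csub)
    also have "\<dots> = f A + f B" using emp by (rule suminf_binaryset_eq)
    finally show ?thesis .
  qed
  define e where "e i = 1 / (real i + 1)" for i
  have e_mono: "e j \<le> e i" if "i \<le> j" for i j using that by (simp add: e_def frac_le)
  have e_strict: "e (Suc i) < e i" for i by (simp add: e_def frac_less2)
  have e_pos: "e i > 0" for i by (simp add: e_def)
  have main: "f (T \<inter> A) + f (T - A) \<le> f T" if A: "A = {x. g x \<le> a}" for T A
  proof (cases "f T = \<infinity>")
    case fin: False
    define R where "R i = {x \<in> T. a + e (Suc i) < g x \<and> g x \<le> a + e i}" for i :: nat
    define U where "U k = {x \<in> T. a + e k < g x}" for k :: nat
    \<comment> \<open>Between two shells of equal parity lies a whole shell, and its width is the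
      gap required by \<open>sep\<close>; \<open>2 * K + p + 1\<close> is the index of the shell
      skipped last.\<close>
    have par: "(\<Sum>i<N. f (R (2 * i + p))) \<le> f (\<Union>i<N. R (2 * i + p))" for N p
    proof (induction N)
      case (Suc N)
      have "f (R (2 * N + p)) + f (\<Union>i<N. R (2 * i + p)) \<le> f (R (2 * N + p) \<union> (\<Union>i<N. R (2 * i + p)))"
      proof (cases N)
        case 0
        then show ?thesis by (simp add: emp)
      next
        case N: (Suc K)
        show ?thesis
        proof (rule sep)
          show "0 < e (2 * K + p + 1) - e (2 * N + p)" using e_strict[of "2*K+p+1"] N by simp
          fix x y assume x: "x \<in> R (2 * N + p)" and "y \<in> (\<Union>i<N. R (2 * i + p))"
          then obtain i where "i < N" "y \<in> R (2 * i + p)" by auto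
          then have i: "i \<le> K" "y \<in> R (2 * i + p)" using N by auto
          have "e (2 * K + p + 1) \<le> e (2 * i + p + 1)" using i by (intro e_mono) auto
          then show "g x + (e (2 * K + p + 1) - e (2 * N + p)) \<le> g y"
            using x i unfolding R_def by auto
        qed
      qed
      also have "R (2 * N + p) \<union> (\<Union>i<N. R (2 * i + p)) = (\<Union>i<Suc N. R (2 * i + p))"
        by (auto simp: lessThan_Suc)
      finally have "f (R (2 * N + p)) + f (\<Union>i<N. R (2 * i + p)) \<le> f (\<Union>i<Suc N. R (2 * i + p))" .
      from order_trans[OF add_left_mono[OF Suc.IH] this] show ?case by (simp add: add.commute)
    qed (simp add: emp)
    have RT: "R i \<subseteq> T" for i by (auto simp: R_def)
    have ineq: "(\<Sum>i<2 * N. f (R i)) \<le> 2 * f T" for N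
    proof -
      have "(\<Sum>i<2 * N. f (R i)) = (\<Sum>i<N. f (R (2 * i + 0))) + (\<Sum>i<N. f (R (2 * i + 1)))"
        by (induction N) (auto simp: algebra_simps)
      also have "\<dots> \<le> f T + f T"
        using RT by (intro add_mono order_trans[OF par] inc) auto
      finally show ?thesis by (simp add: mult_2)
    qed
    have "(\<Sum>i<N. f (R i)) \<le> 2 * f T" for N
      by (rule order_trans[OF _ ineq[of N]]) (rule sum_mono2, auto)
    then have sumfin: "(\<Sum>i. f (R i)) \<le> 2 * f T"
      by (intro suminf_le_const) auto
    then have tot: "(\<Sum>i. f (R i)) < top"
      using fin by (metis ennreal_mult_less_top ennreal_numeral_less_top infinity_ennreal_def
          less_top order_le_less_trans)
    define r where "r i = enn2real (f (R i))" for i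
    have fR: "f (R i) = ennreal (r i)" for i
      using tot ennreal_suminf_lessD[OF tot, of i] by (simp add: r_def)
    have rn: "r i \<ge> 0" for i by (simp add: r_def)
    have sr: "summable r"
      using tot rn unfolding fR by (intro summable_suminf_not_top) auto
    have eps: "f (T \<inter> A) + f (T - A) \<le> f T + ennreal \<epsilon>" if \<epsilon>: "\<epsilon> > 0" for \<epsilon>
    proof -
      \<comment> \<open>The tail beyond \<open>k\<close> bounds what is lost when
        \<open>T - A\<close> is shrunk to \<open>U k\<close>, where \<open>g\<close> exceeds its
        values on \<open>A\<close> by at least \<open>e k\<close>.\<close>
      obtain k where k: "norm (\<Sum>i. r (i + k)) < \<epsilon>"
        using suminf_exist_split[OF \<epsilon> sr] by blast
      have "T - A \<subseteq> U k \<union> (\<Union>i. R (i + k))"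
      proof
        fix x assume x: "x \<in> T - A"
        then have gx: "g x - a > 0" by (simp add: A)
        obtain n where n: "e n < g x - a"
          using reals_Archimedean[OF gx] by (auto simp: e_def inverse_eq_divide add.commute)
        show "x \<in> U k \<union> (\<Union>i. R (i + k))"
        proof (cases "a + e k < g x")
          case True
          then show ?thesis using x by (auto simp: U_def)
        next
          case nk: False
          \<comment> \<open>Minimality of \<open>j\<close> puts \<open>x\<close> into the preceding
            shell, and \<open>j\<close> exceeds \<open>k\<close> because \<open>x\<close> is not in
            \<open>U k\<close>.\<close>
          define j where "j = (LEAST n. e n < g x - a)"
          have j: "e j < g x - a" unfolding j_def by (rule LeastI, rule n)
          have jk: "k < j"
          proof (rule ccontr)
            assume "\<not> k < j"
            then have "e k \<le> e j" by (intro e_mono) auto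
            then show False using j nk by simp
          qed
          then obtain i where i: "j = Suc (i + k)" by (metis add.commute less_imp_Suc_add)
          have "\<not> e (i + k) < g x - a"
            using not_less_Least[of "i + k" "\<lambda>n. e n < g x - a"] i by (simp add: j_def[symmetric])
          then have "x \<in> R (i + k)" using j x i by (auto simp: R_def)
          then show ?thesis by auto
        qed
      qed
      then have "f (T - A) \<le> f (U k \<union> (\<Union>i. R (i + k)))" by (rule inc)
      also have "\<dots> \<le> f (U k) + (\<Sum>i. f (R (i + k)))"
        by (rule order_trans[OF sub]) (rule add_left_mono, rule csub)
      also have "(\<Sum>i. f (R (i + k))) = ennreal (\<Sum>i. r (i + k))"
        unfolding fR using rn sr by (intro suminf_ennreal2) (auto simp: summable_iff_shift)
      also have "\<dots> \<le> ennreal \<epsilon>" using k by (intro ennreal_leI) auto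
      finally have 1: "f (T - A) \<le> f (U k) + ennreal \<epsilon>" by (simp add: add_left_mono)
      have "f (T \<inter> A) + f (U k) \<le> f ((T \<inter> A) \<union> U k)"
        by (rule sep[OF e_pos[of k]]) (auto simp: A U_def)
      also have "\<dots> \<le> f T" by (rule inc) (auto simp: U_def)
      finally have 2: "f (T \<inter> A) + f (U k) \<le> f T" .
      have "f (T \<inter> A) + f (T - A) \<le> (f (T \<inter> A) + f (U k)) + ennreal \<epsilon>"
        using add_left_mono[OF 1, of "f (T \<inter> A)"] by (simp add: add.assoc)
      also have "\<dots> \<le> f T + ennreal \<epsilon>" by (rule add_right_mono[OF 2])
      finally show ?thesis .
    qed
    show ?thesis by (rule ennreal_le_epsilon) (rule eps)
  next
    case True
    then show ?thesis by simp
  qed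
  have "f (T \<inter> {x. g x \<le> a}) + f (T - {x. g x \<le> a}) = f T" for T
  proof -
    have "f T \<le> f (T \<inter> {x. g x \<le> a}) + f (T - {x. g x \<le> a})"
      using sub[of "T \<inter> {x. g x \<le> a}" "T - {x. g x \<le> a}"] by (simp add: Int_Diff_Un)
    then show ?thesis
      using main[OF refl, of T] by (intro antisym)
  qed
  then show ?thesis unfolding lambda_system_eq by blast
qed

section \<open>Hausdorff premeasures for covers of bounded mesh\<close>

definition hcover :: "nat \<Rightarrow> real \<Rightarrow> (nat \<Rightarrow> real) set \<Rightarrow> (nat \<Rightarrow> (nat \<Rightarrow> real) set) set" where
  "hcover n \<delta> E = {C. E \<subseteq> (\<Union>i. C i) \<and> (\<forall>i. \<forall>x\<in>C i. \<forall>y\<in>C i. dist_n n x y \<le> \<delta>)}"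

definition hweight :: "nat \<Rightarrow> real \<Rightarrow> (nat \<Rightarrow> real) set \<Rightarrow> ennreal" where
  "hweight n s C = ennreal (hausdorff_const s * diam_n n C powr s)"

definition hpre :: "nat \<Rightarrow> real \<Rightarrow> real \<Rightarrow> (nat \<Rightarrow> real) set \<Rightarrow> ennreal" where
  "hpre n s \<delta> E = (INF C\<in>hcover n \<delta> E. \<Sum>i. hweight n s (C i))"

lemma hausdorff_n_eq: "hausdorff_n n s E = (SUP \<delta>\<in>{0<..}. hpre n s \<delta> E)"
  unfolding hausdorff_n_def hpre_def hcover_def hweight_def ..

text \<open>\<open>diam_n\<close> of the empty set is 0 and \<open>0 powr s\<close> is 0 for every
  \<open>s\<close>, so spare slots of a countable cover can be filled with empty sets.\<close>

lemma hweight_empty [simp]: "hweight n s {} = 0"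
  by (simp add: hweight_def diam_n_def)

lemma hpre_mono: "E \<subseteq> F \<Longrightarrow> hpre n s \<delta> E \<le> hpre n s \<delta> F"
  unfolding hpre_def by (rule INF_superset_mono) (auto simp: hcover_def)

lemma hpre_antimono: "\<delta> \<le> \<delta>' \<Longrightarrow> hpre n s \<delta>' E \<le> hpre n s \<delta> E"
  unfolding hpre_def by (rule INF_superset_mono) (auto simp: hcover_def, meson order_trans)

lemma hpre_le: "C \<in> hcover n \<delta> E \<Longrightarrow> hpre n s \<delta> E \<le> (\<Sum>i. hweight n s (C i))"
  unfolding hpre_def by (rule INF_lower)

lemma hpre_le_hausdorff: "\<delta> > 0 \<Longrightarrow> hpre n s \<delta> E \<le> hausdorff_n n s E"
  unfolding hausdorff_n_eq by (rule SUP_upper) simp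

lemma hausdorff_n_mono: "E \<subseteq> F \<Longrightarrow> hausdorff_n n s E \<le> hausdorff_n n s F"
  unfolding hausdorff_n_eq by (rule SUP_mono) (auto intro: hpre_mono)

lemma hausdorff_n_empty [simp]: "hausdorff_n n s {} = 0"
proof -
  have "hpre n s \<delta> {} \<le> 0" for \<delta>
    using hpre_le[of "\<lambda>_. {}" n \<delta> "{}" s] by (simp add: hcover_def)
  then show ?thesis unfolding hausdorff_n_eq by (simp add: SUP_constant)
qed

text \<open>Covers of the \<open>E i\<close> that are optimal up to \<epsilon> / 2^(i+1) are merged
  into one sequence by the pairing function; the errors add up to \<epsilon>.\<close>

lemma hpre_countably_subadditive:
  "hpre n s \<delta> (\<Union>i. E i) \<le> (\<Sum>i. hpre n s \<delta> (E i))"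
proof (rule ennreal_le_epsilon)
  fix \<epsilon> :: real assume fin: "(\<Sum>i. hpre n s \<delta> (E i)) < top" and \<epsilon>: "0 < \<epsilon>"
  have "\<exists>C\<in>hcover n \<delta> (E i). (\<Sum>k. hweight n s (C k)) < hpre n s \<delta> (E i) + ennreal (\<epsilon> * (1/2) ^ Suc i)" for i
  proof -
    have "hpre n s \<delta> (E i) < hpre n s \<delta> (E i) + ennreal (\<epsilon> * (1/2) ^ Suc i)"
    proof -
      have "hpre n s \<delta> (E i) \<noteq> \<infinity>"
        using ennreal_suminf_lessD[OF fin, of i] by auto
      moreover have "0 < ennreal (\<epsilon> * (1/2) ^ Suc i)" using \<epsilon> by simp
      ultimately have "hpre n s \<delta> (E i) + 0 < hpre n s \<delta> (E i) + ennreal (\<epsilon> * (1/2) ^ Suc i)"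
        unfolding ennreal_add_left_cancel_less by blast
      then show ?thesis by simp
    qed
    then show ?thesis unfolding hpre_def by (simp add: INF_less_iff)
  qed
  then obtain C where C: "\<And>i. C i \<in> hcover n \<delta> (E i)"
    "\<And>i. (\<Sum>k. hweight n s (C i k)) < hpre n s \<delta> (E i) + ennreal (\<epsilon> * (1/2) ^ Suc i)"
    by metis
  define D where "D k = (case prod_decode k of (i, j) \<Rightarrow> C i j)" for k
  have "D \<in> hcover n \<delta> (\<Union>i. E i)"
    unfolding hcover_def
  proof safe
    fix x i assume "x \<in> E i"
    then obtain j where "x \<in> C i j" using C(1)[of i] by (auto simp: hcover_def)
    then have "x \<in> D (prod_encode (i, j))" by (simp add: D_def)
    then show "x \<in> (\<Union>i. D i)" by blast
  next
    fix k x y assume "x \<in> D k" "y \<in> D k"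
    then show "dist_n n x y \<le> \<delta>"
      using C(1)[of "fst (prod_decode k)"] by (auto simp: hcover_def D_def split: prod.splits)
  qed
  then have "hpre n s \<delta> (\<Union>i. E i) \<le> (\<Sum>k. hweight n s (D k))" by (rule hpre_le)
  also have "\<dots> = (\<Sum>k. (\<lambda>(i, j). hweight n s (C i j)) (prod_decode k))"
    by (simp add: D_def case_prod_unfold)
  also have "\<dots> = (\<Sum>i. \<Sum>j. hweight n s (C i j))"
    by (rule suminf_ennreal_2dimen) simp
  also have "\<dots> \<le> (\<Sum>i. hpre n s \<delta> (E i) + ennreal (\<epsilon> * (1/2) ^ Suc i))"
    using C(2) by (intro suminf_le) (auto intro: less_imp_le)
  also have "\<dots> = (\<Sum>i. hpre n s \<delta> (E i)) + (\<Sum>i. ennreal (\<epsilon> * (1/2) ^ Suc i))"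
    by (rule suminf_add[symmetric]) auto
  also have "(\<Sum>i. ennreal (\<epsilon> * (1/2) ^ Suc i)) = ennreal \<epsilon>"
    using \<epsilon> sums_mult[OF power_half_series, of \<epsilon>] by (intro suminf_ennreal_eq) auto
  finally show "hpre n s \<delta> (\<Union>i. E i) \<le> (\<Sum>i. hpre n s \<delta> (E i)) + ennreal \<epsilon>" .
qed

lemma hausdorff_n_countably_subadditive:
  "hausdorff_n n s (\<Union>i. E i) \<le> (\<Sum>i. hausdorff_n n s (E i))"
  unfolding hausdorff_n_eq[of n s "\<Union>i. E i"]
  by (intro SUP_least order_trans[OF hpre_countably_subadditive] suminf_le hpre_le_hausdorff) auto

text \<open>A set of diameter at most \<delta> < r meets at most one of \<open>E\<close> and
  \<open>F\<close>. Replacing the members that miss \<open>E\<close> (or \<open>F\<close>) by the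
  empty set splits a cover of the union into two covers without counting any member twice.\<close>

lemma hpre_separated:
  assumes "\<delta> < r" and sep: "\<And>x y. x \<in> E \<Longrightarrow> y \<in> F \<Longrightarrow> r \<le> dist_n n x y"
  shows "hpre n s \<delta> E + hpre n s \<delta> F \<le> hpre n s \<delta> (E \<union> F)"
  unfolding hpre_def[of n s \<delta> "E \<union> F"]
proof (rule INF_greatest)
  fix C assume C: "C \<in> hcover n \<delta> (E \<union> F)"
  define P where "P X i = (if C i \<inter> X = {} then {} else C i)" for X i
  have "P E \<in> hcover n \<delta> E" "P F \<in> hcover n \<delta> F"
    using C unfolding hcover_def P_def by (auto split: if_splits) blast+
  then have "hpre n s \<delta> E + hpre n s \<delta> F \<le> (\<Sum>i. hweight n s (P E i)) + (\<Sum>i. hweight n s (P F i))"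
    by (intro add_mono hpre_le)
  also have "\<dots> = (\<Sum>i. hweight n s (P E i) + hweight n s (P F i))"
    by (rule suminf_add) auto
  also have "\<dots> \<le> (\<Sum>i. hweight n s (C i))"
  proof (intro suminf_le)
    fix i
    have "C i \<inter> E = {} \<or> C i \<inter> F = {}"
    proof (rule ccontr)
      assume "\<not> ?thesis"
      then obtain x y where "x \<in> C i" "x \<in> E" "y \<in> C i" "y \<in> F" by auto
      moreover from this have "dist_n n x y \<le> \<delta>" using C by (auto simp: hcover_def)
      ultimately show False using sep[of x y] \<open>\<delta> < r\<close> by simp
    qed
    then show "hweight n s (P E i) + hweight n s (P F i) \<le> hweight n s (C i)"
      by (auto simp: P_def)
  qed auto
  finally show "hpre n s \<delta> E + hpre n s \<delta> F \<le> (\<Sum>i. hweight n s (C i))" .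
qed

lemma hausdorff_n_separated:
  assumes "0 < r" and sep: "\<And>x y. x \<in> E \<Longrightarrow> y \<in> F \<Longrightarrow> r \<le> dist_n n x y"
  shows "hausdorff_n n s E + hausdorff_n n s F \<le> hausdorff_n n s (E \<union> F)"
proof -
  have "hausdorff_n n s E + hausdorff_n n s F = (SUP \<delta>\<in>{0<..}. hpre n s \<delta> E + hpre n s \<delta> F)"
    unfolding hausdorff_n_eq
  proof (rule SUP_add_directed_ennreal[symmetric])
    fix i j :: real assume "i \<in> {0<..}" "j \<in> {0<..}"
    then show "\<exists>k\<in>{0<..}. hpre n s i E + hpre n s j F \<le> hpre n s k E + hpre n s k F"
      by (intro bexI[of _ "min i j"] add_mono hpre_antimono) auto
  qed
  also have "\<dots> \<le> hausdorff_n n s (E \<union> F)"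
  proof (rule SUP_least)
    fix \<delta> :: real assume "\<delta> \<in> {0<..}"
    \<comment> \<open>Premeasures grow as the mesh shrinks, so the mesh may be lowered below the gap
      \<open>r\<close>.\<close>
    define \<eta> where "\<eta> = min \<delta> (r / 2)"
    have \<eta>: "\<eta> > 0" "\<eta> \<le> \<delta>" "\<eta> < r" using \<open>0 < r\<close> \<open>\<delta> \<in> _\<close> by (auto simp: \<eta>_def)
    have "hpre n s \<delta> E + hpre n s \<delta> F \<le> hpre n s \<eta> E + hpre n s \<eta> F"
      using \<eta> by (intro add_mono hpre_antimono)
    also have "\<dots> \<le> hpre n s \<eta> (E \<union> F)" by (rule hpre_separated[OF \<eta>(3) sep])
    also have "\<dots> \<le> hausdorff_n n s (E \<union> F)" by (rule hpre_le_hausdorff[OF \<eta>(1)])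
    finally show "hpre n s \<delta> E + hpre n s \<delta> F \<le> hausdorff_n n s (E \<union> F)" .
  qed
  finally show ?thesis .
qed

lemma coord_le_dist_n: "j < n \<Longrightarrow> \<bar>x j - y j\<bar> \<le> dist_n n x y"
  unfolding dist_n_def
  by (rule real_le_rsqrt) (simp add: member_le_sum[of j "{..<n}" "\<lambda>j. (x j - y j)\<^sup>2"])

text \<open>\<open>dist_n\<close> ignores the coordinates from \<open>n\<close> on, so it is only a pseudometric and not every Borel set is
  Caratheodory measurable; this is repaired by restricting to a set \<open>L\<close> of vectors supported below \<open>n\<close>.\<close>

definition hausdorff_on :: "nat \<Rightarrow> real \<Rightarrow> (nat \<Rightarrow> real) set \<Rightarrow> (nat \<Rightarrow> real) measure" where
  "hausdorff_on n s L = measure_of UNIV (sets (PiM UNIV (\<lambda>_::nat. borel :: real measure)))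
     (\<lambda>E. hausdorff_n n s (E \<inter> L))"

lemma sets_hausdorff_on [measurable_cong]:
  "sets (hausdorff_on n s L) = sets (PiM UNIV (\<lambda>_::nat. borel :: real measure))"
  unfolding hausdorff_on_def
  using sets.sigma_sets_eq[of "PiM UNIV (\<lambda>_::nat. borel :: real measure)"]
  by (subst sets_measure_of) (auto simp: space_PiM)

lemma space_hausdorff_on [simp]: "space (hausdorff_on n s L) = UNIV"
  unfolding hausdorff_on_def by (simp add: space_measure_of_conv)

text \<open>It is enough that sublevel sets of single coordinates are Caratheodory measurable. A
  coordinate \<open>j < n\<close> is 1-Lipschitz for \<open>dist_n\<close>, so sets separated in
  that coordinate are separated in the pseudometric; a coordinate \<open>j\<close> from
  \<open>n\<close> on vanishes on \<open>L\<close>, and its sublevel sets contain either all of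
  \<open>L\<close> or none of it.\<close>

lemma emeasure_hausdorff_on:
  assumes L: "\<And>x j. x \<in> L \<Longrightarrow> n \<le> j \<Longrightarrow> x j = 0"
    and E: "E \<in> sets (PiM UNIV (\<lambda>_::nat. borel :: real measure))"
  shows "emeasure (hausdorff_on n s L) E = hausdorff_n n s (E \<inter> L)"
proof -
  let ?f = "\<lambda>E. hausdorff_n n s (E \<inter> L)"
  let ?N = "PiM UNIV (\<lambda>_::nat. borel :: real measure)"
  interpret sigma_algebra UNIV "Pow (UNIV :: (nat \<Rightarrow> real) set)" by (rule sigma_algebra_Pow)
  have csub: "?f (\<Union>i. R i) \<le> (\<Sum>i. ?f (R i))" for R :: "nat \<Rightarrow> _"
    using hausdorff_n_countably_subadditive[of n s "\<lambda>i. R i \<inter> L"] by simp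
  have om: "outer_measure_space (Pow UNIV) ?f"
    unfolding outer_measure_space_def positive_def increasing_def countably_subadditive_def
    using csub by (auto intro!: hausdorff_n_mono)
  have ms: "measure_space UNIV (lambda_system UNIV (Pow UNIV) ?f) ?f"
    by (rule caratheodory_lemma[OF om])
  then have salg: "sigma_algebra UNIV (lambda_system UNIV (Pow UNIV) ?f)"
    by (simp add: measure_space_def)
  have gen: "{x. x j \<le> a} \<in> lambda_system UNIV (Pow UNIV) ?f" for j :: nat and a :: real
  proof (cases "j < n")
    case True
    show ?thesis
    proof (rule caratheodory_sublevel_set)
      fix E F :: "(nat \<Rightarrow> real) set" and r :: real
      assume r: "r > 0" and sep: "\<And>x y. x \<in> E \<Longrightarrow> y \<in> F \<Longrightarrow> x j + r \<le> y j"
      have "?f E + ?f F \<le> hausdorff_n n s ((E \<inter> L) \<union> (F \<inter> L))"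
        using sep coord_le_dist_n[OF True]
        by (intro hausdorff_n_separated[OF r]) (smt (verit, best) IntD1)
      then show "?f E + ?f F \<le> ?f (E \<union> F)" by (simp add: Int_Un_distrib2)
    qed (use csub in \<open>auto intro!: hausdorff_n_mono\<close>)
  next
    case False
    then have *: "x \<in> L \<Longrightarrow> x j = 0" for x using L by simp
    have "?f (T \<inter> {x. x j \<le> a}) + ?f (T - {x. x j \<le> a}) = ?f T" for T
    proof (cases "0 \<le> a")
      case True
      then have "T \<inter> {x. x j \<le> a} \<inter> L = T \<inter> L" "(T - {x. x j \<le> a}) \<inter> L = {}" by (auto dest: *)
      then show ?thesis by simp
    next
      case False
      then have "T \<inter> {x. x j \<le> a} \<inter> L = {}" "(T - {x. x j \<le> a}) \<inter> L = T \<inter> L" by (auto dest: *)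
      then show ?thesis by simp
    qed
    then show ?thesis unfolding lambda_system_eq by auto
  qed
  let ?LM = "measure_of UNIV (lambda_system UNIV (Pow UNIV) ?f) ?f"
  have LM: "space ?LM = UNIV" "sets ?LM = lambda_system UNIV (Pow UNIV) ?f"
    using sigma_algebra.sets_measure_of_eq[OF salg] sigma_algebra.space_measure_of_eq[OF salg] by auto
  \<comment> \<open>Measurability of the identity passes from the coordinate conditions to the
    inclusion of the whole product sigma-algebra.\<close>
  have "(\<lambda>x. x) \<in> measurable ?LM ?N"
  proof (rule measurable_PiM_single')
    fix j :: nat
    show "(\<lambda>x. x j) \<in> borel_measurable ?LM"
      by (rule borel_measurableI_le) (use gen LM in auto)
  qed (auto simp: LM)
  then have sub: "sets ?N \<subseteq> lambda_system UNIV (Pow UNIV) ?f"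
    using LM by (auto simp: measurable_def)
  have "measure_space UNIV (sets ?N) ?f"
    by (rule measure_down[OF ms _ sub]) (use sets.sigma_algebra_axioms[of ?N] in \<open>simp add: space_PiM\<close>)
  then show ?thesis
    unfolding hausdorff_on_def using E sets.space_closed[of ?N]
    by (intro emeasure_measure_of_sigma) (auto simp: measure_space_def)
qed

lemma hausdorff_n_translate:
  "hausdorff_n n s ((\<lambda>x i. z i + x i) ` E) = hausdorff_n n s E"
proof -
  have le: "hausdorff_n n s ((\<lambda>x i. z i + x i) ` E) \<le> hausdorff_n n s E" for z E
    unfolding hausdorff_n_eq
  proof (rule SUP_mono, intro bexI)
    fix \<delta> :: real assume "\<delta> \<in> {0<..}"
    show "hpre n s \<delta> ((\<lambda>x i. z i + x i) ` E) \<le> hpre n s \<delta> E"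
      unfolding hpre_def[of n s \<delta> E]
    proof (rule INF_greatest)
      fix C assume C: "C \<in> hcover n \<delta> E"
      have d: "dist_n n (\<lambda>i. z i + x i) (\<lambda>i. z i + y i) = dist_n n x y" for x y
        by (simp add: dist_n_def)
      have setcompr_eq_image2: "{dist_n n x y |x y. x \<in> Y \<and> y \<in> Y} = (\<Union>x\<in>Y. \<Union>y\<in>Y. {dist_n n x y})" for Y
        by auto
      have "{dist_n n x y |x y. x \<in> (\<lambda>x i. z i + x i) ` X \<and> y \<in> (\<lambda>x i. z i + x i) ` X}
           = {dist_n n x y |x y. x \<in> X \<and> y \<in> X}" (is "?L X = ?R X") for X
        unfolding setcompr_eq_image2 by (simp add: d)
      then have "hweight n s ((\<lambda>x i. z i + x i) ` X) = hweight n s X" for X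
        unfolding hweight_def diam_n_def image_is_empty by (metis (no_types))
      moreover have "(\<lambda>k. (\<lambda>x i. z i + x i) ` C k) \<in> hcover n \<delta> ((\<lambda>x i. z i + x i) ` E)"
        using C by (auto simp: hcover_def d) blast
      ultimately show "hpre n s \<delta> ((\<lambda>x i. z i + x i) ` E) \<le> (\<Sum>i. hweight n s (C i))"
        using hpre_le[of "\<lambda>k. (\<lambda>x i. z i + x i) ` C k" n \<delta> "(\<lambda>x i. z i + x i) ` E" s] by simp
    qed
  qed simp
  have "E = (\<lambda>x i. - z i + x i) ` ((\<lambda>x i. z i + x i) ` E)" by (simp add: image_image)
  then have "hausdorff_n n s E \<le> hausdorff_n n s ((\<lambda>x i. z i + x i) ` E)"
    using le[of "\<lambda>i. - z i" "(\<lambda>x i. z i + x i) ` E"] by simp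
  then show ?thesis using le[of z E] by (intro antisym)
qed

section \<open>The kernel of a full-rank matrix\<close>

definition ker_set :: "nat \<Rightarrow> ('m::finite \<Rightarrow> nat \<Rightarrow> real) \<Rightarrow> (nat \<Rightarrow> real) set" where
  "ker_set n A = {y. (\<forall>j\<ge>n. y j = 0) \<and> (\<forall>l. (\<Sum>j<n. A l j * y j) = 0)}"

definition full_rank :: "nat \<Rightarrow> ('m::finite \<Rightarrow> nat \<Rightarrow> real) \<Rightarrow> bool" where
  "full_rank n A \<longleftrightarrow> (\<forall>c. (\<forall>i<n. (\<Sum>l\<in>UNIV. c l * A l i) = 0) \<longrightarrow> (\<forall>l. c l = 0))"

text \<open>Full row rank makes the columns span R^m, so some m of them, indexed by
  \<open>I\<close>, form a basis. Expanding the other columns in this basis presents the kernel as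
  the graph of a linear map over the n - m coordinates outside \<open>I\<close>. Both estimates of
  its Hausdorff measure are read off from this graph.\<close>

lemma free_coordinates:
  fixes A :: "'m::finite \<Rightarrow> nat \<Rightarrow> real"
  assumes rank: "full_rank n A"
  obtains I \<tau> where "I \<subseteq> {..<n}" "card I = CARD('m)"
    "\<And>y. (\<forall>j\<ge>n. y j = 0) \<Longrightarrow> y \<in> ker_set n A \<longleftrightarrow> (\<forall>i\<in>I. y i = (\<Sum>j\<in>{..<n} - I. \<tau> i j * y j))"
proof -
  define col where "col j = (\<chi> l. A l j)" for j
  have sp: "span (col ` {..<n}) = UNIV"
  proof (rule ccontr)
    assume "span (col ` {..<n}) \<noteq> UNIV"
    \<comment> \<open>A normal vector of a hyperplane containing all columns is a nontrivial linear
      relation between the rows.\<close>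
    then obtain a where a: "a \<noteq> 0" "\<forall>x\<in>span (col ` {..<n}). a \<bullet> x = 0"
      using span_not_univ_subset_hyperplane[of "col ` {..<n}"] by (auto simp: subset_iff)
    have "\<forall>i<n. (\<Sum>l\<in>UNIV. (a $ l) * A l i) = 0"
    proof safe
      fix i assume "i < n"
      then have "a \<bullet> col i = 0" using a(2) by (simp add: span_base)
      then show "(\<Sum>l\<in>UNIV. (a $ l) * A l i) = 0" by (simp add: inner_vec_def col_def)
    qed
    then have "\<forall>l. a $ l = 0" using rank unfolding full_rank_def by (metis (no_types))
    then show False using a(1) by (simp add: vec_eq_iff)
  qed
  obtain B where B: "B \<subseteq> col ` {..<n}" "independent B" "col ` {..<n} \<subseteq> span B"
    using maximal_independent_subset by metis
  have spB: "span B = UNIV" using B sp by (metis span_minimal subspace_span top.extremum_uniqueI)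
  have finB: "finite B" using B(1) finite_surj by blast
  have cardB: "card B = CARD('m)"
    using B(2) spB by (metis DIM_cart DIM_real dim_UNIV dim_eq_card_independent dim_span mult.right_neutral)
  obtain I where I: "I \<subseteq> {..<n}" "inj_on col I" "B = col ` I"
    using B(1) by (auto simp: subset_image_inj)
  have finI: "finite I" using I(1) finite_subset by blast
  define \<rho> where "\<rho> j i = representation B (col j) (col i)" for i j
  have rep: "col j = (\<Sum>i\<in>I. \<rho> j i *\<^sub>R col i)" for j
  proof -
    have "(\<Sum>b\<in>B. representation B (col j) b *\<^sub>R b) = col j"
      by (rule sum_representation_eq) (use B(2) spB finB in auto)
    then show ?thesis unfolding I(3) \<rho>_def sum.reindex[OF I(2)] by simp
  qed
  have indep: "(\<Sum>i\<in>I. u i *\<^sub>R col i) = 0 \<longleftrightarrow> (\<forall>i\<in>I. u i = 0)" for u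
  proof safe
    fix i assume 0: "(\<Sum>i\<in>I. u i *\<^sub>R col i) = 0" and i: "i \<in> I"
    define v where "v b = u (the_inv_into I col b)" for b
    have "(\<Sum>b\<in>B. v b *\<^sub>R b) = (\<Sum>i\<in>I. u i *\<^sub>R col i)"
      unfolding I(3) sum.reindex[OF I(2)] v_def
      by (intro sum.cong) (auto simp: the_inv_into_f_f[OF I(2)])
    with 0 have "v (col i) = 0"
      using independentD[OF B(2) finB subset_refl, of v "col i"] i I(3) by auto
    then show "u i = 0" using i by (simp add: v_def the_inv_into_f_f[OF I(2)])
  qed simp
  define \<tau> where "\<tau> i j = - \<rho> j i" for i j
  show ?thesis
  proof (rule that[of I \<tau>])
    show "card I = CARD('m)" using cardB I by (simp add: card_image)
  next
    fix y :: "nat \<Rightarrow> real" assume y: "\<forall>j\<ge>n. y j = 0"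
    have "y \<in> ker_set n A \<longleftrightarrow> (\<Sum>j<n. y j *\<^sub>R col j) = 0"
      using y by (simp add: ker_set_def vec_eq_iff col_def mult.commute)
    also have "(\<Sum>j<n. y j *\<^sub>R col j) = (\<Sum>j\<in>I. y j *\<^sub>R col j) + (\<Sum>j\<in>{..<n}-I. y j *\<^sub>R col j)"
      using I(1) by (simp add: sum.subset_diff add.commute)
    also have "(\<Sum>j\<in>{..<n}-I. y j *\<^sub>R col j) = (\<Sum>j\<in>{..<n}-I. \<Sum>i\<in>I. (y j * \<rho> j i) *\<^sub>R col i)"
      by (subst rep) (simp add: scaleR_sum_right)
    also have "\<dots> = (\<Sum>i\<in>I. \<Sum>j\<in>{..<n}-I. (y j * \<rho> j i) *\<^sub>R col i)" by (rule sum.swap)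
    also have "\<dots> = (\<Sum>i\<in>I. - (\<Sum>j\<in>{..<n}-I. \<tau> i j * y j) *\<^sub>R col i)"
      by (simp add: \<tau>_def scaleR_sum_left sum_negf mult.commute)
    also have "(\<Sum>j\<in>I. y j *\<^sub>R col j) + \<dots> = (\<Sum>i\<in>I. (y i - (\<Sum>j\<in>{..<n}-I. \<tau> i j * y j)) *\<^sub>R col i)"
      by (simp add: sum.distrib[symmetric] scaleR_left_diff_distrib sum_subtractf sum_negf)
    also have "\<dots> = 0 \<longleftrightarrow> (\<forall>i\<in>I. y i = (\<Sum>j\<in>{..<n} - I. \<tau> i j * y j))"
      by (subst indep) simp
    finally show "y \<in> ker_set n A \<longleftrightarrow> (\<forall>i\<in>I. y i = (\<Sum>j\<in>{..<n} - I. \<tau> i j * y j))" .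
  qed (use I in auto)
qed

section \<open>Hausdorff measure of the kernel: positivity and finiteness on boxes\<close>

lemma hausdorff_const_pos: "0 < s \<Longrightarrow> 0 < hausdorff_const s"
  unfolding hausdorff_const_def by (intro divide_pos_pos mult_pos_pos Gamma_real_pos) auto

lemma dist_n_le_diam_n:
  assumes "x \<in> C" "y \<in> C" and "\<And>x y. x \<in> C \<Longrightarrow> y \<in> C \<Longrightarrow> dist_n n x y \<le> \<delta>"
  shows "dist_n n x y \<le> diam_n n C"
proof -
  have "dist_n n x y \<le> Sup {dist_n n x y | x y. x \<in> C \<and> y \<in> C}"
    using assms by (intro cSup_upper) (auto intro!: bdd_aboveI[of _ \<delta>])
  then show ?thesis using assms(1) by (auto simp: diam_n_def)
qed

lemma diam_n_nonneg: "(\<And>x y. x \<in> C \<Longrightarrow> y \<in> C \<Longrightarrow> dist_n n x y \<le> \<delta>) \<Longrightarrow> 0 \<le> diam_n n C"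
proof (cases "C = {}")
  case False
  assume *: "\<And>x y. x \<in> C \<Longrightarrow> y \<in> C \<Longrightarrow> dist_n n x y \<le> \<delta>"
  from False obtain x where "x \<in> C" by auto
  then show ?thesis
    using dist_n_le_diam_n[of x C x n \<delta>] * by (simp add: dist_n_def)
qed (simp add: diam_n_def)

lemma diam_n_le:
  assumes "\<And>x y. x \<in> C \<Longrightarrow> y \<in> C \<Longrightarrow> dist_n n x y \<le> \<delta>" "0 \<le> \<delta>"
  shows "diam_n n C \<le> \<delta>"
proof (cases "C = {}")
  case False
  then have "{dist_n n x y | x y. x \<in> C \<and> y \<in> C} \<noteq> {}" by blast
  then have "Sup {dist_n n x y | x y. x \<in> C \<and> y \<in> C} \<le> \<delta>"
    using assms by (intro cSup_least) auto
  then show ?thesis using False by (simp add: diam_n_def)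
qed (simp add: diam_n_def assms)

lemma dist_n_le_sum: "dist_n n x y \<le> (\<Sum>j<n. \<bar>x j - y j\<bar>)"
  using L2_set_le_sum_abs[of "\<lambda>j. x j - y j" "{..<n}"] by (simp add: L2_set_def dist_n_def)

text \<open>Projection to the free coordinates does not increase distances. A covering set of
  diameter D therefore projects into a cube of side 2 D, of volume (2 D)^d. The projections cover
  the unit cube, so these volumes sum to at least 1, which bounds every cover's weight below by the
  Hausdorff constant over 2^d.\<close>

lemma hausdorff_n_ker_pos:
  fixes A :: "'m::finite \<Rightarrow> nat \<Rightarrow> real"
  assumes rank: "full_rank n A"
    and n: "CARD('m) < n"
  shows "hausdorff_n n (real n - real CARD('m)) (ker_set n A) \<noteq> 0"
proof -
  define d where "d = n - CARD('m)"
  have d: "real n - real CARD('m) = real d" "0 < d" using n by (auto simp: d_def)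
  obtain I \<tau> where I: "I \<subseteq> {..<n}" "card I = CARD('m)"
    and ker: "\<And>y. (\<forall>j\<ge>n. y j = 0) \<Longrightarrow> y \<in> ker_set n A \<longleftrightarrow> (\<forall>i\<in>I. y i = (\<Sum>j\<in>{..<n} - I. \<tau> i j * y j))"
    by (rule free_coordinates[OF rank]) blast
  define J where "J = {..<n} - I"
  have J: "finite J" "card J = d" "J \<subseteq> {..<n}"
    using I by (auto simp: J_def d_def card_Diff_subset finite_subset)
  let ?c = "hausdorff_const (real d)"
  have c: "0 < ?c" using d by (intro hausdorff_const_pos) simp
  let ?M = "PiM J (\<lambda>_. lborel :: real measure)"
  interpret product_sigma_finite "\<lambda>_::nat. lborel :: real measure"
    by standard
  define u where "u = PiE J (\<lambda>_. {0..1::real})"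
  have eu: "emeasure ?M u = 1"
    unfolding u_def by (subst emeasure_PiM) (use J in auto)
  have "ennreal (?c / 2 ^ d) \<le> hpre n (real d) 1 (ker_set n A)"
    unfolding hpre_def
  proof (rule INF_greatest)
    fix C assume C: "C \<in> hcover n 1 (ker_set n A)"
    have Cd: "\<And>x y. x \<in> C i \<Longrightarrow> y \<in> C i \<Longrightarrow> dist_n n x y \<le> 1" for i
      using C by (auto simp: hcover_def)
    define D where "D i = diam_n n (C i)" for i
    have D0: "0 \<le> D i" for i unfolding D_def by (rule diam_n_nonneg[OF Cd])
    define p where "p i = (SOME x. x \<in> C i)" for i
    define Q where "Q i = PiE J (\<lambda>j. {p i j - D i .. p i j + D i})" for i
    have eQ: "emeasure ?M (Q i) = ennreal ((2 * D i) ^ d)" for i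
      unfolding Q_def
      by (subst emeasure_PiM) (use J D0[of i] in \<open>auto simp: prod_constant ennreal_power\<close>)
    have "u \<subseteq> (\<Union>i. Q i)"
    proof
      fix x assume x: "x \<in> u"
      \<comment> \<open>The point of the kernel lying over \<open>x\<close> in the graph
        representation.\<close>
      define y where "y i = (if i \<in> J then x i else if i \<in> I then (\<Sum>j\<in>J. \<tau> i j * x j) else 0)" for i
      have "y \<in> ker_set n A"
      proof (subst ker)
        show "\<forall>j\<ge>n. y j = 0" using J I by (auto simp: y_def)
        show "\<forall>i\<in>I. y i = (\<Sum>j\<in>{..<n} - I. \<tau> i j * y j)"
          unfolding J_def[symmetric] by (auto simp: y_def J_def)
      qed
      then obtain i where i: "y \<in> C i" using C by (auto simp: hcover_def)
      then have p: "p i \<in> C i" unfolding p_def by (rule someI[of "\<lambda>x. x \<in> C i"])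
      have "x \<in> Q i"
        unfolding Q_def
      proof (rule PiE_I)
        fix j assume j: "j \<in> J"
        have "\<bar>y j - p i j\<bar> \<le> dist_n n y (p i)" using j J by (intro coord_le_dist_n) auto
        also have "\<dots> \<le> D i" unfolding D_def by (rule dist_n_le_diam_n[OF i p Cd])
        finally show "x j \<in> {p i j - D i .. p i j + D i}" using j by (auto simp: y_def abs_if split: if_splits)
      next
        fix j assume "j \<notin> J"
        then show "x j = undefined" using x by (auto simp: u_def)
      qed
      then show "x \<in> (\<Union>i. Q i)" by auto
    qed
    then have "1 \<le> emeasure ?M (\<Union>i. Q i)"
      unfolding eu[symmetric] by (intro emeasure_mono) (auto simp: Q_def J)
    also have "\<dots> \<le> (\<Sum>i. emeasure ?M (Q i))"
      by (rule emeasure_subadditive_countably) (auto simp: Q_def J)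
    also have "\<dots> = (\<Sum>i. ennreal ((2 * D i) ^ d))" by (simp add: eQ)
    finally have *: "1 \<le> (\<Sum>i. ennreal ((2 * D i) ^ d))" .
    have "ennreal (?c / 2 ^ d) = ennreal (?c / 2 ^ d) * 1" by simp
    also have "\<dots> \<le> ennreal (?c / 2 ^ d) * (\<Sum>i. ennreal ((2 * D i) ^ d))"
      by (rule mult_left_mono[OF *]) simp
    also have "\<dots> = (\<Sum>i. ennreal (?c / 2 ^ d) * ennreal ((2 * D i) ^ d))"
      by (rule ennreal_suminf_cmult[symmetric])
    also have "\<dots> = (\<Sum>i. hweight n (real d) (C i))"
    proof (intro suminf_cong)
      fix i
      have "ennreal (?c / 2 ^ d) * ennreal ((2 * D i) ^ d) = ennreal (?c / 2 ^ d * (2 * D i) ^ d)"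
        using c D0 by (intro ennreal_mult[symmetric]) auto
      also have "?c / 2 ^ d * (2 * D i) ^ d = ?c * D i ^ d"
        by (simp add: power_mult_distrib)
      \<comment> \<open>For \<open>D i = 0\<close> both sides vanish, the left one because
        \<open>d\<close> is positive.\<close>
      also have "D i ^ d = D i powr real d"
        using D0[of i] d(2) by (cases "D i = 0") (auto simp: powr_realpow)
      finally show "ennreal (?c / 2 ^ d) * ennreal ((2 * D i) ^ d) = hweight n (real d) (C i)"
        by (simp add: hweight_def D_def)
    qed
    finally show "ennreal (?c / 2 ^ d) \<le> (\<Sum>i. hweight n (real d) (C i))" .
  qed
  also have "\<dots> \<le> hausdorff_n n (real d) (ker_set n A)" by (rule hpre_le_hausdorff) simp
  finally have "ennreal (?c / 2 ^ d) \<le> hausdorff_n n (real d) (ker_set n A)" .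
  moreover have "0 < ennreal (?c / 2 ^ d)" using c by simp
  ultimately show ?thesis unfolding d(1) by (metis not_less)
qed

text \<open>Cutting the cube \<open>[-r, r]\<close> in the d free coordinates into N^d cells cuts
  the graph into pieces of diameter at most L * 2 r / N. The number of pieces times the d-th power
  of this diameter does not depend on N, so the bound survives as the mesh tends to 0.\<close>

lemma hausdorff_n_ker_bounded:
  fixes A :: "'m::finite \<Rightarrow> nat \<Rightarrow> real"
  assumes rank: "full_rank n A"
    and n: "CARD('m) < n" and r: "0 < r"
  shows "hausdorff_n n (real n - real CARD('m)) {y \<in> ker_set n A. \<forall>j<n. \<bar>y j\<bar> \<le> r} < \<infinity>"
proof -
  define d where "d = n - CARD('m)"
  have d: "real n - real CARD('m) = real d" "0 < d" using n by (auto simp: d_def)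
  obtain I \<tau> where I: "I \<subseteq> {..<n}" "card I = CARD('m)"
    and ker: "\<And>y. (\<forall>j\<ge>n. y j = 0) \<Longrightarrow> y \<in> ker_set n A \<longleftrightarrow> (\<forall>i\<in>I. y i = (\<Sum>j\<in>{..<n} - I. \<tau> i j * y j))"
    by (rule free_coordinates[OF rank]) blast
  define J where "J = {..<n} - I"
  have J: "finite J" "card J = d" "J \<subseteq> {..<n}"
    using I by (auto simp: J_def d_def card_Diff_subset finite_subset)
  let ?c = "hausdorff_const (real d)"
  have c: "0 < ?c" using d by (intro hausdorff_const_pos) simp
  \<comment> \<open>A Lipschitz constant of the graph, from the supremum distance of the free
    coordinates to the sum of all coordinate distances: the 1 serves the free coordinates, the sum
    of the |\<tau> i j| the dependent ones.\<close>
  define L where "L = (\<Sum>i<n. 1 + (\<Sum>j\<in>J. \<bar>\<tau> i j\<bar>))"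
  have L: "0 \<le> L" unfolding L_def by (intro sum_nonneg add_nonneg_nonneg) auto
  let ?E = "{y \<in> ker_set n A. \<forall>j<n. \<bar>y j\<bar> \<le> r}"
  have "hausdorff_n n (real d) ?E \<le> ennreal (?c * (L * (2 * r)) ^ d)"
    unfolding hausdorff_n_eq
  proof (rule SUP_least)
    fix \<delta> :: real assume "\<delta> \<in> {0<..}"
    then have \<delta>: "\<delta> > 0" by simp
    obtain N where N: "L * (2 * r) / \<delta> < real N" using reals_Archimedean2 by blast
    have "0 \<le> L * (2 * r) / \<delta>" using L r \<delta> by simp
    then have N0: "0 < real N" using N by linarith
    have Nd: "L * (2 * r / real N) \<le> \<delta>" using N N0 \<delta> by (simp add: field_simps)
    define P where "P = PiE J (\<lambda>_. {..<N})"
    have P: "finite P" "card P = N ^ d" unfolding P_def using J by (auto simp: card_PiE finite_PiE)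
    define cell where "cell k = {y \<in> ?E. \<forall>j\<in>J. - r + 2 * r / real N * real (k j) \<le> y j \<and>
        y j \<le> - r + 2 * r / real N * (real (k j) + 1)}" for k
    obtain e where e: "bij_betw e {..<card P} P"
      using ex_bij_betw_nat_finite[OF P(1)] by (auto simp: atLeast0LessThan)
    define C where "C i = (if i < card P then cell (e i) else {})" for i
    have dcell: "dist_n n x y \<le> L * (2 * r / real N)" if "x \<in> cell k" "y \<in> cell k" for x y k
    proof -
      have J1: "\<bar>x j - y j\<bar> \<le> 2 * r / real N" if j: "j \<in> J" for j
      proof -
        have "- r + 2 * r / real N * real (k j) \<le> x j" "x j \<le> - r + 2 * r / real N * (real (k j) + 1)"
          "- r + 2 * r / real N * real (k j) \<le> y j" "y j \<le> - r + 2 * r / real N * (real (k j) + 1)"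
          using \<open>x \<in> cell k\<close> \<open>y \<in> cell k\<close> j unfolding cell_def by blast+
        then show ?thesis unfolding abs_le_iff by (simp only: distrib_left) linarith
      qed
      have I1: "x i = (\<Sum>j\<in>J. \<tau> i j * x j)" "y i = (\<Sum>j\<in>J. \<tau> i j * y j)" if "i \<in> I" for i
        using that ker[of x] ker[of y] \<open>x \<in> cell k\<close> \<open>y \<in> cell k\<close>
        by (auto simp: cell_def J_def[symmetric] ker_set_def)
      have "\<bar>x i - y i\<bar> \<le> (1 + (\<Sum>j\<in>J. \<bar>\<tau> i j\<bar>)) * (2 * r / real N)" if i: "i < n" for i
      proof (cases "i \<in> I")
        case True
        have "\<bar>x i - y i\<bar> = \<bar>\<Sum>j\<in>J. \<tau> i j * (x j - y j)\<bar>"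
          unfolding I1[OF True] by (simp add: sum_subtractf right_diff_distrib)
        also have "\<dots> \<le> (\<Sum>j\<in>J. \<bar>\<tau> i j * (x j - y j)\<bar>)" by (rule sum_abs)
        also have "\<dots> \<le> (\<Sum>j\<in>J. \<bar>\<tau> i j\<bar> * (2 * r / real N))"
          unfolding abs_mult using J1 by (intro sum_mono mult_left_mono) auto
        also have "\<dots> = (\<Sum>j\<in>J. \<bar>\<tau> i j\<bar>) * (2 * r / real N)" by (rule sum_distrib_right[symmetric])
        also have "\<dots> \<le> (1 + (\<Sum>j\<in>J. \<bar>\<tau> i j\<bar>)) * (2 * r / real N)"
          using r by (intro mult_right_mono) auto
        finally show ?thesis .
      next
        case False
        then have "\<bar>x i - y i\<bar> \<le> 1 * (2 * r / real N)" using i J1[of i] by (simp add: J_def)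
        also have "\<dots> \<le> (1 + (\<Sum>j\<in>J. \<bar>\<tau> i j\<bar>)) * (2 * r / real N)"
          using r by (intro mult_right_mono) (auto intro: sum_nonneg)
        finally show ?thesis .
      qed
      then have "(\<Sum>i<n. \<bar>x i - y i\<bar>) \<le> L * (2 * r / real N)"
        unfolding L_def sum_distrib_right by (intro sum_mono) auto
      then show ?thesis using dist_n_le_sum[of n x y] by linarith
    qed
    have "C \<in> hcover n \<delta> ?E"
      unfolding hcover_def
    proof (intro CollectI conjI allI ballI subsetI)
      fix x assume x: "x \<in> ?E"
      \<comment> \<open>The cap \<open>N - 1\<close> puts the right end point
        \<open>x j = r\<close>, where the floor equals \<open>N\<close>, into the last cell.\<close>
      define k where "k = (\<lambda>j\<in>J. min (N - 1) (nat \<lfloor>(x j + r) * real N / (2 * r)\<rfloor>))"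
      have k: "k \<in> P" unfolding P_def k_def using N0 by (auto simp: min_def)
      have "x \<in> cell k"
        unfolding cell_def
      proof (rule CollectI, rule conjI[OF x], rule ballI, rule conjI)
        fix j assume j: "j \<in> J"
        then have xj: "- r \<le> x j" "x j \<le> r" using x J by (force simp: abs_le_iff)+
        define q where "q = (x j + r) * real N / (2 * r)"
        have q: "0 \<le> q" "q \<le> real N" proof -
          show "0 \<le> q" unfolding q_def using xj r N0 by (intro divide_nonneg_pos mult_nonneg_nonneg) auto
          have "(x j + r) * real N \<le> (2 * r) * real N" using xj N0 by (intro mult_right_mono) auto
          then show "q \<le> real N" unfolding q_def using r by (simp add: pos_divide_le_eq mult.commute)
        qed
        have xq: "x j = - r + 2 * r / real N * q" using r N0 by (simp add: q_def field_simps)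
        have kj: "k j = min (N - 1) (nat \<lfloor>q\<rfloor>)" using j by (simp add: k_def q_def)
        have lo: "real (k j) \<le> q"
          unfolding kj using q(1) by (meson le_nat_floor min.cobounded2 of_nat_floor of_nat_mono order_trans)
        have "q < real (nat \<lfloor>q\<rfloor>) + 1" using q(1) by linarith
        then have hi: "q \<le> real (k j) + 1"
          unfolding kj using q(2) N0 by (auto simp: min_def of_nat_diff)
        have "0 < 2 * r / real N" using r N0 by simp
        then show "- r + 2 * r / real N * real (k j) \<le> x j" "x j \<le> - r + 2 * r / real N * (real (k j) + 1)"
          unfolding xq using lo hi by (auto intro!: mult_left_mono simp del: times_divide_eq_left)
      qed
      moreover obtain i where "i < card P" "e i = k"
        using k e by (auto simp: bij_betw_def image_iff) (metis imageE k lessThan_iff)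
      ultimately have "x \<in> C i" by (simp add: C_def)
      then show "x \<in> (\<Union>i. C i)" by blast
    next
      fix i x y assume "x \<in> C i" "y \<in> C i"
      then have "dist_n n x y \<le> L * (2 * r / real N)"
        using dcell by (auto simp: C_def split: if_splits)
      then show "dist_n n x y \<le> \<delta>" using Nd by linarith
    qed
    then have "hpre n (real d) \<delta> ?E \<le> (\<Sum>i. hweight n (real d) (C i))" by (rule hpre_le)
    also have "\<dots> = (\<Sum>i<card P. hweight n (real d) (C i))"
      by (rule suminf_finite) (auto simp: C_def)
    also have "\<dots> \<le> (\<Sum>i<card P. ennreal (?c * (L * (2 * r / real N)) ^ d))"
    proof (rule sum_mono)
      fix i assume i: "i \<in> {..<card P}"
      have D: "diam_n n (C i) \<le> L * (2 * r / real N)" "0 \<le> diam_n n (C i)"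
        using dcell L r i N0 by (auto intro!: diam_n_le diam_n_nonneg[of _ _ "L * (2 * r / real N)"] simp: C_def)
      have "diam_n n (C i) powr real d \<le> (L * (2 * r / real N)) powr real d"
        using D d by (intro powr_mono2) auto
      also have "\<dots> = (L * (2 * r / real N)) ^ d"
        using L r d(2) N0 by (cases "L = 0") (auto intro!: powr_realpow)
      finally show "hweight n (real d) (C i) \<le> ennreal (?c * (L * (2 * r / real N)) ^ d)"
        unfolding hweight_def using c by (intro ennreal_leI mult_left_mono) auto
    qed
    also have "\<dots> = ennreal (real N ^ d * (?c * (L * (2 * r / real N)) ^ d))"
      using c L r by (simp add: P ennreal_mult ennreal_of_nat_eq_real_of_nat[symmetric] ennreal_power[symmetric])
    also have "real N ^ d * (?c * (L * (2 * r / real N)) ^ d) = ?c * (L * (2 * r)) ^ d"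
      using N0 by (simp add: power_mult_distrib power_divide)
    finally show "hpre n (real d) \<delta> ?E \<le> ennreal (?c * (L * (2 * r)) ^ d)" .
  qed
  then show ?thesis unfolding d(1) by (auto intro: order_le_less_trans)
qed

section \<open>Gram matrices and the analytic centre\<close>

lemma pos_def_mat_sym: "pos_def_mat M \<Longrightarrow> u \<bullet> (M *v v) = (M *v u) \<bullet> v"
  unfolding pos_def_mat_def by (metis dot_lmul_matrix transpose_matrix_vector)

lemma pos_def_mat_invertible:
  fixes M :: "real^'m^'m"
  assumes "pos_def_mat M"
  shows "invertible M"
proof -
  have "inj ((*v) M)"
  proof (rule injI)
    fix u v assume "M *v u = M *v v"
    then have "(u - v) \<bullet> (M *v (u - v)) = 0" by (simp add: matrix_vector_mult_diff_distrib)
    then show "u = v" using assms unfolding pos_def_mat_def by (metis eq_iff_diff_eq_0 less_irrefl)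
  qed
  then show ?thesis by (simp add: invertible_left_inverse matrix_left_invertible_injective)
qed

lemma
  assumes "invertible M"
  shows matrix_inv_right: "M ** matrix_inv M = mat 1"
    and matrix_inv_left: "matrix_inv M ** M = mat 1"
  using assms someI_ex[of "\<lambda>M'. M ** M' = mat 1 \<and> M' ** M = mat 1"]
  unfolding invertible_def matrix_inv_def by auto

text \<open>With D = S - T and P = S + T, equality of the squares reads D P + P D = 0. Multiplying
  by D and taking traces gives 2 tr(D P D) = 0 by cyclicity. As D is symmetric, tr(D P D) is the sum
  of the values of the positive definite form P at the columns of D, so every column
  vanishes.\<close>

lemma pos_def_sqrt_unique:
  fixes S T :: "real^'m^'m"
  assumes S: "pos_def_mat S" and T: "pos_def_mat T" and eq: "S ** S = T ** T"
  shows "S = T"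
proof -
  define D where "D = S - T"
  define P where "P = S + T"
  have DP: "D ** P + P ** D = 0"
  proof -
    have "S *v (S *v v) = T *v (T *v v)" for v
      using eq by (simp add: matrix_vector_mul_assoc)
    then show ?thesis
      unfolding matrix_eq D_def P_def
      by (simp add: matrix_vector_mul_assoc[symmetric] matrix_vector_mult_add_rdistrib
          matrix_vector_mult_diff_rdistrib matrix_vector_right_distrib matrix_vector_mult_diff_distrib)
  qed
  have Dsym: "(D *v u) \<bullet> v = u \<bullet> (D *v v)" for u v
    using pos_def_mat_sym[OF S, of u v] pos_def_mat_sym[OF T, of u v]
    by (simp add: D_def matrix_vector_mult_diff_rdistrib inner_diff_left inner_diff_right)
  have Ppos: "0 < v \<bullet> (P *v v)" if "v \<noteq> 0" for v
    using S T that by (simp add: P_def pos_def_mat_def matrix_vector_mult_add_rdistrib inner_add_right add_pos_pos)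
  have "trace (D ** (D ** P)) = trace (D ** P ** D)"
    by (rule trace_mul_sym[of D "D ** P"])
  moreover have "trace (D ** (D ** P + P ** D)) = 0" unfolding DP by (simp add: trace_def matrix_matrix_mult_def)
  ultimately have "trace (D ** (P ** D)) = 0"
    by (simp add: matrix_add_ldistrib trace_add matrix_mul_assoc)
  moreover have "trace (D ** (P ** D)) = (\<Sum>i\<in>UNIV. (D *v axis i 1) \<bullet> (P *v (D *v axis i 1)))"
    unfolding trace_def
  proof (rule sum.cong[OF refl])
    fix i
    have "(D ** (P ** D)) $ i $ i = axis i 1 \<bullet> ((D ** (P ** D)) *v axis i 1)"
      by (simp add: inner_axis' matrix_vector_mul_component inner_axis)
    also have "\<dots> = (D *v axis i 1) \<bullet> (P *v (D *v axis i 1))"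
      by (simp add: Dsym matrix_vector_mul_assoc[symmetric])
    finally show "(D ** (P ** D)) $ i $ i = (D *v axis i 1) \<bullet> (P *v (D *v axis i 1))" .
  qed
  ultimately have sum0: "(\<Sum>i\<in>UNIV. (D *v axis i 1) \<bullet> (P *v (D *v axis i 1))) = 0" by simp
  have nn: "0 \<le> v \<bullet> (P *v v)" for v using Ppos[of v] by (cases "v = 0") auto
  have "\<forall>i\<in>UNIV. (D *v axis i 1) \<bullet> (P *v (D *v axis i 1)) = 0"
    using sum0 by (subst (asm) sum_nonneg_eq_0_iff) (auto intro: nn)
  then have "D *v axis i 1 = 0" for i using Ppos by (metis UNIV_I less_irrefl)
  then have "column i D = 0" for i by (simp add: matrix_vector_mul_component matrix_vector_mult_basis)
  then have "D = 0" by (simp add: vec_eq_iff column_def)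
  then show ?thesis by (simp add: D_def)
qed

lemma pos_def_bounds:
  fixes M :: "real^'m^'m"
  assumes M: "pos_def_mat M"
  obtains l u where "0 < l" "0 < u" "\<And>v. l * (norm v)\<^sup>2 \<le> v \<bullet> (M *v v)" "\<And>v. norm (M *v v) \<le> u * norm v"
proof -
  have cont: "continuous_on (sphere 0 1) (\<lambda>v. v \<bullet> (M *v v))"
    by (intro continuous_intros linear_continuous_on matrix_vector_mul_bounded_linear)
  obtain x :: "real^'m" where x: "x \<in> sphere 0 1" "\<And>y. y \<in> sphere 0 1 \<Longrightarrow> x \<bullet> (M *v x) \<le> y \<bullet> (M *v y)"
    using continuous_attains_inf[OF compact_sphere _ cont] by (auto simp: sphere_def) (metis norm_axis_1)
  define l where "l = x \<bullet> (M *v x)"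
  have l: "0 < l" using M x(1) unfolding l_def pos_def_mat_def by (metis mem_sphere_0 norm_zero zero_neq_one)
  have "l * (norm v)\<^sup>2 \<le> v \<bullet> (M *v v)" for v
  proof (cases "v = 0")
    case False
    have "l \<le> (v /\<^sub>R norm v) \<bullet> (M *v (v /\<^sub>R norm v))" unfolding l_def using False by (intro x(2)) simp
    also have "\<dots> = (v \<bullet> (M *v v)) / (norm v)\<^sup>2"
      by (simp add: matrix_vector_mult_scaleR power2_eq_square field_simps)
    finally show ?thesis using False by (simp add: field_simps)
  qed simp
  moreover obtain u where "0 < u" "\<And>v. norm (M *v v) \<le> norm v * u"
    using bounded_linear.pos_bounded[OF matrix_vector_mul_bounded_linear[of M]] by blast
  ultimately show ?thesis using that[OF l, of u] by (simp add: mult.commute)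
qed

text \<open>After scaling, \<open>M = (1 - N) / \<epsilon>\<close> with \<open>norm N < 1\<close>, and \<open>1 - Y\<close> is a square root of \<open>1 - N\<close>
  when \<open>Y\<close> is the fixed point of the contraction \<open>Y \<mapsto> (N + Y Y) / 2\<close>.\<close>

lemma pos_def_sqrt_exists:
  fixes M :: "real^'m^'m"
  assumes M: "pos_def_mat M"
  shows "\<exists>S. pos_def_mat S \<and> S ** S = M"
proof -
  obtain l u where lu: "0 < l" "0 < u" "\<And>v. l * (norm v)\<^sup>2 \<le> v \<bullet> (M *v v)" "\<And>v. norm (M *v v) \<le> u * norm v"
    using pos_def_bounds[OF M] by blast
  \<comment> \<open>Since |(1 - e M) v|^2 is at most (1 - 2 e l + e^2 u^2) |v|^2, this choice of
    \<open>e\<close> minimises the factor, with value 1 - l e < 1.\<close>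
  define e where "e = l / u\<^sup>2"
  have e: "0 < e" using lu by (simp add: e_def)
  define N where "N = Blinfun (\<lambda>v. v - e *\<^sub>R (M *v v))"
  have Nv: "blinfun_apply N v = v - e *\<^sub>R (M *v v)" for v
    unfolding N_def
    by (subst bounded_linear_Blinfun_apply)
       (auto intro!: bounded_linear_sub bounded_linear_ident bounded_linear_const_scaleR matrix_vector_mul_bounded_linear)
  define q where "q = sqrt (max 0 (1 - l * e))"
  have q: "0 \<le> q" "q < 1" using lu e by (auto simp: q_def)
  have "norm (blinfun_apply N v) \<le> q * norm v" for v
  proof -
    have "(norm (blinfun_apply N v))\<^sup>2 = (norm v)\<^sup>2 - 2 * e * (v \<bullet> (M *v v)) + e\<^sup>2 * (norm (M *v v))\<^sup>2"
      unfolding Nv power2_norm_eq_inner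
      by (simp add: inner_diff_left inner_diff_right inner_commute power2_eq_square algebra_simps)
    also have "\<dots> \<le> (norm v)\<^sup>2 - 2 * e * (l * (norm v)\<^sup>2) + e\<^sup>2 * (u * norm v)\<^sup>2"
      using lu(3)[of v] lu(4)[of v] e by (intro add_mono diff_mono mult_left_mono power_mono) auto
    also have "\<dots> = (1 - l * e) * (norm v)\<^sup>2"
      using lu by (simp add: e_def field_simps power2_eq_square)
    also have "\<dots> \<le> (q * norm v)\<^sup>2" by (simp add: q_def power_mult_distrib mult_right_mono)
    finally have sq: "(norm (blinfun_apply N v))\<^sup>2 \<le> (q * norm v)\<^sup>2" .
    show ?thesis by (rule power2_le_imp_le[OF sq]) (use q in simp)
  qed
  then have normN: "norm N \<le> q" by (intro norm_blinfun_bound q(1))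
  let ?sym = "\<lambda>Y :: (real^'m) \<Rightarrow>\<^sub>L (real^'m). \<forall>u v. u \<bullet> blinfun_apply Y v = blinfun_apply Y u \<bullet> v"
  \<comment> \<open>Symmetry is built into the complete set so that the fixed point inherits it. The
    ball of radius \<open>q < 1\<close> is invariant because (q + q^2) / 2 is at most q, and
    \<open>q\<close> also serves as contraction constant.\<close>
  define A where "A = {Y :: (real^'m) \<Rightarrow>\<^sub>L (real^'m). norm Y \<le> q \<and> ?sym Y}"
  define f where "f Y = (1/2 :: real) *\<^sub>R (N + (Y o\<^sub>L Y))" for Y
  have symN: "?sym N"
    using pos_def_mat_sym[OF M] by (simp add: Nv inner_diff_left inner_diff_right)
  have "closed A"
  proof -
    have "A = {Y. norm Y \<le> q} \<inter> (\<Inter>u. \<Inter>v. {Y. u \<bullet> blinfun_apply Y v = blinfun_apply Y u \<bullet> v})"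
      by (auto simp: A_def)
    also have "closed \<dots>"
      by (intro closed_Int closed_INT ballI closed_Collect_le closed_Collect_eq continuous_intros)
    finally show ?thesis .
  qed
  note cA = complete_eq_closed[THEN iffD2, OF this]
  have ne: "A \<noteq> {}" using q by (auto simp: A_def intro!: exI[of _ 0])
  have img: "f ` A \<subseteq> A"
  proof safe
    fix Y assume Y: "Y \<in> A"
    have "norm (f Y) \<le> (1/2) * (norm N + norm Y * norm Y)"
      unfolding f_def norm_scaleR by (intro mult_mono order_trans[OF norm_triangle_ineq] add_mono norm_blinfun_compose) auto
    also have "\<dots> \<le> (1/2) * (q + q * 1)"
      using Y q normN by (intro mult_left_mono add_mono mult_mono) (auto simp: A_def)
    finally show "f Y \<in> A"
      using Y symN by (auto simp: A_def f_def blinfun.bilinear_simps inner_add_left inner_add_right)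
  qed
  have lip: "dist (f Y) (f Z) \<le> q * dist Y Z" if YZ: "Y \<in> A" "Z \<in> A" for Y Z
  proof -
    have "f Y - f Z = (1/2 :: real) *\<^sub>R ((Y o\<^sub>L (Y - Z)) + ((Y - Z) o\<^sub>L Z))"
      by (rule blinfun_eqI) (simp add: f_def blinfun.bilinear_simps algebra_simps)
    then have "dist (f Y) (f Z) = (1/2) * norm ((Y o\<^sub>L (Y - Z)) + ((Y - Z) o\<^sub>L Z))" by (simp add: dist_norm)
    also have "\<dots> \<le> (1/2) * (norm Y * norm (Y - Z) + norm (Y - Z) * norm Z)"
      by (intro mult_left_mono order_trans[OF norm_triangle_ineq] add_mono norm_blinfun_compose) auto
    also have "\<dots> \<le> (1/2) * (q * norm (Y - Z) + norm (Y - Z) * q)"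
      using YZ q(1) by (intro mult_left_mono add_mono mult_mono) (auto simp: A_def)
    finally show ?thesis by (simp add: dist_norm mult.commute)
  qed
  obtain Y where Y: "Y \<in> A" "f Y = Y"
    using Banach_fix[OF cA ne q img lip] by blast
  \<comment> \<open>S = (1 - Y) / sqrt e has the square (1 - 2 Y + Y^2) / e; the fixed point
    equation Y^2 = 2 Y - N turns this into (1 - N) / e = M.\<close>
  define S where "S = matrix (\<lambda>v. (1 / sqrt e) *\<^sub>R (v - blinfun_apply Y v))"
  have lin: "linear (\<lambda>v. (1 / sqrt e) *\<^sub>R (v - blinfun_apply Y v))"
    by (intro bounded_linear.linear bounded_linear_const_scaleR bounded_linear_sub bounded_linear_ident blinfun.bounded_linear_right)
  have Sv: "S *v v = (1 / sqrt e) *\<^sub>R (v - blinfun_apply Y v)" for v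
    unfolding S_def using matrix_works[OF linear_matrix_vector_mul_eq[THEN iffD2, OF lin]] by simp
  have "S ** S = M"
    unfolding matrix_eq
  proof
    fix v
    have "2 *\<^sub>R blinfun_apply (f Y) v = blinfun_apply N v + blinfun_apply Y (blinfun_apply Y v)"
      by (simp add: f_def blinfun.bilinear_simps)
    then have YY: "blinfun_apply Y (blinfun_apply Y v) = 2 *\<^sub>R blinfun_apply Y v - (v - e *\<^sub>R (M *v v))"
      unfolding Y(2) Nv by simp
    have "(S ** S) *v v = S *v (S *v v)" by (simp add: matrix_vector_mul_assoc)
    also have "\<dots> = (1 / sqrt e * (1 / sqrt e)) *\<^sub>R (v - 2 *\<^sub>R blinfun_apply Y v + blinfun_apply Y (blinfun_apply Y v))"
      unfolding Sv by (simp add: blinfun.bilinear_simps algebra_simps scaleR_2)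
    also have "\<dots> = M *v v" unfolding YY using e by simp
    finally show "(S ** S) *v v = M *v v" .
  qed
  moreover have "pos_def_mat S"
    unfolding pos_def_mat_def
  proof (intro conjI allI impI)
    have "(transpose S) *v v = S *v v" for v
    proof -
      have "u \<bullet> (transpose S *v v) = u \<bullet> (S *v v)" for u
      proof -
        have "u \<bullet> (transpose S *v v) = (S *v u) \<bullet> v" by (metis dot_lmul_matrix inner_commute transpose_matrix_vector)
        also have "\<dots> = u \<bullet> (S *v v)" using Y(1) by (simp add: Sv A_def inner_diff_left inner_diff_right)
        finally show ?thesis .
      qed
      then show ?thesis using vector_eq_ldot by blast
    qed
    then show "transpose S = S" by (simp add: matrix_eq)
  next
    fix v :: "real^'m" assume v: "v \<noteq> 0"
    have "v \<bullet> blinfun_apply Y v \<le> norm v * (norm Y * norm v)"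
      by (intro order_trans[OF norm_cauchy_schwarz] mult_left_mono norm_blinfun) auto
    also have "\<dots> \<le> norm v * (q * norm v)"
      using Y(1) by (intro mult_left_mono mult_right_mono) (auto simp: A_def)
    also have "\<dots> < norm v * (1 * norm v)"
      using v q by (intro mult_strict_left_mono mult_strict_right_mono) auto
    finally have "v \<bullet> blinfun_apply Y v < v \<bullet> v" by (simp add: power2_norm_eq_inner[symmetric] power2_eq_square)
    then show "0 < v \<bullet> (S *v v)" using e by (simp add: Sv inner_diff_right)
  qed
  ultimately show ?thesis by blast
qed

lemma mat_sqrt:
  assumes "pos_def_mat M"
  shows "pos_def_mat (mat_sqrt M)" "mat_sqrt M ** mat_sqrt M = M"
proof -
  have "\<exists>!S. pos_def_mat S \<and> S ** S = M"
    using pos_def_sqrt_exists[OF assms] pos_def_sqrt_unique by metis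
  then have "pos_def_mat (mat_sqrt M) \<and> mat_sqrt M ** mat_sqrt M = M"
    unfolding mat_sqrt_def by (rule theI')
  then show "pos_def_mat (mat_sqrt M)" "mat_sqrt M ** mat_sqrt M = M" by auto
qed

section \<open>The row span and the weight vector\<close>

definition gram :: "nat \<Rightarrow> ('m::finite \<Rightarrow> nat \<Rightarrow> real) \<Rightarrow> real^'m^'m" where
  "gram n A = (\<chi> p q. \<Sum>i<n. A p i * A q i)"

lemma inner_gram: "u \<bullet> (gram n A *v v) = (\<Sum>i<n. (\<Sum>p\<in>UNIV. u $ p * A p i) * (\<Sum>q\<in>UNIV. v $ q * A q i))"
proof -
  have "u \<bullet> (gram n A *v v) = (\<Sum>p\<in>UNIV. \<Sum>q\<in>UNIV. \<Sum>i<n. (u $ p * A p i) * (v $ q * A q i))"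
    by (simp add: inner_vec_def gram_def matrix_vector_mult_def sum_distrib_left sum_distrib_right mult_ac)
  also have "\<dots> = (\<Sum>p\<in>UNIV. \<Sum>i<n. \<Sum>q\<in>UNIV. (u $ p * A p i) * (v $ q * A q i))"
    by (intro sum.cong refl sum.swap)
  also have "\<dots> = (\<Sum>i<n. \<Sum>p\<in>UNIV. \<Sum>q\<in>UNIV. (u $ p * A p i) * (v $ q * A q i))"
    by (rule sum.swap)
  finally show ?thesis by (simp add: sum_product)
qed

lemma pos_def_gram:
  assumes rank: "full_rank n A"
  shows "pos_def_mat (gram n A)"
  unfolding pos_def_mat_def
proof (intro conjI allI impI)
  show "transpose (gram n A) = gram n A"
    by (simp add: transpose_def gram_def vec_eq_iff mult.commute)
next
  fix v :: "real^'a" assume v: "v \<noteq> 0"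
  have "v \<bullet> (gram n A *v v) = (\<Sum>i<n. (\<Sum>p\<in>UNIV. v $ p * A p i)\<^sup>2)" by (simp add: inner_gram power2_eq_square)
  moreover have "(\<Sum>i<n. (\<Sum>p\<in>UNIV. v $ p * A p i)\<^sup>2) \<noteq> 0"
  proof
    assume "(\<Sum>i<n. (\<Sum>p\<in>UNIV. v $ p * A p i)\<^sup>2) = 0"
    then have "\<forall>i<n. (\<Sum>p\<in>UNIV. v $ p * A p i) = 0"
      by (subst (asm) sum_nonneg_eq_0_iff) auto
    then have "\<forall>p. v $ p = 0" using rank unfolding full_rank_def by (metis (no_types))
    then show False using v by (simp add: vec_eq_iff)
  qed
  moreover have "0 \<le> (\<Sum>i<n. (\<Sum>p\<in>UNIV. v $ p * A p i)\<^sup>2)" by (intro sum_nonneg) auto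
  ultimately show "0 < v \<bullet> (gram n A *v v)" by simp
qed

text \<open>The row span is the orthogonal complement of the kernel. Solving the normal equations
  with the Gram matrix projects \<open>w\<close> to the row span. The residue \<open>y\<close> lies
  in the kernel, hence is orthogonal to the rows, and also to \<open>w\<close> by assumption; so it
  is orthogonal to itself.\<close>

lemma row_span_of_orthogonal:
  assumes rank: "full_rank n A"
    and orth: "\<And>y. y \<in> ker_set n A \<Longrightarrow> (\<Sum>j<n. w j * y j) = 0"
  obtains c where "\<And>j. j < n \<Longrightarrow> w j = (\<Sum>l\<in>UNIV. c l * A l j)"
proof -
  define b where "b = (\<chi> l. \<Sum>j<n. A l j * w j)"
  have inv: "invertible (gram n A)" by (rule pos_def_mat_invertible[OF pos_def_gram[OF rank]])
  define c where "c = matrix_inv (gram n A) *v b"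
  have Gc: "gram n A *v c = b"
    unfolding c_def by (simp add: matrix_vector_mul_assoc matrix_inv_right[OF inv])
  define y where "y j = (if j < n then w j - (\<Sum>l\<in>UNIV. c $ l * A l j) else 0)" for j
  have "(\<Sum>j<n. A l j * y j) = 0" for l
  proof -
    have "(\<Sum>j<n. A l j * y j) = b $ l - (\<Sum>j<n. A l j * (\<Sum>q\<in>UNIV. c $ q * A q j))"
      by (simp add: y_def b_def right_diff_distrib sum_subtractf)
    also have "(\<Sum>j<n. A l j * (\<Sum>q\<in>UNIV. c $ q * A q j)) = axis l 1 \<bullet> (gram n A *v c)"
      unfolding inner_gram by (simp add: axis_def if_distrib[of "\<lambda>x. x * _"] cong: if_cong)
    also have "\<dots> = b $ l" by (simp add: Gc inner_axis')
    finally show ?thesis by simp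
  qed
  then have y: "y \<in> ker_set n A" by (simp add: ker_set_def y_def)
  have "(\<Sum>j<n. (y j)\<^sup>2) = (\<Sum>j<n. w j * y j) - (\<Sum>j<n. (\<Sum>l\<in>UNIV. c $ l * A l j) * y j)"
    unfolding sum_subtractf[symmetric] by (intro sum.cong) (auto simp: y_def power2_eq_square algebra_simps)
  also have "(\<Sum>j<n. (\<Sum>l\<in>UNIV. c $ l * A l j) * y j) = (\<Sum>l\<in>UNIV. c $ l * (\<Sum>j<n. A l j * y j))"
    unfolding sum_distrib_left sum_distrib_right by (subst sum.swap) (simp add: mult_ac)
  also have "\<dots> = 0" using y by (simp add: ker_set_def)
  finally have "(\<Sum>j<n. (y j)\<^sup>2) = 0" using orth[OF y] by simp
  then have "\<forall>j<n. y j = 0" by (subst (asm) sum_nonneg_eq_0_iff) auto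
  then show ?thesis using that[of "\<lambda>l. c $ l"] by (auto simp: y_def)
qed

text \<open>The centre maximises the product of the coordinates over the compact polytope. The
  product is continuous up to the boundary, where the logarithm is not; its maximum is positive
  because of the interior point, so the maximiser is interior. There the derivative of the sum of
  logarithms along each kernel direction vanishes: the vector of reciprocals 1 / x is orthogonal to
  the kernel.\<close>

lemma analytic_center:
  assumes K: "compact (K_set n A b)" and x0: "x0 \<in> K_set n A b" "\<And>i. i < n \<Longrightarrow> 0 < x0 i"
  obtains x where "x \<in> K_set n A b" "\<And>i. i < n \<Longrightarrow> 0 < x i"
    "\<And>y. y \<in> ker_set n A \<Longrightarrow> (\<Sum>j<n. (1 / x j) * y j) = 0"
proof -
  have cont: "continuous_on (K_set n A b) (\<lambda>x. \<Prod>j<n. x j)"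
    by (intro continuous_on_prod continuous_on_subset[OF continuous_on_product_coordinates]) auto
  obtain x where x: "x \<in> K_set n A b" "\<And>z. z \<in> K_set n A b \<Longrightarrow> (\<Prod>j<n. z j) \<le> (\<Prod>j<n. x j)"
    using continuous_attains_sup[OF K _ cont] x0(1) by blast
  have "0 < (\<Prod>j<n. x0 j)" by (intro prod_pos) (use x0 in auto)
  also have "\<dots> \<le> (\<Prod>j<n. x j)" by (rule x(2)[OF x0(1)])
  finally have P: "0 < (\<Prod>j<n. x j)" .
  have xpos: "0 < x i" if "i < n" for i
  proof -
    have "0 \<le> x i" using x(1) that by (auto simp: K_set_def)
    moreover have "x i \<noteq> 0" using P that by (metis finite_lessThan lessThan_iff less_irrefl prod_zero_iff)
    ultimately show ?thesis by simp
  qed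
  have "(\<Sum>j<n. (1 / x j) * y j) = 0" if y: "y \<in> ker_set n A" for y
  proof -
    define g where "g t = (\<Sum>j<n. ln (x j + t * y j))" for t
    have "(g has_real_derivative (\<Sum>j<n. y j / (x j + 0 * y j))) (at 0)"
      unfolding g_def[abs_def] using xpos
      by (intro DERIV_sum) (auto intro!: derivative_eq_intros)
    then have D: "DERIV g 0 :> (\<Sum>j<n. (1 / x j) * y j)" by simp
    have "\<forall>j<n. \<forall>\<^sub>F t in at (0::real). 0 < x j + t * y j"
    proof safe
      fix j assume "j < n"
      have "((\<lambda>t. x j + t * y j) \<longlongrightarrow> x j + 0 * y j) (at 0)" by (intro tendsto_intros)
      then show "\<forall>\<^sub>F t in at 0. 0 < x j + t * y j" using order_tendstoD(1)[of _ "x j"] xpos[OF \<open>j < n\<close>] by simp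
    qed
    then have "\<forall>\<^sub>F t in at (0::real). \<forall>j\<in>{..<n}. 0 < x j + t * y j"
      by (intro eventually_ball_finite) auto
    then obtain d where d: "0 < d" "\<And>t. t \<noteq> 0 \<Longrightarrow> dist t 0 < d \<Longrightarrow> \<forall>j\<in>{..<n}. 0 < x j + t * y j"
      unfolding eventually_at by auto
    have "g t \<le> g 0" if t: "\<bar>0 - t\<bar> < d" for t
    proof -
      have pos: "0 < x j + t * y j" if "j < n" for j
        using d(2)[of t] t xpos[OF that] that by (cases "t = 0") auto
      have "(\<Sum>j<n. A l j * (x j + t * y j)) = (\<Sum>j<n. A l j * x j) + t * (\<Sum>j<n. A l j * y j)" for l
        by (simp add: distrib_left sum.distrib sum_distrib_left mult_ac)
      then have "(\<lambda>j. x j + t * y j) \<in> K_set n A b"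
        using x(1) y pos by (auto simp: K_set_def ker_set_def less_imp_le)
      from x(2)[OF this] have "ln (\<Prod>j<n. x j + t * y j) \<le> ln (\<Prod>j<n. x j)"
        using P pos by (subst ln_le_cancel_iff) (auto intro!: prod_pos)
      then show ?thesis
      proof -
        have "ln (\<Prod>j<n. x j + t * y j) = g t" "ln (\<Prod>j<n. x j) = g 0"
          unfolding g_def using pos xpos by (subst ln_prod; force)+
        then show ?thesis using \<open>ln (\<Prod>j<n. x j + t * y j) \<le> ln (\<Prod>j<n. x j)\<close> by simp
      qed
    qed
    then show ?thesis using DERIV_local_max[OF D d(1)] by blast
  qed
  then show ?thesis using that x(1) xpos by blast
qed

text \<open>Existence: the reciprocals of the analytic centre lie in the row span and satisfy the
  moment equations. Uniqueness: for two solutions the difference w - w' is a combination of rows, on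
  which 1 / w and 1 / w' take the same values, so the sum of (w - w') (1 / w' - 1 / w) is 0; each
  term equals (w - w')^2 / (w w') and is nonnegative.\<close>

lemma w_vec:
  fixes A :: "'m::finite \<Rightarrow> nat \<Rightarrow> real"
  assumes rank: "full_rank n A" and K: "compact (K_set n A b)"
    and int: "\<exists>x\<in>K_set n A b. \<forall>i<n. 0 < x i"
  shows "\<And>j. j < n \<Longrightarrow> 0 < w_vec n A b j"
    and "\<And>j. n \<le> j \<Longrightarrow> w_vec n A b j = 0"
    and "\<exists>c. \<forall>j<n. w_vec n A b j = (\<Sum>l\<in>UNIV. c l * A l j)"
    and "\<And>l. (\<Sum>j<n. A l j / w_vec n A b j) = b l"
proof -
  let ?P = "\<lambda>w. (\<forall>j<n. w j > 0) \<and> (\<forall>j\<ge>n. w j = 0)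
      \<and> (\<exists>c::'m \<Rightarrow> real. \<forall>j<n. w j = (\<Sum>l\<in>UNIV. c l * A l j))
      \<and> (\<forall>l. (\<Sum>j<n. A l j / w j) = b l)"
  obtain x0 where x0: "x0 \<in> K_set n A b" "\<And>i. i < n \<Longrightarrow> 0 < x0 i" using int by blast
  obtain x where x: "x \<in> K_set n A b" "\<And>i. i < n \<Longrightarrow> 0 < x i"
    "\<And>y. y \<in> ker_set n A \<Longrightarrow> (\<Sum>j<n. (1 / x j) * y j) = 0"
    by (rule analytic_center[OF K x0]) blast+
  obtain c where c: "\<And>j. j < n \<Longrightarrow> 1 / x j = (\<Sum>l\<in>UNIV. c l * A l j)"
    by (rule row_span_of_orthogonal[OF rank x(3)]) blast+
  have ex: "?P (\<lambda>j. if j < n then 1 / x j else 0)"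
  proof (intro conjI)
    show "\<exists>c. \<forall>j<n. (if j < n then 1 / x j else 0) = (\<Sum>l\<in>UNIV. c l * A l j)"
      using c by (intro exI[of _ c]) simp
    show "\<forall>l. (\<Sum>j<n. A l j / (if j < n then 1 / x j else 0)) = b l"
      using x(1) by (simp add: K_set_def)
  qed (use x(2) in auto)
  have uniq: "w = w'" if w: "?P w" and w': "?P w'" for w w'
  proof -
    obtain c where c: "\<And>j. j < n \<Longrightarrow> w j = (\<Sum>l\<in>UNIV. c l * A l j)" using w by blast
    obtain c' where c': "\<And>j. j < n \<Longrightarrow> w' j = (\<Sum>l\<in>UNIV. c' l * A l j)" using w' by blast
    have "(\<Sum>j<n. (w j - w' j) * (1 / w' j - 1 / w j)) = (\<Sum>j<n. \<Sum>l\<in>UNIV. (c l - c' l) * (A l j / w' j - A l j / w j))"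
    proof (rule sum.cong[OF refl])
      fix j assume "j \<in> {..<n}"
      then have "w j - w' j = (\<Sum>l\<in>UNIV. (c l - c' l) * A l j)"
        by (simp add: c c' sum_subtractf left_diff_distrib)
      then show "(w j - w' j) * (1 / w' j - 1 / w j) = (\<Sum>l\<in>UNIV. (c l - c' l) * (A l j / w' j - A l j / w j))"
        by (simp only: sum_distrib_right) (simp add: right_diff_distrib)
    qed
    also have "\<dots> = (\<Sum>l\<in>UNIV. (c l - c' l) * ((\<Sum>j<n. A l j / w' j) - (\<Sum>j<n. A l j / w j)))"
      by (subst sum.swap) (simp only: sum_distrib_left[symmetric] sum_subtractf)
    also have "\<dots> = 0" using w w' by simp
    finally have s0: "(\<Sum>j<n. (w j - w' j) * (1 / w' j - 1 / w j)) = 0" .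
    have t: "(w j - w' j) * (1 / w' j - 1 / w j) = (w j - w' j)\<^sup>2 / (w j * w' j)" if "j < n" for j
    proof -
      have "w j \<noteq> 0" "w' j \<noteq> 0" using w w' that by (metis less_irrefl)+
      then show ?thesis by (simp add: field_simps power2_eq_square)
    qed
    have "\<forall>j\<in>{..<n}. (w j - w' j) * (1 / w' j - 1 / w j) = 0"
    proof (subst sum_nonneg_eq_0_iff[symmetric])
      fix j assume "j \<in> {..<n}"
      then show "0 \<le> (w j - w' j) * (1 / w' j - 1 / w j)"
        using w w' by (simp add: t less_imp_le)
    qed (use s0 in auto)
    then have "w j = w' j" if "j < n" for j
    proof -
      assume "\<forall>j\<in>{..<n}. (w j - w' j) * (1 / w' j - 1 / w j) = 0"
      then have "(w j - w' j) * (1 / w' j - 1 / w j) = 0" using that by blast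
      then have "(w j - w' j)\<^sup>2 / (w j * w' j) = 0" unfolding t[OF that] .
      moreover have "0 < w j" "0 < w' j" using w w' that by blast+
      ultimately show ?thesis by simp
    qed
    then show "w = w'" using w w' by (metis ext not_le)
  qed
  have "\<exists>!w. ?P w" by (rule ex1I[of ?P, OF ex]) (rule uniq[OF _ ex])
  then have "?P (w_vec n A b)" unfolding w_vec_def by (rule theI')
  then show "\<And>j. j < n \<Longrightarrow> 0 < w_vec n A b j"
    and "\<And>j. n \<le> j \<Longrightarrow> w_vec n A b j = 0"
    and "\<exists>c. \<forall>j<n. w_vec n A b j = (\<Sum>l\<in>UNIV. c l * A l j)"
    and "\<And>l. (\<Sum>j<n. A l j / w_vec n A b j) = b l"
    by auto
qed

section \<open>Gaussian and exponential integrals\<close>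

lemma measurable_vec_lambda [measurable]:
  assumes "\<And>i. (\<lambda>x. g x i) \<in> borel_measurable M"
  shows "(\<lambda>x. (\<chi> i. g x i) :: real^'k::finite) \<in> borel_measurable M"
proof -
  have "(\<lambda>x. (\<chi> i. g x i) :: real^'k) = (\<lambda>x. \<Sum>i\<in>UNIV. g x i *\<^sub>R axis i 1)"
    by (simp add: fun_eq_iff vec_eq_iff axis_def if_distrib cong: if_cong)
  then show ?thesis using assms by simp
qed

lemma lborel_vec_eq_PiM:
  "(lborel :: (real^'m::finite) measure) = distr (PiM UNIV (\<lambda>_. lborel)) borel (\<lambda>f. \<chi> i. f i)"
proof (rule lborel_eqI)
  interpret product_sigma_finite "\<lambda>_::'m. lborel :: real measure" by standard
  have meas [measurable]: "(\<lambda>f. \<chi> i. f i) \<in> measurable (PiM UNIV (\<lambda>_::'m. lborel :: real measure)) borel"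
    by measurable
  fix l u :: "real^'m" assume lu: "\<And>b. b \<in> Basis \<Longrightarrow> l \<bullet> b \<le> u \<bullet> b"
  then have lu': "l $ i \<le> u $ i" for i
    using lu[of "axis i 1"] by (simp add: inner_axis axis_in_Basis_iff)
  have "emeasure (distr (PiM UNIV (\<lambda>_. lborel)) borel (\<lambda>f. (\<chi> i. f i) :: real^'m)) (box l u)
      = emeasure (PiM UNIV (\<lambda>_::'m. lborel)) ((\<lambda>f. \<chi> i. f i) -` box l u \<inter> space (PiM UNIV (\<lambda>_::'m. lborel :: real measure)))"
    by (rule emeasure_distr) auto
  also have "(\<lambda>f. \<chi> i. f i) -` box l u \<inter> space (PiM UNIV (\<lambda>_::'m. lborel :: real measure))
      = PiE UNIV (\<lambda>i. {l $ i <..< u $ i})"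
    by (auto simp: mem_box_cart space_PiM PiE_def Pi_def)
  also have "emeasure (PiM UNIV (\<lambda>_::'m. lborel)) \<dots> = (\<Prod>i\<in>UNIV. ennreal (u $ i - l $ i))"
    using lu' by (subst emeasure_PiM) auto
  also have "\<dots> = ennreal (\<Prod>i\<in>UNIV. (u - l) $ i)"
    using lu' by (simp add: prod_ennreal)
  also have "(\<Prod>i\<in>UNIV. (u - l) $ i) = (\<Prod>b\<in>Basis. (u - l) \<bullet> b)"
  proof -
    have "(Basis :: (real^'m) set) = range (\<lambda>i. axis i 1)" by (auto simp: Basis_vec_def)
    moreover have "inj (\<lambda>i::'m. axis i (1::real))" by (auto simp: inj_on_def axis_eq_axis)
    ultimately show ?thesis
      using prod.reindex[of "\<lambda>i. axis i 1" UNIV "\<lambda>b. (u - l) \<bullet> b"] by (simp add: inner_axis)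
  qed
  finally show "emeasure (distr (PiM UNIV (\<lambda>_. lborel)) borel (\<lambda>f. (\<chi> i. f i) :: real^'m)) (box l u)
      = ennreal (\<Prod>b\<in>Basis. (u - l) \<bullet> b)" .
qed simp

lemma
  fixes f :: "'m::finite \<Rightarrow> real \<Rightarrow> 'b::{real_normed_field,banach,second_countable_topology}"
  assumes f: "\<And>i. integrable lborel (f i)"
  shows integrable_prod_vec: "integrable lborel (\<lambda>t::real^'m. \<Prod>i\<in>UNIV. f i (t $ i))" (is ?I)
    and integral_prod_vec: "(\<integral>t. (\<Prod>i\<in>UNIV. f i (t $ i)) \<partial>(lborel :: (real^'m) measure)) = (\<Prod>i\<in>UNIV. \<integral>x. f i x \<partial>lborel)" (is ?E)
proof -
  interpret product_sigma_finite "\<lambda>_::'m. lborel :: real measure" by standard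
  have [measurable]: "f i \<in> borel_measurable borel" for i using f[of i] by auto
  have meas [measurable]: "(\<lambda>f. \<chi> i. f i) \<in> measurable (PiM UNIV (\<lambda>_::'m. lborel :: real measure)) borel"
    by measurable
  have g [measurable]: "(\<lambda>t::real^'m. \<Prod>i\<in>UNIV. f i (t $ i)) \<in> borel_measurable borel"
    by measurable
  show ?I
    unfolding lborel_vec_eq_PiM
    by (subst integrable_distr_eq) (auto intro!: product_integrable_prod f)
  show ?E
    unfolding lborel_vec_eq_PiM
    by (subst integral_distr) (auto intro!: product_integral_prod f)
qed

definition gauss :: "real^'m::finite \<Rightarrow> real" where
  "gauss t = (\<Prod>i\<in>UNIV. std_normal_density (t $ i))"

text \<open>The normalising constant (2 pi)^(-m/2) is carried along as \<open>gauss 0\<close>; it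
  cancels in the end and is never evaluated.\<close>

lemma gauss_eq: "gauss (t :: real^'m::finite) = gauss (0 :: real^'m) * exp (- (norm t)\<^sup>2 / 2)"
proof -
  have "(norm t)\<^sup>2 = (\<Sum>i\<in>UNIV. (t $ i)\<^sup>2)"
    by (simp add: norm_vec_def L2_set_def sum_nonneg)
  then show ?thesis
    unfolding gauss_def std_normal_density_def
    by (simp add: exp_sum[symmetric] sum_negf sum_divide_distrib power_divide prod_dividef)
qed

lemma gauss_pos: "0 < gauss t"
  unfolding gauss_def by (intro prod_pos) (simp add: normal_density_pos)

lemma gauss_le: "gauss (t :: real^'m::finite) \<le> gauss (0 :: real^'m)"
  using gauss_pos[of "0::real^'m"] by (subst gauss_eq) simp

lemma measurable_gauss [measurable]: "gauss \<in> borel_measurable borel"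
  unfolding gauss_def[abs_def] by measurable

lemma integrable_gauss: "integrable lborel (gauss :: real^'m::finite \<Rightarrow> real)"
  unfolding gauss_def[abs_def] by (intro integrable_prod_vec) simp

lemma integral_gauss: "(\<integral>t. gauss t \<partial>(lborel :: (real^'m::finite) measure)) = 1"
  unfolding gauss_def[abs_def]
  by (subst integral_prod_vec) (auto intro: integrable_normal_density)

text \<open>The integrand factors over coordinates, and each factor integrates to the characteristic
  function of the standard normal law.\<close>

lemma gauss_fourier:
  "(\<integral>t. gauss t *\<^sub>R iexp (t \<bullet> x) \<partial>(lborel :: (real^'m::finite) measure)) = exp (- (norm x)\<^sup>2 / 2)"
proof -
  have int: "integrable lborel (\<lambda>u. std_normal_density u *\<^sub>R iexp (x $ i * u))" for i
  proof (rule Bochner_Integration.integrable_bound[OF integrable_normal_density])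
  qed (auto simp: norm_mult)
  have "gauss t *\<^sub>R iexp (t \<bullet> x) = (\<Prod>i\<in>UNIV. std_normal_density (t $ i) *\<^sub>R iexp (x $ i * t $ i))" for t
    by (simp add: gauss_def inner_vec_def scaleR_conv_of_real prod.distrib exp_sum[symmetric]
        sum_distrib_left mult.commute)
  then have "(\<integral>t. gauss t *\<^sub>R iexp (t \<bullet> x) \<partial>(lborel :: (real^'m) measure))
     = (\<Prod>i\<in>UNIV. \<integral>u. std_normal_density u *\<^sub>R iexp (x $ i * u) \<partial>lborel)"
    using integral_prod_vec[OF int] by simp
  also have "\<dots> = (\<Prod>i\<in>UNIV. char std_normal_distribution (x $ i))"
    unfolding char_def by (intro prod.cong refl integral_density[symmetric]) (auto simp: normal_density_nonneg)
  also have "\<dots> = (\<Prod>i\<in>UNIV. complex_of_real (exp (- (x $ i)\<^sup>2 / 2)))"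
    by (simp add: char_std_normal_distribution)
  also have "\<dots> = complex_of_real (exp (\<Sum>i\<in>UNIV. - (x $ i)\<^sup>2 / 2))"
    by (simp add: exp_sum)
  also have "(\<Sum>i\<in>UNIV. - (x $ i)\<^sup>2 / 2) = - (norm x)\<^sup>2 / 2"
    by (simp add: norm_vec_def L2_set_def sum_nonneg sum_negf sum_divide_distrib)
  finally show ?thesis by simp
qed

lemma lborel_scale:
  assumes r: "0 < r"
  shows "lborel = density (distr lborel borel (\<lambda>x::'a::euclidean_space. r *\<^sub>R x)) (\<lambda>_. ennreal (r ^ DIM('a)))"
  using lborel_affine[of r "0::'a"] r by simp

lemma nn_integral_lborel_scale:
  fixes g :: "'a::euclidean_space \<Rightarrow> ennreal"
  assumes r: "0 < r" and [measurable]: "g \<in> borel_measurable borel"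
  shows "(\<integral>\<^sup>+x. g x \<partial>lborel) = (\<integral>\<^sup>+x. ennreal (r ^ DIM('a)) * g (r *\<^sub>R x) \<partial>lborel)"
  by (subst lborel_scale[OF r]) (simp add: nn_integral_density nn_integral_distr)

lemma integral_lborel_scale:
  fixes g :: "'a::euclidean_space \<Rightarrow> 'b::{banach, second_countable_topology}"
  assumes r: "0 < r" and [measurable]: "g \<in> borel_measurable borel"
  shows "(\<integral>x. g x \<partial>lborel) = (\<integral>x. r ^ DIM('a) *\<^sub>R g (r *\<^sub>R x) \<partial>lborel)"
  using r by (subst lborel_scale[OF r]) (simp add: integral_density integral_distr)

lemma integrable_inverse_square: "integrable lborel (\<lambda>x::real. 1 / (1 + x\<^sup>2))"
  using integrable_inverse_1_plus_square
  by (simp add: set_integrable_def einterval_def inverse_eq_divide)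

text \<open>The exponent m is dictated by this comparison: 1 + |t|^2 dominates each 1 + t_i^2, so
  its m-th power dominates their product, whose reciprocal is integrable by Fubini.\<close>

lemma integrable_norm_power:
  "integrable lborel (\<lambda>t::real^'m::finite. 1 / (1 + (norm t)\<^sup>2) ^ CARD('m))"
proof (rule Bochner_Integration.integrable_bound)
  show "integrable lborel (\<lambda>t::real^'m. \<Prod>i\<in>UNIV. 1 / (1 + (t $ i)\<^sup>2))"
    by (intro integrable_prod_vec integrable_inverse_square)
  show "AE t::real^'m in lborel. norm (1 / (1 + (norm t)\<^sup>2) ^ CARD('m)) \<le> norm (\<Prod>i\<in>UNIV. 1 / (1 + (t $ i)\<^sup>2))"
  proof (rule AE_I2)
    fix t :: "real^'m"
    have "(\<Prod>i\<in>UNIV. 1 + (t $ i)\<^sup>2) \<le> (\<Prod>i\<in>(UNIV :: 'm set). 1 + (norm t)\<^sup>2)"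
    proof (rule prod_mono)
      fix i
      have "\<bar>t $ i\<bar> \<le> norm t" by (rule component_le_norm_cart)
      then show "0 \<le> 1 + (t $ i)\<^sup>2 \<and> 1 + (t $ i)\<^sup>2 \<le> 1 + (norm t)\<^sup>2"
        by (simp add: abs_le_square_iff[symmetric])
    qed
    moreover have "0 < (\<Prod>i\<in>UNIV. 1 + (t $ i)\<^sup>2)"
      by (intro prod_pos) (simp add: add_pos_nonneg)
    ultimately have "1 / (1 + (norm t)\<^sup>2) ^ CARD('m) \<le> 1 / (\<Prod>i\<in>UNIV. 1 + (t $ i)\<^sup>2)"
      by (intro divide_left_mono) (auto intro!: mult_pos_pos zero_less_power add_pos_nonneg)
    then show "norm (1 / (1 + (norm t)\<^sup>2) ^ CARD('m)) \<le> norm (\<Prod>i\<in>UNIV. 1 / (1 + (t $ i)\<^sup>2))"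
      by (simp add: prod_dividef abs_prod)
  qed
qed measurable

section \<open>The standard exponential law\<close>

abbreviation "expo \<equiv> density lborel (exponential_density 1) :: real measure"

lemma prob_space_expo: "prob_space expo"
  by (rule prob_space_exponential_density) simp

text \<open>With z = 1 - i \<theta> the integrand is exp(-x z), with primitive -exp(-x z) / z; since
  Re z = 1 it is absolutely integrable and the primitive vanishes at infinity.\<close>

lemma iexp_exponential_integral:
  "(\<integral>x. iexp (\<theta> * x) \<partial>expo) = 1 / (1 - \<i> * complex_of_real \<theta>)"
proof -
  define z where "z = 1 - \<i> * complex_of_real \<theta>"
  have z: "z \<noteq> 0" "Re z = 1" by (auto simp: z_def complex_eq_iff)
  let ?f = "\<lambda>x::real. exp (- (complex_of_real x * z))"
  let ?F = "\<lambda>x::real. - exp (- (complex_of_real x * z)) / z"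
  have nf: "norm (?f x) = exp (- x)" for x by (simp add: norm_exp_eq_Re z_def)
  have int: "set_integrable lborel (einterval 0 \<infinity>) ?f"
  proof -
    have "integrable lborel (exponential_density 1)"
    proof (rule integrableI_nonneg)
      have "emeasure expo (space expo) = 1" using prob_space_expo by (rule prob_space.emeasure_space_1)
      then show "(\<integral>\<^sup>+x. ennreal (exponential_density 1 x) \<partial>lborel) < \<infinity>"
        by (simp add: emeasure_density)
    qed (auto simp: exponential_density_nonneg)
    then show ?thesis
      unfolding set_integrable_def
    proof (rule Bochner_Integration.integrable_bound)
      show "AE x in lborel. norm (indicat_real (einterval 0 \<infinity>) x *\<^sub>R ?f x) \<le> norm (exponential_density 1 x)"
        by (rule AE_I2) (auto simp: indicator_def nf z(2) exponential_density_def einterval_def)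
    qed measurable
  qed
  have "(LBINT x=0..\<infinity>. ?f x) = 0 - (- 1 / z)"
  proof (rule interval_integral_FTC_integrable[where F="?F"])
    fix x :: real
    show "(?F has_vector_derivative ?f x) (at x)"
      using z(1) by (auto intro!: derivative_eq_intros has_vector_derivative_real_field simp: has_field_derivative_def)
    show "isCont ?f x" by (intro continuous_intros)
  next
    have "isCont ?F 0" by (intro continuous_intros z)
    then have "(?F \<longlongrightarrow> - 1 / z) (at_right 0)"
      unfolding isCont_def by (auto intro: tendsto_within_subset)
    then show "((?F \<circ> real_of_ereal) \<longlongrightarrow> - 1 / z) (at_right 0)"
      unfolding zero_ereal_def ereal_tendsto_simps1 .
    have "((\<lambda>x::real. exp (- x) / norm z) \<longlongrightarrow> 0 / norm z) at_top"
      using z by (intro tendsto_divide tendsto_const filterlim_compose[OF exp_at_bot] filterlim_uminus_at_bot_at_top) auto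
    then have "(?F \<longlongrightarrow> 0) at_top"
      by (subst tendsto_norm_zero_iff[symmetric]) (simp add: norm_divide nf z(2))
    then show "((?F \<circ> real_of_ereal) \<longlongrightarrow> 0) (at_left \<infinity>)"
      unfolding ereal_tendsto_simps1 .
  qed (use int in simp_all)
  then have "(\<integral>x. indicator {0<..} x *\<^sub>R ?f x \<partial>lborel) = 1 / z"
    by (simp add: interval_lebesgue_integral_def set_lebesgue_integral_def einterval_def greaterThan_def)
  moreover have "(\<integral>x. iexp (\<theta> * x) \<partial>expo) = (\<integral>x. exponential_density 1 x *\<^sub>R iexp (\<theta> * x) \<partial>lborel)"
    by (rule integral_density) (auto simp: exponential_density_nonneg)
  moreover have "\<dots> = (\<integral>x. indicator {0<..} x *\<^sub>R ?f x \<partial>lborel)"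
  proof (rule integral_cong_AE)
    \<comment> \<open>The density is 1 at 0, whereas the interval of integration is open, hence an
      identity only off the point 0.\<close>
    show "AE x in lborel. exponential_density 1 x *\<^sub>R iexp (\<theta> * x) = indicator {0<..} x *\<^sub>R ?f x"
      using AE_lborel_singleton[of 0]
    proof eventually_elim
      fix x :: real assume "x \<noteq> 0"
      moreover have "?f x = complex_of_real (exp (- x)) * iexp (\<theta> * x)"
        unfolding exp_of_real[symmetric] exp_add[symmetric] z_def by (simp add: algebra_simps)
      ultimately show "exponential_density 1 x *\<^sub>R iexp (\<theta> * x) = indicator {0<..} x *\<^sub>R ?f x"
        by (auto simp: exponential_density_def indicator_def scaleR_conv_of_real)
    qed
  qed measurable
  ultimately show ?thesis by (simp add: z_def)
qed

lemma PiM_density_lborel: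
  fixes f :: "'i \<Rightarrow> real \<Rightarrow> ennreal"
  assumes I: "finite I" and [measurable]: "\<And>i. f i \<in> borel_measurable borel"
    and sf: "\<And>i. sigma_finite_measure (density lborel (f i))"
  shows "PiM I (\<lambda>i. density lborel (f i)) = density (PiM I (\<lambda>_. lborel)) (\<lambda>x. \<Prod>i\<in>I. f i (x i))"
proof -
  interpret L: product_sigma_finite "\<lambda>_::'i. lborel :: real measure" by standard
  interpret D: product_sigma_finite "\<lambda>i::'i. density lborel (f i)" using sf by (simp add: product_sigma_finite_def)
  show ?thesis
  proof (rule D.PiM_eqI[symmetric, OF I])
    show "sets (density (PiM I (\<lambda>_. lborel)) (\<lambda>x. \<Prod>i\<in>I. f i (x i))) = sets (PiM I (\<lambda>i. density lborel (f i)))"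
      unfolding sets_density by (rule sets_PiM_cong) auto
    fix A assume A: "\<And>i. i \<in> I \<Longrightarrow> A i \<in> sets (density lborel (f i))"
    then have [measurable]: "\<And>i. i \<in> I \<Longrightarrow> A i \<in> sets borel" by simp
    have comp: "(\<lambda>x. x i) \<in> borel_measurable (PiM I (\<lambda>_. lborel :: real measure))" if "i \<in> I" for i
      using measurable_component_singleton[OF that, of "\<lambda>_. lborel :: real measure"] by simp
    have "emeasure (density (PiM I (\<lambda>_. lborel)) (\<lambda>x. \<Prod>i\<in>I. f i (x i))) (PiE I A)
       = (\<integral>\<^sup>+x. (\<Prod>i\<in>I. f i (x i)) * indicator (PiE I A) x \<partial>PiM I (\<lambda>_. lborel))"
      using I A comp by (intro emeasure_density borel_measurable_prod_ennreal sets_PiM_I_finite)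
        (auto intro: measurable_compose[of _ _ borel "f _"])
    also have "\<dots> = (\<integral>\<^sup>+x. (\<Prod>i\<in>I. f i (x i) * indicator (A i) (x i)) \<partial>PiM I (\<lambda>_. lborel))"
    proof (rule nn_integral_cong)
      fix x assume "x \<in> space (PiM I (\<lambda>_. lborel :: real measure))"
      then have "(indicator (PiE I A) x :: ennreal) = (\<Prod>i\<in>I. indicator (A i) (x i))"
        using I by (auto simp: indicator_def space_PiM PiE_def Pi_def)
      then show "(\<Prod>i\<in>I. f i (x i)) * indicator (PiE I A) x = (\<Prod>i\<in>I. f i (x i) * indicator (A i) (x i))"
        by (simp add: prod.distrib)
    qed
    also have "\<dots> = (\<Prod>i\<in>I. \<integral>\<^sup>+x. f i x * indicator (A i) x \<partial>lborel)"
      by (rule L.product_nn_integral_prod[OF I, of "\<lambda>i x. f i x * indicator (A i) x"]) simp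
    also have "\<dots> = (\<Prod>i\<in>I. emeasure (density lborel (f i)) (A i))"
      by (intro prod.cong refl) (simp add: emeasure_density)
    finally show "emeasure (density (PiM I (\<lambda>_. lborel)) (\<lambda>x. \<Prod>i\<in>I. f i (x i))) (PiE I A)
       = (\<Prod>i\<in>I. emeasure (density lborel (f i)) (A i))" .
  qed
qed

text \<open>The upper estimate follows from (1 + u + u^2/2) (1 - u + u^2/2) = 1 + u^4/4, which is at
  least 1, together with the quadratic lower bound for exp u.\<close>

lemma exp_minus_approx:
  fixes u :: real
  assumes u: "0 \<le> u"
  shows "\<bar>exp (- u) - (1 - u)\<bar> \<le> u\<^sup>2 / 2"
proof -
  have "1 - u \<le> exp (- u)" using exp_ge_add_one_self[of "- u"] by simp
  moreover have "exp (- u) \<le> 1 - u + u\<^sup>2 / 2"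
  proof -
    have "(1 + u + u\<^sup>2 / 2) * (1 - u + u\<^sup>2 / 2) = 1 + u ^ 4 / 4"
      by (simp add: field_simps power2_eq_square power4_eq_xxxx)
    then have "1 \<le> (1 + u + u\<^sup>2 / 2) * (1 - u + u\<^sup>2 / 2)" by simp
    also have "\<dots> \<le> exp u * (1 - u + u\<^sup>2 / 2)"
    proof (rule mult_right_mono)
      show "1 + u + u\<^sup>2 / 2 \<le> exp u" using exp_lower_Taylor_quadratic[OF u] .
      have "1 - u + u\<^sup>2 / 2 = ((1 - u)\<^sup>2 + 1) / 2" by (simp add: power2_diff field_simps)
      also have "0 \<le> \<dots>" by simp
      finally show "0 \<le> 1 - u + u\<^sup>2 / 2" .
    qed
    finally show ?thesis by (simp add: exp_minus field_simps)
  qed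
  ultimately show ?thesis by (simp add: abs_le_iff)
qed

text \<open>Multiplied by 1 - i \<theta>, which has modulus at least 1, the difference compares
  exp(-i \<theta>) with (1 - i \<theta>) exp(-\<theta>^2/2). These agree to second order. The Taylor
  remainders \<open>R1\<close> and \<open>R2\<close> and the leftover product i \<theta>^3/2
  contribute at most 1/6 + 1/2 + 2/8 < 1 times |\<theta>|^3.\<close>

lemma expo_cf_approx:
  fixes \<theta> :: real
  assumes "\<bar>\<theta>\<bar> \<le> 1"
  shows "norm (iexp (- \<theta>) / (1 - \<i> * complex_of_real \<theta>) - complex_of_real (exp (- \<theta>\<^sup>2 / 2))) \<le> \<bar>\<theta>\<bar> ^ 3"
proof -
  define z where "z = 1 - \<i> * complex_of_real \<theta>"
  have z1: "1 \<le> norm z" using abs_Re_le_cmod[of z] by (simp add: z_def)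
  then have z0: "z \<noteq> 0" by auto
  define R1 where "R1 = iexp (- \<theta>) - (1 - \<i> * \<theta> - \<theta>\<^sup>2 / 2)"
  define R2 where "R2 = exp (- \<theta>\<^sup>2 / 2) - (1 - \<theta>\<^sup>2 / 2)"
  have R1: "norm R1 \<le> \<bar>\<theta>\<bar> ^ 3 / 6"
  proof -
    have "(\<Sum>k\<le>2. (\<i> * complex_of_real (- \<theta>)) ^ k / fact k) = 1 - \<i> * \<theta> - \<theta>\<^sup>2 / 2"
      by (simp add: numeral_2_eq_2 power2_eq_square flip: of_real_mult) (simp add: algebra_simps)
    then show ?thesis
      using iexp_approx1[of "- \<theta>" 2] by (simp add: R1_def fact_numeral numeral_3_eq_3)
  qed
  have R2: "\<bar>R2\<bar> \<le> \<bar>\<theta>\<bar> ^ 3 / 8"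
  proof -
    have "\<bar>R2\<bar> \<le> (\<theta>\<^sup>2 / 2)\<^sup>2 / 2"
      using exp_minus_approx[of "\<theta>\<^sup>2 / 2"] by (simp add: R2_def)
    also have "\<dots> = \<bar>\<theta>\<bar> ^ 3 * \<bar>\<theta>\<bar> / 8"
      by (simp add: power2_eq_square power3_eq_cube)
    also have "\<dots> \<le> \<bar>\<theta>\<bar> ^ 3 / 8"
      using assms mult_left_mono[OF assms, of "\<bar>\<theta>\<bar> ^ 3"] by simp
    finally show ?thesis .
  qed
  have nz: "norm z \<le> 2"
    using norm_triangle_ineq4[of 1 "\<i> * complex_of_real \<theta>"] assms by (simp add: z_def norm_mult)
  have "iexp (- \<theta>) / z - complex_of_real (exp (- \<theta>\<^sup>2 / 2)) = (iexp (- \<theta>) - z * exp (- \<theta>\<^sup>2 / 2)) / z"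
    using z0 by (simp add: field_simps)
  also have "iexp (- \<theta>) - z * exp (- \<theta>\<^sup>2 / 2) = R1 - \<i> * \<theta> ^ 3 / 2 - z * R2"
  proof -
    have e1: "iexp (- \<theta>) = R1 + (1 - \<i> * \<theta> - \<theta>\<^sup>2 / 2)" by (simp add: R1_def)
    have e2: "complex_of_real (exp (- \<theta>\<^sup>2 / 2)) = R2 + (1 - \<theta>\<^sup>2 / 2)" by (simp add: R2_def)
    show ?thesis unfolding e1 e2 z_def by (simp add: field_simps power2_eq_square power3_eq_cube)
  qed
  also have "norm (\<dots> / z) \<le> norm (R1 - \<i> * \<theta> ^ 3 / 2 - z * R2)"
    using z1 by (simp add: norm_divide divide_le_eq mult_left_le zero_less_mult_iff mult_le_cancel_left1)
  also have "\<dots> \<le> norm R1 + norm (\<i> * complex_of_real (\<theta> ^ 3) / 2) + norm (z * R2)"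
    by (intro order_trans[OF norm_triangle_ineq4] add_mono order_refl norm_triangle_ineq4)
  also have "\<dots> \<le> \<bar>\<theta>\<bar> ^ 3 / 6 + \<bar>\<theta>\<bar> ^ 3 / 2 + 2 * (\<bar>\<theta>\<bar> ^ 3 / 8)"
    unfolding norm_mult norm_divide norm_power
    using R1 nz R2 by (intro add_mono mult_mono) (auto simp: norm_power)
  also have "\<dots> \<le> \<bar>\<theta>\<bar> ^ 3" by simp
  finally show ?thesis by (simp add: z_def)
qed

text \<open>By concavity of ln(1 + x), the product is smallest when the given sum is concentrated in
  as few terms of maximal size \<open>d\<close> as possible. The proof uses the termwise form (1 +
  d)^(x/d) <= 1 + x for 0 <= x <= d, which is convexity of exp between 0 and ln(1 + d).\<close>

lemma prod_one_plus_ge: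
  fixes x :: "'i \<Rightarrow> real"
  assumes S: "finite S" and x: "\<And>i. i \<in> S \<Longrightarrow> 0 \<le> x i" "\<And>i. i \<in> S \<Longrightarrow> x i \<le> d"
    and sum: "real p * d \<le> (\<Sum>i\<in>S. x i)" and d: "0 \<le> d"
  shows "(1 + d) ^ p \<le> (\<Prod>i\<in>S. 1 + x i)"
proof (cases "d = 0")
  case True
  then show ?thesis using x by (simp add: prod_ge_1)
next
  case False
  then have d: "0 < d" using d by simp
  have bern: "(1 + d) powr (x i / d) \<le> 1 + x i" if i: "i \<in> S" for i
  proof -
    define u where "u = x i / d"
    have u: "0 \<le> u" "u \<le> 1" using x[OF i] d by (auto simp: u_def)
    have "exp ((1 - u) *\<^sub>R 0 + u *\<^sub>R ln (1 + d)) \<le> (1 - u) * exp 0 + u * exp (ln (1 + d))"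
      by (rule convex_onD[OF exp_convex]) (use u in auto)
    then have "(1 + d) powr u \<le> (1 - u) + u * (1 + d)" using d by (simp add: powr_def)
    also have "\<dots> = 1 + x i" using d by (simp add: u_def field_simps)
    finally show ?thesis by (simp add: u_def)
  qed
  have "(1 + d) ^ p = (1 + d) powr real p" using d by (simp add: powr_realpow)
  also have "\<dots> \<le> (1 + d) powr ((\<Sum>i\<in>S. x i) / d)"
    using d sum by (intro powr_mono) (auto simp: pos_le_divide_eq)
  also have "\<dots> = (\<Prod>i\<in>S. (1 + d) powr (x i / d))"
    using d S by (subst powr_sum[symmetric]) (auto simp: sum_divide_distrib)
  also have "\<dots> \<le> (\<Prod>i\<in>S. 1 + x i)"
    using bern by (intro prod_mono) auto
  finally show ?thesis .
qed

section \<open>The local limit of the characteristic functions\<close>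

text \<open>The characteristic function of V - 1 for a standard exponential V.\<close>

definition ecf :: "real \<Rightarrow> complex" where
  "ecf \<theta> = iexp (- \<theta>) / (1 - \<i> * complex_of_real \<theta>)"

lemma expo_centred_cf: "(\<integral>x. iexp (\<theta> * (x - 1)) \<partial>expo) = ecf \<theta>"
proof -
  have "iexp (\<theta> * (x - 1)) = iexp (- \<theta>) * iexp (\<theta> * x)" for x
    unfolding exp_add[symmetric] by (simp add: algebra_simps)
  then show ?thesis
    by (simp only: integral_mult_right_zero iexp_exponential_integral ecf_def) simp
qed

lemma norm_ecf: "norm (ecf \<theta>) = 1 / sqrt (1 + \<theta>\<^sup>2)"
proof -
  have "norm (1 - \<i> * complex_of_real \<theta>) = sqrt (1 + \<theta>\<^sup>2)" by (simp add: cmod_def)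
  then show ?thesis unfolding ecf_def norm_divide by (simp only: norm_exp_i_times)
qed

lemma norm_ecf_le_1: "norm (ecf \<theta>) \<le> 1"
proof -
  have "1 \<le> sqrt (1 + \<theta>\<^sup>2)" by simp
  then show ?thesis unfolding norm_ecf by (subst divide_le_eq_1_pos) linarith+
qed

lemma measurable_ecf [measurable]: "ecf \<in> borel_measurable borel"
  unfolding ecf_def[abs_def] by measurable

text \<open>The part of E[exp(i t . S) f(V)] that involves the selected coordinates,
  \<open>u i\<close> being their columns. The test function enters the Fourier integral only through
  this factor.\<close>

definition sel_cf :: "('k::finite \<Rightarrow> real^'m::finite) \<Rightarrow> (real^'k \<Rightarrow> real) \<Rightarrow> real^'m \<Rightarrow> complex" where
  "sel_cf u f t = (\<integral>y. iexp (\<Sum>i\<in>UNIV. (u i \<bullet> t) * (y i - 1)) * complex_of_real (f (\<chi> i. y i)) \<partial>PiM UNIV (\<lambda>_. expo))"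

lemma prob_space_PiM_expo: "prob_space (PiM (UNIV :: 'k::finite set) (\<lambda>_. expo))"
  by (rule prob_space_PiM) (rule prob_space_expo)

lemma measurable_PiM_expo_f:
  fixes f :: "real^'k::finite \<Rightarrow> real"
  assumes fm: "f \<in> borel_measurable borel"
  shows "(\<lambda>y. f (\<chi> i. y i)) \<in> borel_measurable (PiM (UNIV :: 'k set) (\<lambda>_. expo))"
proof -
  have "(\<lambda>y. y i) \<in> borel_measurable (PiM (UNIV :: 'k set) (\<lambda>_. expo))" for i
    using measurable_component_singleton[of i UNIV "\<lambda>_. expo"] by simp
  then show ?thesis by (intro measurable_compose[OF measurable_vec_lambda fm]) auto
qed

lemma measurable_sel_integrand:
  fixes f :: "real^'k::finite \<Rightarrow> real" and u :: "'k \<Rightarrow> real^'m::finite"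
  assumes fm: "f \<in> borel_measurable borel"
  shows "(\<lambda>(t, y). iexp (\<Sum>i\<in>UNIV. (u i \<bullet> t) * (y i - 1)) * complex_of_real (f (\<chi> i. y i)))
    \<in> borel_measurable ((borel :: (real^'m) measure) \<Otimes>\<^sub>M PiM (UNIV :: 'k set) (\<lambda>_. expo))"
proof -
  let ?P = "(borel :: (real^'m) measure) \<Otimes>\<^sub>M PiM (UNIV :: 'k set) (\<lambda>_. expo)"
  have c [measurable]: "(\<lambda>p. snd p i) \<in> borel_measurable ?P" for i
    using measurable_component_singleton[of i UNIV "\<lambda>_. expo"]
    by (intro measurable_compose[OF measurable_snd]) simp
  have [measurable]: "(\<lambda>p. f (\<chi> i. snd p i)) \<in> borel_measurable ?P"
    by (rule measurable_compose[OF measurable_snd measurable_PiM_expo_f[OF fm]])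
  have "(\<lambda>p. \<Sum>i\<in>UNIV. (u i \<bullet> fst p) * (snd p i - 1)) \<in> borel_measurable ?P"
    by (intro borel_measurable_sum borel_measurable_times borel_measurable_diff c) simp_all
  then have "(\<lambda>p. iexp (\<Sum>i\<in>UNIV. (u i \<bullet> fst p) * (snd p i - 1))) \<in> borel_measurable ?P"
    by (rule measurable_compose[where g = "\<lambda>x::real. iexp x"]) simp
  then show ?thesis unfolding case_prod_unfold by measurable
qed

lemma measurable_sel_cf:
  fixes f :: "real^'k::finite \<Rightarrow> real" and u :: "'k \<Rightarrow> real^'m::finite"
  assumes fm: "f \<in> borel_measurable borel"
  shows "sel_cf u f \<in> borel_measurable borel"
proof -
  interpret prob_space "PiM (UNIV :: 'k set) (\<lambda>_. expo)" by (rule prob_space_PiM_expo)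
  show ?thesis
    unfolding sel_cf_def[abs_def]
    by (rule borel_measurable_lebesgue_integral) (rule measurable_sel_integrand[OF fm, of u])
qed

lemma measurable_sel_integrand1:
  fixes f :: "real^'k::finite \<Rightarrow> real" and u :: "'k \<Rightarrow> real^'m::finite"
  assumes fm: "f \<in> borel_measurable borel"
  shows "(\<lambda>y. iexp (\<Sum>i\<in>UNIV. (u i \<bullet> t) * (y i - 1)) * complex_of_real (f (\<chi> i. y i)))
    \<in> borel_measurable (PiM (UNIV :: 'k set) (\<lambda>_. expo))"
proof -
  have "(\<lambda>y. (t, y)) \<in> measurable (PiM (UNIV :: 'k set) (\<lambda>_. expo)) (borel \<Otimes>\<^sub>M PiM UNIV (\<lambda>_. expo))"
    by (rule measurable_Pair1') simp
  from measurable_compose[OF this measurable_sel_integrand[OF fm, of u]] show ?thesis by simp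
qed

lemma norm_sel_cf_le:
  fixes f :: "real^'k::finite \<Rightarrow> real"
  assumes fm: "f \<in> borel_measurable borel" and f0: "\<And>x. 0 \<le> f x" and fM: "\<And>x. f x \<le> M"
  shows "norm (sel_cf u f t) \<le> M"
proof -
  interpret prob_space "PiM (UNIV :: 'k set) (\<lambda>_. expo)" by (rule prob_space_PiM_expo)
  have nrm: "norm (iexp (\<Sum>i\<in>UNIV. (u i \<bullet> t) * (y i - 1)) * complex_of_real (f (\<chi> i. y i))) = f (\<chi> i. y i)" for y
    using f0 by (simp add: norm_mult)
  have "norm (sel_cf u f t) \<le> (\<integral>y. f (\<chi> i. y i) \<partial>PiM UNIV (\<lambda>_. expo))"
    unfolding sel_cf_def by (rule order_trans[OF integral_norm_bound]) (simp only: nrm order_refl)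
  also have "\<dots> \<le> M"
    using f0 fM measurable_PiM_expo_f[OF fm] by (intro integral_le_const integrable_const_bound[of _ M]) auto
  finally show ?thesis .
qed

definition rest_cf :: "(nat \<Rightarrow> nat \<Rightarrow> real^'m::finite) \<Rightarrow> (nat \<Rightarrow> 'k::finite \<Rightarrow> nat) \<Rightarrow> nat \<Rightarrow> real^'m \<Rightarrow> complex" where
  "rest_cf a jj n t = (\<Prod>j\<in>{..<n} - range (jj n). ecf (a n j \<bullet> t))"

section \<open>Convergence and domination as the dimension grows\<close>

context
  fixes a :: "nat \<Rightarrow> nat \<Rightarrow> real^'m::finite" and jj :: "nat \<Rightarrow> 'k::finite \<Rightarrow> nat" and \<delta> :: "nat \<Rightarrow> real"
    and f :: "real^'k \<Rightarrow> real" and M :: real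
  assumes iso: "\<forall>\<^sub>F n in sequentially. \<forall>s. (\<Sum>j<n. (a n j \<bullet> s) *\<^sub>R a n j) = s"
    and small: "\<forall>\<^sub>F n in sequentially. \<forall>j<n. norm (a n j) \<le> \<delta> n" and \<delta>: "\<delta> \<longlonglongrightarrow> 0"
    and jj: "\<forall>\<^sub>F n in sequentially. inj (jj n) \<and> (\<forall>i. jj n i < n)"
    and fm: "f \<in> borel_measurable borel" and f0: "\<And>x. 0 \<le> f x" and fM: "\<And>x. f x \<le> M"
begin

abbreviation (input) "rest \<equiv> rest_cf a jj"

lemma measurable_rest: "rest n \<in> borel_measurable borel"
proof -
  have "(\<lambda>t. ecf (a n j \<bullet> t)) \<in> borel_measurable borel" for j
    by (rule measurable_compose[OF _ measurable_ecf]) simp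
  then show ?thesis unfolding rest_cf_def[abs_def] by (intro borel_measurable_prod) auto
qed

lemma sum_squares:
  assumes "\<forall>s. (\<Sum>j<n. (a n j \<bullet> s) *\<^sub>R a n j) = s"
  shows "(\<Sum>j<n. (a n j \<bullet> t)\<^sup>2) = (norm t)\<^sup>2"
proof -
  have "(norm t)\<^sup>2 = (\<Sum>j<n. (a n j \<bullet> t) *\<^sub>R a n j) \<bullet> t" using assms by (simp add: power2_norm_eq_inner)
  then show ?thesis by (simp add: inner_sum_left power2_eq_square)
qed

lemma inner_small:
  assumes "\<forall>j<n. norm (a n j) \<le> \<delta> n" "j < n"
  shows "\<bar>a n j \<bullet> t\<bar> \<le> \<delta> n * norm t"
  using assms Cauchy_Schwarz_ineq2[of "a n j" t] mult_right_mono[of "norm (a n j)" "\<delta> n" "norm t"] by fastforce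

lemma sum_selected:
  assumes "\<forall>j<n. norm (a n j) \<le> \<delta> n" "inj (jj n) \<and> (\<forall>i. jj n i < n)"
  shows "(\<Sum>j\<in>range (jj n). (a n j \<bullet> t)\<^sup>2) \<le> real CARD('k) * ((\<delta> n)\<^sup>2 * (norm t)\<^sup>2)"
proof -
  have "(\<Sum>j\<in>range (jj n). (a n j \<bullet> t)\<^sup>2) \<le> (\<Sum>j\<in>range (jj n). (\<delta> n * norm t)\<^sup>2)"
  proof (rule sum_mono)
    fix j assume "j \<in> range (jj n)"
    then have "\<bar>a n j \<bullet> t\<bar> \<le> \<delta> n * norm t" using assms by (intro inner_small) auto
    then show "(a n j \<bullet> t)\<^sup>2 \<le> (\<delta> n * norm t)\<^sup>2" by (metis abs_ge_zero power2_abs power_mono)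
  qed
  also have "\<dots> = real CARD('k) * ((\<delta> n)\<^sup>2 * (norm t)\<^sup>2)"
    using assms(2) by (simp add: card_image power_mult_distrib)
  finally show ?thesis .
qed

text \<open>The modulus is the product of the (1 + x_j)^(-1/2) with x_j = (a_j . t)^2 over the
  unselected j. Put D = |t|^2 / (4 m). Once \<delta>^2 < 1 / (4 m), each x_j is at most D; once
  \<delta>^2 < 1 / (2 k), the k selected coordinates take at most half of |t|^2, which leaves a sum
  of at least |t|^2 / 2 = 2 m D. Hence the product of the 1 + x_j is at least (1 + D)^(2 m), and its
  square root supplies the exponent m needed for integrability in R^m.\<close>

lemma rest_bound:
  "\<forall>\<^sub>F n in sequentially. \<forall>t. norm (rest n t) \<le> (4 * real CARD('m)) ^ CARD('m) * (1 / (1 + (norm t)\<^sup>2) ^ CARD('m))"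
proof -
  let ?m = "real CARD('m)"
  have m: "1 \<le> ?m" by (simp add: Suc_leI)
  have "(\<lambda>n. (\<delta> n)\<^sup>2) \<longlonglongrightarrow> 0\<^sup>2" by (intro tendsto_intros \<delta>)
  then have d2: "(\<lambda>n. (\<delta> n)\<^sup>2) \<longlonglongrightarrow> 0" by simp
  have "\<forall>\<^sub>F n in sequentially. (\<delta> n)\<^sup>2 < 1 / (4 * ?m)" "\<forall>\<^sub>F n in sequentially. (\<delta> n)\<^sup>2 < 1 / (2 * real CARD('k))"
    using m by (auto intro!: order_tendstoD(2)[OF d2])
  then show ?thesis
    using iso small jj
  proof eventually_elim
    fix n
    assume d: "(\<delta> n)\<^sup>2 < 1 / (4 * ?m)" "(\<delta> n)\<^sup>2 < 1 / (2 * real CARD('k))"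
      and iso: "\<forall>s. (\<Sum>j<n. (a n j \<bullet> s) *\<^sub>R a n j) = s" and small: "\<forall>j<n. norm (a n j) \<le> \<delta> n"
      and jj: "inj (jj n) \<and> (\<forall>i. jj n i < n)"
    show "\<forall>t. norm (rest n t) \<le> (4 * ?m) ^ CARD('m) * (1 / (1 + (norm t)\<^sup>2) ^ CARD('m))"
    proof
      fix t
      define x where "x j = (a n j \<bullet> t)\<^sup>2" for j
      define D where "D = (norm t)\<^sup>2 / (4 * ?m)"
      let ?I = "{..<n} - range (jj n)"
      have "(1 + D) ^ (2 * CARD('m)) \<le> (\<Prod>j\<in>?I. 1 + x j)"
      proof (rule prod_one_plus_ge)
        show "x j \<le> D" if "j \<in> ?I" for j
        proof -
          have "x j = \<bar>a n j \<bullet> t\<bar>\<^sup>2" by (simp add: x_def)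
          also have "\<dots> \<le> (\<delta> n * norm t)\<^sup>2" using inner_small[OF small] that by (intro power_mono) auto
          also have "\<dots> = (\<delta> n)\<^sup>2 * (norm t)\<^sup>2" by (simp add: power_mult_distrib)
          also have "\<dots> \<le> 1 / (4 * ?m) * (norm t)\<^sup>2" using d by (intro mult_right_mono) auto
          finally show ?thesis by (simp add: D_def)
        qed
        have "real CARD('k) * ((\<delta> n)\<^sup>2 * (norm t)\<^sup>2) \<le> real CARD('k) * (1 / (2 * real CARD('k)) * (norm t)\<^sup>2)"
          using d by (intro mult_left_mono mult_right_mono) auto
        also have "\<dots> = (norm t)\<^sup>2 / 2" by simp
        finally have "(\<Sum>j\<in>range (jj n). x j) \<le> (norm t)\<^sup>2 / 2"
          using sum_selected[OF small jj, of t] by (simp add: x_def)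
        moreover have "(\<Sum>j<n. x j) = (\<Sum>j\<in>?I. x j) + (\<Sum>j\<in>range (jj n). x j)"
          using jj by (intro sum.subset_diff) auto
        ultimately have "(norm t)\<^sup>2 / 2 \<le> (\<Sum>j\<in>?I. x j)" using sum_squares[OF iso, of t] by (simp add: x_def)
        then show "real (2 * CARD('m)) * D \<le> (\<Sum>j\<in>?I. x j)" by (simp add: D_def)
      qed (auto simp: x_def D_def)
      then have "(1 + D) ^ CARD('m) \<le> sqrt (\<Prod>j\<in>?I. 1 + x j)"
        by (intro real_le_rsqrt) (simp add: power_mult[symmetric] mult.commute)
      moreover have D0: "0 \<le> D" by (simp add: D_def)
      ultimately have "1 / sqrt (\<Prod>j\<in>?I. 1 + x j) \<le> 1 / (1 + D) ^ CARD('m)"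
      proof -
        assume le: "(1 + D) ^ CARD('m) \<le> sqrt (\<Prod>j\<in>?I. 1 + x j)" and "0 \<le> D"
        then have "0 < (1 + D) ^ CARD('m)" by (intro zero_less_power) simp
        with le show ?thesis by (intro divide_left_mono mult_pos_pos) linarith+
      qed
      moreover have "norm (rest n t) = 1 / sqrt (\<Prod>j\<in>?I. 1 + x j)"
      proof -
        have "sqrt (\<Prod>j\<in>S. 1 + x j) = (\<Prod>j\<in>S. sqrt (1 + x j))" if "finite S" for S
          using that by (induction S) (auto simp: real_sqrt_mult)
        then show ?thesis by (simp add: rest_cf_def prod_norm[symmetric] norm_ecf x_def prod_dividef)
      qed
      moreover have "1 / (1 + D) ^ CARD('m) \<le> (4 * ?m) ^ CARD('m) * (1 / (1 + (norm t)\<^sup>2) ^ CARD('m))"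
      proof -
        have "4 * ?m * (1 + D) = 4 * ?m + (norm t)\<^sup>2" by (simp add: D_def field_simps)
        then have "(1 + (norm t)\<^sup>2) \<le> 4 * ?m * (1 + D)" using m by linarith
        then have "(1 + (norm t)\<^sup>2) ^ CARD('m) \<le> (4 * ?m * (1 + D)) ^ CARD('m)"
          by (intro power_mono) auto
        then have "(1 + (norm t)\<^sup>2) ^ CARD('m) \<le> (4 * ?m) ^ CARD('m) * (1 + D) ^ CARD('m)"
          by (simp add: power_mult_distrib)
        moreover have "0 < (1 + D) ^ CARD('m)" "0 < (1 + (norm t)\<^sup>2) ^ CARD('m)"
          using D0 by (auto intro!: zero_less_power add_pos_nonneg)
        ultimately show ?thesis by (simp add: divide_simps)
      qed
      ultimately show "norm (rest n t) \<le> (4 * ?m) ^ CARD('m) * (1 / (1 + (norm t)\<^sup>2) ^ CARD('m))" by linarith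
    qed
  qed
qed

text \<open>All factors have modulus at most 1, so replacing each by its Gaussian counterpart costs
  at most the sum of the errors |\<theta>_j|^3 <= \<delta> |t| \<theta>_j^2, that is, at most
  \<delta> |t|^3. The Gaussian product equals exp(-|t|^2/2) up to the selected squares, a fixed
  number of terms tending to 0.\<close>

lemma rest_tendsto: "(\<lambda>n. rest n t) \<longlonglongrightarrow> complex_of_real (exp (- (norm t)\<^sup>2 / 2))"
proof -
  define G where "G n = (\<Prod>j\<in>{..<n} - range (jj n). complex_of_real (exp (- (a n j \<bullet> t)\<^sup>2 / 2)))" for n
  have dt: "(\<lambda>n. \<delta> n * norm t) \<longlonglongrightarrow> 0" using tendsto_mult_left_zero[OF \<delta>] .
  have diff: "(\<lambda>n. rest n t - G n) \<longlonglongrightarrow> 0"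
  proof (rule Lim_null_comparison)
    show "(\<lambda>n. \<delta> n * norm t * (norm t)\<^sup>2) \<longlonglongrightarrow> 0" using tendsto_mult_left_zero[OF dt] .
    have "\<forall>\<^sub>F n in sequentially. \<delta> n * norm t < 1" by (rule order_tendstoD(2)[OF dt]) simp
    then show "\<forall>\<^sub>F n in sequentially. norm (rest n t - G n) \<le> \<delta> n * norm t * (norm t)\<^sup>2"
      using iso small
    proof eventually_elim
      fix n
      assume d: "\<delta> n * norm t < 1" and iso: "\<forall>s. (\<Sum>j<n. (a n j \<bullet> s) *\<^sub>R a n j) = s" and small: "\<forall>j<n. norm (a n j) \<le> \<delta> n"
      let ?I = "{..<n} - range (jj n)"
      have "norm (rest n t - G n) \<le> (\<Sum>j\<in>?I. norm (ecf (a n j \<bullet> t) - complex_of_real (exp (- (a n j \<bullet> t)\<^sup>2 / 2))))"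
        unfolding rest_cf_def G_def by (rule norm_prod_diff) (auto simp: norm_ecf_le_1)
      also have "\<dots> \<le> (\<Sum>j\<in>?I. \<delta> n * norm t * (a n j \<bullet> t)\<^sup>2)"
      proof (rule sum_mono)
        fix j assume j: "j \<in> ?I"
        then have s: "\<bar>a n j \<bullet> t\<bar> \<le> \<delta> n * norm t" using inner_small[OF small] by simp
        have "norm (ecf (a n j \<bullet> t) - complex_of_real (exp (- (a n j \<bullet> t)\<^sup>2 / 2))) \<le> \<bar>a n j \<bullet> t\<bar> ^ 3"
          unfolding ecf_def using s d by (intro expo_cf_approx) linarith
        also have "\<dots> = \<bar>a n j \<bullet> t\<bar> * (a n j \<bullet> t)\<^sup>2" by (simp add: power3_eq_cube power2_eq_square)
        also have "\<dots> \<le> \<delta> n * norm t * (a n j \<bullet> t)\<^sup>2" using s by (intro mult_right_mono) auto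
        finally show "norm (ecf (a n j \<bullet> t) - complex_of_real (exp (- (a n j \<bullet> t)\<^sup>2 / 2))) \<le> \<delta> n * norm t * (a n j \<bullet> t)\<^sup>2" .
      qed
      also have "\<dots> \<le> (\<Sum>j<n. \<delta> n * norm t * (a n j \<bullet> t)\<^sup>2)"
      proof (rule sum_mono2)
        fix j assume "j \<in> {..<n} - ?I"
        then have "0 \<le> \<delta> n * norm t" using inner_small[OF small, of j t] by (meson DiffD1 abs_ge_zero lessThan_iff order_trans)
        then show "0 \<le> \<delta> n * norm t * (a n j \<bullet> t)\<^sup>2" by simp
      qed auto
      also have "\<dots> = \<delta> n * norm t * (norm t)\<^sup>2" by (simp add: sum_distrib_left[symmetric] sum_squares[OF iso])
      finally show "norm (rest n t - G n) \<le> \<delta> n * norm t * (norm t)\<^sup>2" .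
    qed
  qed
  have sel: "(\<lambda>n. \<Sum>j\<in>range (jj n). (a n j \<bullet> t)\<^sup>2) \<longlonglongrightarrow> 0"
  proof (rule Lim_null_comparison)
    have "(\<lambda>n. real CARD('k) * ((\<delta> n)\<^sup>2 * (norm t)\<^sup>2)) \<longlonglongrightarrow> real CARD('k) * (0\<^sup>2 * (norm t)\<^sup>2)"
      by (intro tendsto_intros \<delta>)
    then show "(\<lambda>n. real CARD('k) * ((\<delta> n)\<^sup>2 * (norm t)\<^sup>2)) \<longlonglongrightarrow> 0" by simp
    show "\<forall>\<^sub>F n in sequentially. norm (\<Sum>j\<in>range (jj n). (a n j \<bullet> t)\<^sup>2) \<le> real CARD('k) * ((\<delta> n)\<^sup>2 * (norm t)\<^sup>2)"
      using small jj by eventually_elim (use sum_selected in \<open>simp add: sum_nonneg\<close>)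
  qed
  have "(\<lambda>n. complex_of_real (exp (- ((norm t)\<^sup>2 - (\<Sum>j\<in>range (jj n). (a n j \<bullet> t)\<^sup>2)) / 2))) \<longlonglongrightarrow> complex_of_real (exp (- ((norm t)\<^sup>2 - 0) / 2))"
    by (intro tendsto_intros sel) auto
  moreover have "\<forall>\<^sub>F n in sequentially. complex_of_real (exp (- ((norm t)\<^sup>2 - (\<Sum>j\<in>range (jj n). (a n j \<bullet> t)\<^sup>2)) / 2)) = G n"
    using iso jj
  proof eventually_elim
    fix n assume iso: "\<forall>s. (\<Sum>j<n. (a n j \<bullet> s) *\<^sub>R a n j) = s" and jj: "inj (jj n) \<and> (\<forall>i. jj n i < n)"
    have "(\<Sum>j<n. (a n j \<bullet> t)\<^sup>2) = (\<Sum>j\<in>{..<n} - range (jj n). (a n j \<bullet> t)\<^sup>2) + (\<Sum>j\<in>range (jj n). (a n j \<bullet> t)\<^sup>2)"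
      using jj by (intro sum.subset_diff) auto
    then have "(norm t)\<^sup>2 - (\<Sum>j\<in>range (jj n). (a n j \<bullet> t)\<^sup>2) = (\<Sum>j\<in>{..<n} - range (jj n). (a n j \<bullet> t)\<^sup>2)"
      using sum_squares[OF iso, of t] by simp
    then show "complex_of_real (exp (- ((norm t)\<^sup>2 - (\<Sum>j\<in>range (jj n). (a n j \<bullet> t)\<^sup>2)) / 2)) = G n"
      unfolding G_def of_real_prod[symmetric] exp_sum[OF finite_Diff[OF finite_lessThan], symmetric]
      by (simp only:) (simp add: sum_negf sum_divide_distrib)
  qed
  ultimately have "G \<longlonglongrightarrow> complex_of_real (exp (- (norm t)\<^sup>2 / 2))"
    using Lim_transform_eventually by fastforce
  from tendsto_add[OF diff this] show ?thesis by simp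
qed

text \<open>Decoupling of the selected coordinates: their columns tend to 0, so the phase tends to 1
  for each fixed y, with the constant \<open>M\<close> as dominating function.\<close>

lemma sel_cf_tendsto:
  "(\<lambda>n. sel_cf (\<lambda>i. a n (jj n i)) f t) \<longlonglongrightarrow> complex_of_real (\<integral>y. f (\<chi> i. y i) \<partial>PiM UNIV (\<lambda>_. expo))"
proof -
  interpret prob_space "PiM (UNIV :: 'k set) (\<lambda>_. expo)" by (rule prob_space_PiM_expo)
  have lim0: "(\<lambda>n. a n (jj n i) \<bullet> t) \<longlonglongrightarrow> 0" for i
  proof (rule Lim_null_comparison)
    show "(\<lambda>n. \<delta> n * norm t) \<longlonglongrightarrow> 0" using tendsto_mult_left_zero[OF \<delta>] .
    show "\<forall>\<^sub>F n in sequentially. norm (a n (jj n i) \<bullet> t) \<le> \<delta> n * norm t"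
      using small jj by eventually_elim (use inner_small in auto)
  qed
  have "(\<lambda>n. sel_cf (\<lambda>i. a n (jj n i)) f t) \<longlonglongrightarrow> (\<integral>y. complex_of_real (f (\<chi> i. y i)) \<partial>PiM UNIV (\<lambda>_. expo))"
    unfolding sel_cf_def
  proof (rule integral_dominated_convergence[where w="\<lambda>_. M"])
    show "AE y in PiM UNIV (\<lambda>_. expo). (\<lambda>n. iexp (\<Sum>i\<in>UNIV. (a n (jj n i) \<bullet> t) * (y i - 1)) * complex_of_real (f (\<chi> i. y i)))
        \<longlonglongrightarrow> complex_of_real (f (\<chi> i. y i))"
    proof (rule AE_I2)
      fix y :: "'k \<Rightarrow> real"
      have "(\<lambda>n. iexp (\<Sum>i\<in>UNIV. (a n (jj n i) \<bullet> t) * (y i - 1)) * complex_of_real (f (\<chi> i. y i)))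
        \<longlonglongrightarrow> iexp (\<Sum>i\<in>(UNIV :: 'k set). 0 * (y i - 1)) * complex_of_real (f (\<chi> i. y i))"
        by (intro tendsto_intros lim0)
      then show "(\<lambda>n. iexp (\<Sum>i\<in>UNIV. (a n (jj n i) \<bullet> t) * (y i - 1)) * complex_of_real (f (\<chi> i. y i)))
        \<longlonglongrightarrow> complex_of_real (f (\<chi> i. y i))" by simp
    qed
    show "AE y in PiM UNIV (\<lambda>_. expo). norm (iexp (\<Sum>i\<in>UNIV. (a n (jj n i) \<bullet> t) * (y i - 1)) * complex_of_real (f (\<chi> i. y i))) \<le> M" for n
      using f0 fM by (simp add: norm_mult)
  qed (use measurable_sel_integrand1[OF fm] measurable_PiM_expo_f[OF fm] in auto)
  then show ?thesis by simp
qed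

lemma cf_integral_tendsto:
  shows "\<forall>\<^sub>F n in sequentially. integrable lborel (\<lambda>t. rest n t * sel_cf (\<lambda>i. a n (jj n i)) f t)"
    and "(\<lambda>n. Re (\<integral>t. rest n t * sel_cf (\<lambda>i. a n (jj n i)) f t \<partial>lborel))
      \<longlonglongrightarrow> (\<integral>y. f (\<chi> i. y i) \<partial>PiM UNIV (\<lambda>_. expo)) / gauss (0::real^'m)"
proof -
  have M: "0 \<le> M" using f0 fM order_trans by blast
  let ?W = "\<lambda>t::real^'m. (4 * real CARD('m)) ^ CARD('m) * (1 / (1 + (norm t)\<^sup>2) ^ CARD('m)) * M"
  have W: "integrable lborel ?W" by (intro integrable_mult_left integrable_mult_right integrable_norm_power)
  have meas: "(\<lambda>t. rest n t * sel_cf (\<lambda>i. a n (jj n i)) f t) \<in> borel_measurable lborel" for n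
    by (simp, intro borel_measurable_times measurable_rest measurable_sel_cf fm)
  have dom: "\<forall>\<^sub>F n in sequentially. \<forall>t. norm (rest n t * sel_cf (\<lambda>i. a n (jj n i)) f t) \<le> ?W t"
    using rest_bound
  proof eventually_elim
    fix n assume b: "\<forall>t. norm (rest n t) \<le> (4 * real CARD('m)) ^ CARD('m) * (1 / (1 + (norm t)\<^sup>2) ^ CARD('m))"
    show "\<forall>t. norm (rest n t * sel_cf (\<lambda>i. a n (jj n i)) f t) \<le> ?W t"
      unfolding norm_mult using b norm_sel_cf_le[OF fm f0 fM] M by (intro allI mult_mono) auto
  qed
  from dom show int: "\<forall>\<^sub>F n in sequentially. integrable lborel (\<lambda>t. rest n t * sel_cf (\<lambda>i. a n (jj n i)) f t)"
  proof eventually_elim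
    fix n assume b: "\<forall>t. norm (rest n t * sel_cf (\<lambda>i. a n (jj n i)) f t) \<le> ?W t"
    show "integrable lborel (\<lambda>t. rest n t * sel_cf (\<lambda>i. a n (jj n i)) f t)"
    proof (rule Bochner_Integration.integrable_bound[OF W meas], rule AE_I2)
      fix t :: "real^'m"
      show "norm (rest n t * sel_cf (\<lambda>i. a n (jj n i)) f t) \<le> norm (?W t)"
        by (rule order_trans[OF spec[OF b]]) (simp only: real_norm_def abs_ge_self)
    qed
  qed
  let ?L = "complex_of_real (\<integral>y. f (\<chi> i. y i) \<partial>PiM UNIV (\<lambda>_. expo))"
  let ?F = "\<lambda>n t. rest n t * sel_cf (\<lambda>i. a n (jj n i)) f t"
  \<comment> \<open>Domination holds only for large n, whereas dominated convergence wants it for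
    every index; hence the shift by \<open>N0\<close>.\<close>
  obtain N0 where N0: "\<And>n t. N0 \<le> n \<Longrightarrow> norm (?F n t) \<le> ?W t"
    using dom unfolding eventually_sequentially by blast
  have "(\<lambda>n. \<integral>t. ?F (n + N0) t \<partial>lborel) \<longlonglongrightarrow>
      (\<integral>t. complex_of_real (exp (- (norm t)\<^sup>2 / 2)) * ?L \<partial>(lborel :: (real^'m) measure))"
  proof (rule integral_dominated_convergence[where w = ?W])
    show "AE t in lborel. (\<lambda>n. ?F (n + N0) t) \<longlonglongrightarrow> complex_of_real (exp (- (norm t)\<^sup>2 / 2)) * ?L"
      by (intro AE_I2 LIMSEQ_ignore_initial_segment tendsto_mult rest_tendsto sel_cf_tendsto)
    show "AE t in lborel. norm (?F (n + N0) t) \<le> ?W t" for n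
      using N0[of "n + N0"] by (intro AE_I2) simp
  qed (use W meas in auto)
  then have lim: "(\<lambda>n. Re (\<integral>t. ?F n t \<partial>lborel)) \<longlonglongrightarrow>
      Re (\<integral>t. complex_of_real (exp (- (norm t)\<^sup>2 / 2)) * ?L \<partial>(lborel :: (real^'m) measure))"
    by (intro tendsto_Re LIMSEQ_offset[of "\<lambda>n. \<integral>t. ?F n t \<partial>lborel" N0])
  have g0: "0 < gauss (0::real^'m)" by (rule gauss_pos)
  have ex: "exp (- (norm t)\<^sup>2 / 2) = gauss t / gauss (0::real^'m)" for t :: "real^'m"
    using g0 by (subst gauss_eq) simp
  have "(\<integral>t. complex_of_real (exp (- (norm t)\<^sup>2 / 2)) * ?L \<partial>(lborel :: (real^'m) measure))
      = complex_of_real (\<integral>t. exp (- (norm t)\<^sup>2 / 2) \<partial>(lborel :: (real^'m) measure)) * ?L"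
    by (simp only: integral_mult_left_zero integral_complex_of_real)
  also have "(\<integral>t. exp (- (norm t)\<^sup>2 / 2) \<partial>(lborel :: (real^'m) measure)) = 1 / gauss (0::real^'m)"
    unfolding ex integral_divide_zero by (simp add: integral_gauss)
  finally show "(\<lambda>n. Re (\<integral>t. ?F n t \<partial>lborel)) \<longlonglongrightarrow> (\<integral>y. f (\<chi> i. y i) \<partial>PiM UNIV (\<lambda>_. expo)) / gauss (0::real^'m)"
    using lim by simp
qed

end

section \<open>Slicing Lebesgue measure\<close>

abbreviation "seqM \<equiv> PiM UNIV (\<lambda>_::nat. borel :: real measure)"

lemma measurable_seqM_coord [measurable]: "(\<lambda>x. x j) \<in> borel_measurable seqM"
  by (rule measurable_component_singleton) simp

lemma measurable_into_seqM:
  "(\<And>j. (\<lambda>x. f x j) \<in> borel_measurable M) \<Longrightarrow> f \<in> measurable M seqM"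
  by (rule measurable_PiM_single') auto

lemma space_seqM [simp]: "space seqM = UNIV"
  by (simp add: space_PiM)

lemma measurable_seqM_shift [measurable]: "(\<lambda>x i. z i + x i) \<in> measurable seqM seqM"
  by (rule measurable_into_seqM) simp

text \<open>Weil's Fubini argument for the uniqueness of Haar measure.\<close>

lemma translation_invariant_unique:
  fixes \<mu> \<nu> :: "(nat \<Rightarrow> real) measure"
  assumes sets: "sets \<mu> = sets seqM" "sets \<nu> = sets seqM"
    and sf: "sigma_finite_measure \<mu>" "sigma_finite_measure \<nu>"
    and inv\<mu>: "\<And>z E. z \<in> V \<Longrightarrow> E \<in> sets seqM \<Longrightarrow> emeasure \<mu> ((\<lambda>x i. z i + x i) -` E) = emeasure \<mu> E"
    and inv\<nu>: "\<And>z E. z \<in> V \<Longrightarrow> E \<in> sets seqM \<Longrightarrow> emeasure \<nu> ((\<lambda>x i. z i + x i) -` E) = emeasure \<nu> E"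
    and V: "AE x in \<mu>. x \<in> V" "AE x in \<nu>. x \<in> V" "\<And>x. x \<in> V \<Longrightarrow> (\<lambda>i. - x i) \<in> V"
    and E: "E \<in> sets seqM" and B: "B \<in> sets seqM"
  shows "emeasure \<nu> E * emeasure \<mu> B = emeasure \<mu> E * emeasure \<nu> ((\<lambda>x i. - x i) -` B)"
proof -
  note [measurable_cong] = sets
  note [measurable] = E B
  have sp: "space \<mu> = UNIV" "space \<nu> = UNIV"
    using sets[THEN sets_eq_imp_space_eq] by simp_all
  interpret \<mu>: sigma_finite_measure \<mu> by fact
  interpret \<nu>: sigma_finite_measure \<nu> by fact
  interpret pair_sigma_finite \<mu> \<nu> by standard
  interpret P': pair_sigma_finite \<nu> \<mu> by standard
  have plus [measurable]: "(\<lambda>p i. f p i + g p i) \<in> measurable M seqM"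
    if [measurable]: "f \<in> measurable M seqM" "g \<in> measurable M seqM" for f g and M :: "((nat \<Rightarrow> real) \<times> (nat \<Rightarrow> real)) measure"
    by (rule measurable_into_seqM) measurable
  have neg [measurable]: "(\<lambda>p i. - f p i) \<in> measurable M seqM"
    if [measurable]: "f \<in> measurable M seqM" for f and M :: "((nat \<Rightarrow> real) \<times> (nat \<Rightarrow> real)) measure"
    by (rule measurable_into_seqM) measurable
  have neg1 [measurable]: "(\<lambda>x i. - x i) \<in> measurable seqM seqM"
    by (rule measurable_into_seqM) measurable
  have shift\<mu>: "(\<integral>\<^sup>+y. indicator A (\<lambda>i. z i + y i) \<partial>\<mu>) = emeasure \<mu> A" if "z \<in> V" "A \<in> sets seqM" for z A
  proof -
    have "(\<integral>\<^sup>+y. indicator A (\<lambda>i. z i + y i) \<partial>\<mu>) = (\<integral>\<^sup>+y. indicator ((\<lambda>x i. z i + x i) -` A) y \<partial>\<mu>)"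
      by (intro nn_integral_cong) (simp add: indicator_def)
    also have "\<dots> = emeasure \<mu> ((\<lambda>x i. z i + x i) -` A)"
      using measurable_sets[OF measurable_seqM_shift that(2)] sets by (intro nn_integral_indicator) simp
    finally show ?thesis using inv\<mu> that by simp
  qed
  have shift\<nu>: "(\<integral>\<^sup>+y. indicator A (\<lambda>i. z i + y i) \<partial>\<nu>) = emeasure \<nu> A" if "z \<in> V" "A \<in> sets seqM" for z A
  proof -
    have "(\<integral>\<^sup>+y. indicator A (\<lambda>i. z i + y i) \<partial>\<nu>) = (\<integral>\<^sup>+y. indicator ((\<lambda>x i. z i + x i) -` A) y \<partial>\<nu>)"
      by (intro nn_integral_cong) (simp add: indicator_def)
    also have "\<dots> = emeasure \<nu> ((\<lambda>x i. z i + x i) -` A)"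
      using measurable_sets[OF measurable_seqM_shift that(2)] sets by (intro nn_integral_indicator) simp
    finally show ?thesis using inv\<nu> that by simp
  qed
  \<comment> \<open>The double integral of the indicators of x in E and y - x in B is evaluated in
    two ways. Integrating over y and undoing the shift by -x gives the left-hand product.\<close>
  have "emeasure \<nu> E * emeasure \<mu> B = (\<integral>\<^sup>+x. indicator E x * emeasure \<mu> B \<partial>\<nu>)"
    using sets by (simp add: nn_integral_multc)
  also have "\<dots> = (\<integral>\<^sup>+x. indicator E x * (\<integral>\<^sup>+y. indicator B (\<lambda>i. - x i + y i) \<partial>\<mu>) \<partial>\<nu>)"
    using V(2) by (intro nn_integral_cong_AE, eventually_elim) (simp only: shift\<mu>[OF V(3) B])
  also have "\<dots> = (\<integral>\<^sup>+x. (\<integral>\<^sup>+y. indicator E x * indicator B (\<lambda>i. - x i + y i) \<partial>\<mu>) \<partial>\<nu>)"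
    by (intro nn_integral_cong nn_integral_cmult[symmetric]) measurable
  also have "\<dots> = (\<integral>\<^sup>+y. (\<integral>\<^sup>+x. indicator E x * indicator B (\<lambda>i. - x i + y i) \<partial>\<nu>) \<partial>\<mu>)"
    by (rule P'.Fubini'[symmetric]) measurable
  \<comment> \<open>Shifting x by y turns y - x into -x, so that y survives only in E, where the
    remaining y-integral is again a shift. Invariance is available only for shifts in
    \<open>V\<close>, which almost every point provides.\<close>
  also have "\<dots> = (\<integral>\<^sup>+y. (\<integral>\<^sup>+x. indicator E (\<lambda>i. y i + x i) * indicator B (\<lambda>i. - x i) \<partial>\<nu>) \<partial>\<mu>)"
  proof (intro nn_integral_cong_AE, use V(1) in eventually_elim)
    fix y assume y: "y \<in> V"
    have mA [measurable]: "{x. x \<in> E \<and> (\<lambda>i. - x i + y i) \<in> B} \<in> sets seqM" (is "?A \<in> _")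
    proof -
      have [measurable]: "(\<lambda>x i. - x i + y i) \<in> measurable seqM seqM"
        by (rule measurable_into_seqM) measurable
      have "{x \<in> space seqM. x \<in> E \<and> (\<lambda>i. - x i + y i) \<in> B} \<in> sets seqM" by measurable
      then show ?thesis by simp
    qed
    have "(\<integral>\<^sup>+x. indicator E x * indicator B (\<lambda>i. - x i + y i) \<partial>\<nu>) = (\<integral>\<^sup>+x. indicator ?A x \<partial>\<nu>)"
      by (intro nn_integral_cong) (auto simp: indicator_def)
    also have "\<dots> = (\<integral>\<^sup>+x. indicator ?A (\<lambda>i. y i + x i) \<partial>\<nu>)"
      using shift\<nu>[OF y mA] nn_integral_indicator[of ?A \<nu>] mA unfolding sets(2) by (simp only:)
    also have "\<dots> = (\<integral>\<^sup>+x. indicator E (\<lambda>i. y i + x i) * indicator B (\<lambda>i. - x i) \<partial>\<nu>)"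
      by (intro nn_integral_cong) (auto simp: indicator_def)
    finally show "(\<integral>\<^sup>+x. indicator E x * indicator B (\<lambda>i. - x i + y i) \<partial>\<nu>) = \<dots>" .
  qed
  also have "\<dots> = (\<integral>\<^sup>+x. (\<integral>\<^sup>+y. indicator E (\<lambda>i. y i + x i) * indicator B (\<lambda>i. - x i) \<partial>\<mu>) \<partial>\<nu>)"
    by (rule P'.Fubini') measurable
  also have "\<dots> = (\<integral>\<^sup>+x. (\<integral>\<^sup>+y. indicator E (\<lambda>i. x i + y i) \<partial>\<mu>) * indicator B (\<lambda>i. - x i) \<partial>\<nu>)"
    by (subst add.commute, intro nn_integral_cong nn_integral_multc) measurable
  also have "\<dots> = (\<integral>\<^sup>+x. emeasure \<mu> E * indicator ((\<lambda>x i. - x i) -` B) x \<partial>\<nu>)"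
    using V(2) by (intro nn_integral_cong_AE, eventually_elim) (simp only: shift\<mu>[OF _ E], simp add: indicator_def)
  also have "\<dots> = emeasure \<mu> E * emeasure \<nu> ((\<lambda>x i. - x i) -` B)"
    using measurable_sets[OF neg1 B] sets by (intro nn_integral_cmult_indicator) simp
  finally show ?thesis .
qed

lemma sets_seqM_box: "{x. \<forall>j<n. \<bar>x j\<bar> \<le> r} \<in> sets seqM"
proof -
  have "{x \<in> space seqM. \<forall>j<n. \<bar>x j\<bar> \<le> r} \<in> sets seqM" by measurable
  then show ?thesis by simp
qed

lemma sigma_finite_seqM:
  assumes sets: "sets M = sets seqM"
    and fin: "\<And>r :: real. 0 < r \<Longrightarrow> emeasure M {x. \<forall>j<n. \<bar>x j\<bar> \<le> r} < \<infinity>"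
  shows "sigma_finite_measure M"
proof
  have sp: "space M = UNIV" using sets_eq_imp_space_eq[OF sets] by simp
  let ?B = "\<lambda>r::nat. {x. \<forall>j<n. \<bar>x j\<bar> \<le> real (Suc r)}"
  have "?B r \<in> sets M" for r
  proof -
    have "{x \<in> space seqM. \<forall>j<n. \<bar>x j\<bar> \<le> real (Suc r)} \<in> sets seqM" by measurable
    then show ?thesis using sets by simp
  qed
  moreover have "x \<in> \<Union> (range ?B)" for x :: "nat \<Rightarrow> real"
  proof -
    obtain r where r: "(\<Sum>j<n. \<bar>x j\<bar>) < real r" using reals_Archimedean2 by blast
    have "\<bar>x j\<bar> \<le> real (Suc r)" if "j < n" for j
      using member_le_sum[of j "{..<n}" "\<lambda>j. \<bar>x j\<bar>"] that r by simp
    then show ?thesis by blast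
  qed
  moreover have "emeasure M (?B r) \<noteq> \<infinity>" for r using fin[of "real (Suc r)"] by simp
  ultimately show "\<exists>A. countable A \<and> A \<subseteq> sets M \<and> \<Union> A = space M \<and> (\<forall>a\<in>A. emeasure M a \<noteq> \<infinity>)"
    using sp by (intro exI[of _ "range ?B"]) blast
qed

lemma translate_PiM_lborel:
  assumes I: "finite I"
  shows "distr (PiM I (\<lambda>_. lborel)) (PiM I (\<lambda>_. lborel)) (\<lambda>v. \<lambda>i\<in>I. c i + v i :: real) = PiM I (\<lambda>_. lborel)"
proof -
  interpret product_sigma_finite "\<lambda>_. lborel :: real measure" by standard
  show ?thesis
  proof (rule PiM_eqI)
    fix A assume A: "\<And>i. i \<in> I \<Longrightarrow> A i \<in> sets (lborel :: real measure)"
    have A': "(+) (c i) -` A i \<in> sets borel" if "i \<in> I" for i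
      using A[OF that] by (intro measurable_sets_borel[of "(+) (c i)" borel]) auto
    have "emeasure (distr (PiM I (\<lambda>_. lborel)) (PiM I (\<lambda>_. lborel)) (\<lambda>v. \<lambda>i\<in>I. c i + v i)) (PiE I A)
        = emeasure (PiM I (\<lambda>_. lborel)) ((\<lambda>v. \<lambda>i\<in>I. c i + v i) -` PiE I A \<inter> space (PiM I (\<lambda>_. lborel)))"
      using A I by (intro emeasure_distr) (auto intro!: sets_PiM_I_finite measurable_restrict)
    also have "(\<lambda>v. \<lambda>i\<in>I. c i + v i) -` PiE I A \<inter> space (PiM I (\<lambda>_. lborel)) = PiE I (\<lambda>i. (+) (c i) -` A i)"
      by (auto simp: space_PiM PiE_def Pi_def)
    also have "emeasure (PiM I (\<lambda>_. lborel)) \<dots> = (\<Prod>i\<in>I. emeasure lborel ((+) (c i) -` A i))"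
      using A' I by (intro emeasure_PiM) auto
    also have "\<dots> = (\<Prod>i\<in>I. emeasure lborel (A i))"
    proof (rule prod.cong[OF refl])
      fix i assume i: "i \<in> I"
      have "emeasure lborel (A i) = emeasure (distr lborel borel ((+) (c i))) (A i)"
        by (simp add: lborel_distr_plus)
      also have "\<dots> = emeasure lborel ((+) (c i) -` A i)"
        using A[OF i] by (subst emeasure_distr) auto
      finally show "emeasure lborel ((+) (c i) -` A i) = emeasure lborel (A i)" by simp
    qed
    finally show "emeasure (distr (PiM I (\<lambda>_. lborel)) (PiM I (\<lambda>_. lborel)) (\<lambda>v. \<lambda>i\<in>I. c i + v i)) (PiE I A)
       = (\<Prod>i\<in>I. emeasure lborel (A i))" .
  qed (use I in auto)
qed

text \<open>Here \<open>V\<close> is the kernel, \<open>a\<close> lists the columns of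
  \<open>A_hat\<close>, and \<nu> is Hausdorff measure on \<open>V\<close>, retained only through
  its invariance, its finiteness on boxes and its being nonzero. \<open>V_sum\<close> is the form in
  which membership of \<open>w\<close> in the row span enters: it makes the exponential weight
  constant along each slice.\<close>

locale affine_slice =
  fixes n :: nat and w :: "nat \<Rightarrow> real" and a :: "nat \<Rightarrow> real^'m"
    and V :: "(nat \<Rightarrow> real) set" and \<nu> :: "(nat \<Rightarrow> real) measure"
  assumes w_pos: "\<And>j. j < n \<Longrightarrow> 0 < w j"
    and isotropic: "\<And>s. (\<Sum>j<n. (a j \<bullet> s) *\<^sub>R a j) = s"
    and V_iff: "\<And>y. y \<in> V \<longleftrightarrow> (\<forall>j\<ge>n. y j = 0) \<and> (\<Sum>j<n. (w j * y j) *\<^sub>R a j) = 0"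
    and V_sum: "\<And>y. y \<in> V \<Longrightarrow> (\<Sum>j<n. w j * y j) = 0"
    and sets_\<nu>: "sets \<nu> = sets seqM"
    and AE_V: "AE y in \<nu>. y \<in> V"
    and invariant: "\<And>z E. z \<in> V \<Longrightarrow> E \<in> sets seqM \<Longrightarrow> emeasure \<nu> ((\<lambda>x i. z i + x i) -` E) = emeasure \<nu> E"
    and bounded_finite: "\<And>r. 0 < r \<Longrightarrow> emeasure \<nu> {y. \<forall>j<n. \<bar>y j\<bar> \<le> r} < \<infinity>"
    and nontrivial: "emeasure \<nu> UNIV \<noteq> 0"
begin

sublocale \<nu>: sigma_finite_measure \<nu>
  by (rule sigma_finite_seqM[OF sets_\<nu> bounded_finite])

lemmas [measurable_cong] = sets_\<nu>

lemma space_\<nu> [simp]: "space \<nu> = UNIV"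
  using sets_eq_imp_space_eq[OF sets_\<nu>] by simp

text \<open>The point with w_j x_j = 1 + a_j . s + w_j y_j. Isotropy of the columns makes its
  statistic equal to s whenever y lies in the kernel, so (s, y) are linear coordinates of R^n
  adapted to the slices; s = 0, y = 0 is the analytic centre 1 / w.\<close>

definition point :: "real^'m \<Rightarrow> (nat \<Rightarrow> real) \<Rightarrow> nat \<Rightarrow> real" where
  "point s y j = (if j < n then (1 + a j \<bullet> s) / w j + y j else 0)"

definition unscale :: "(nat \<Rightarrow> real) \<Rightarrow> nat \<Rightarrow> real" where
  "unscale v j = (if j < n then v j / w j else 0)"

definition stat :: "(nat \<Rightarrow> real) \<Rightarrow> real^'m" where
  "stat v = (\<Sum>j<n. (v j - 1) *\<^sub>R a j)"

lemma measurable_point [measurable]: "(\<lambda>(s, y). point s y) \<in> measurable (borel \<Otimes>\<^sub>M seqM) seqM"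
  by (rule measurable_into_seqM) (simp add: point_def case_prod_unfold)

lemma measurable_point2 [measurable]: "point s \<in> measurable seqM seqM"
  by (rule measurable_into_seqM) (simp add: point_def)

lemma measurable_unscale [measurable]: "unscale \<in> measurable (PiM {..<n} (\<lambda>_. borel)) seqM"
proof (rule measurable_into_seqM)
  fix j
  show "(\<lambda>x. unscale x j) \<in> borel_measurable (PiM {..<n} (\<lambda>_. borel))"
    by (cases "j < n") (simp_all add: unscale_def)
qed

lemma measurable_stat [measurable]: "stat \<in> borel_measurable (PiM {..<n} (\<lambda>_. borel))"
proof -
  have "(\<lambda>v. (\<Sum>j<n. (v j - 1) *\<^sub>R a j)) \<in> borel_measurable (PiM {..<n} (\<lambda>_. borel :: real measure))"
    by (intro borel_measurable_sum borel_measurable_scaleR borel_measurable_diff) auto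
  then show ?thesis unfolding stat_def[abs_def] .
qed

lemma stat_point: "y \<in> V \<Longrightarrow> stat (\<lambda>j. w j * point s y j) = s"
proof -
  assume y: "y \<in> V"
  have "stat (\<lambda>j. w j * point s y j) = (\<Sum>j<n. (a j \<bullet> s) *\<^sub>R a j + (w j * y j) *\<^sub>R a j)"
    unfolding stat_def
  proof (rule sum.cong[OF refl])
    fix j assume "j \<in> {..<n}"
    then have "w j * point s y j - 1 = a j \<bullet> s + w j * y j" using w_pos[of j] by (simp add: point_def field_simps)
    then show "(w j * point s y j - 1) *\<^sub>R a j = (a j \<bullet> s) *\<^sub>R a j + (w j * y j) *\<^sub>R a j"
      by (simp add: scaleR_add_left)
  qed
  also have "\<dots> = s" using y isotropic[of s] by (simp add: sum.distrib V_iff)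
  finally show ?thesis .
qed

text \<open>\<open>leb\<close> and \<open>sliced\<close> are two measures on the vectors supported
  below \<open>n\<close>, both invariant under translation by such vectors, which will be
  proportional: Lebesgue measure in the unscaled coordinates, and Lebesgue measure in s times
  \<nu>.\<close>

abbreviation (input) "leb \<equiv> distr (PiM {..<n} (\<lambda>_. lborel)) seqM unscale"

abbreviation (input) "sliced \<equiv> distr (lborel \<Otimes>\<^sub>M \<nu>) seqM (\<lambda>(s, y). point s y)"

definition full :: "(nat \<Rightarrow> real) set" where "full = {x. \<forall>j\<ge>n. x j = 0}"

lemma unscale_measurable_lborel [measurable]: "unscale \<in> measurable (PiM {..<n} (\<lambda>_. lborel)) seqM"
proof -
  have "measurable (PiM {..<n} (\<lambda>_. lborel :: real measure)) seqM = measurable (PiM {..<n} (\<lambda>_. borel :: real measure)) seqM"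
    by (intro measurable_cong_sets sets_PiM_cong) auto
  then show ?thesis using measurable_unscale by simp
qed

lemma emeasure_leb:
  "E \<in> sets seqM \<Longrightarrow> emeasure leb E = emeasure (PiM {..<n} (\<lambda>_. lborel)) (unscale -` E \<inter> space (PiM {..<n} (\<lambda>_. lborel)))"
  by (rule emeasure_distr) measurable

lemma leb_invariant:
  assumes z: "z \<in> full" and [measurable]: "E \<in> sets seqM"
  shows "emeasure leb ((\<lambda>x i. z i + x i) -` E) = emeasure leb E"
proof -
  let ?M = "PiM {..<n} (\<lambda>_. lborel :: real measure)"
  let ?T = "\<lambda>v. \<lambda>i\<in>{..<n}. w i * z i + v i"
  have T: "?T \<in> measurable ?M ?M"
  proof (rule measurable_restrict)
    fix i assume i: "i \<in> {..<n}"
    have "(\<lambda>x. x i) \<in> measurable ?M lborel" by (rule measurable_component_singleton[OF i])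
    then show "(\<lambda>x. w i * z i + x i) \<in> measurable ?M lborel" by simp
  qed
  have "emeasure leb E = emeasure ?M (unscale -` E \<inter> space ?M)" by (rule emeasure_leb) fact
  also have "\<dots> = emeasure (distr ?M ?M ?T) (unscale -` E \<inter> space ?M)"
    by (simp add: translate_PiM_lborel)
  also have "\<dots> = emeasure ?M (?T -` (unscale -` E \<inter> space ?M) \<inter> space ?M)"
    by (rule emeasure_distr[OF T]) measurable
  also have "?T -` (unscale -` E \<inter> space ?M) \<inter> space ?M = unscale -` ((\<lambda>x i. z i + x i) -` E) \<inter> space ?M"
  proof -
    have "unscale (?T v) = (\<lambda>i. z i + unscale v i)" for v
    proof
      fix j
      show "unscale (?T v) j = z j + unscale v j"
        using z w_pos[of j] by (auto simp: unscale_def full_def field_simps)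
    qed
    then show ?thesis using measurable_space[OF T] by auto
  qed
  also have "emeasure ?M \<dots> = emeasure leb ((\<lambda>x i. z i + x i) -` E)"
    using measurable_sets[OF measurable_seqM_shift, of E z] by (intro emeasure_leb[symmetric]) simp
  finally show ?thesis ..
qed

lemma leb_box:
  assumes r: "0 \<le> r"
  shows "emeasure leb {x. \<forall>j<n. 0 \<le> w j * x j \<and> w j * x j \<le> 1} = 1" (is "emeasure leb ?B = 1")
    and "emeasure leb {x. \<forall>j<n. \<bar>x j\<bar> \<le> r} < \<infinity>" (is "emeasure leb ?C < _")
proof -
  interpret product_sigma_finite "\<lambda>_::nat. lborel :: real measure" by standard
  let ?M = "PiM {..<n} (\<lambda>_. lborel :: real measure)"
  have B: "?B \<in> sets seqM"
  proof -
    have "{x \<in> space seqM. \<forall>j<n. 0 \<le> w j * x j \<and> w j * x j \<le> 1} \<in> sets seqM" by measurable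
    then show ?thesis by simp
  qed
  have "emeasure leb ?B = emeasure ?M (PiE {..<n} (\<lambda>_. {0..1}))"
    unfolding emeasure_leb[OF B]
  proof (rule arg_cong[where f="emeasure ?M"], intro set_eqI iffI)
    fix v assume v: "v \<in> unscale -` ?B \<inter> space ?M"
    show "v \<in> PiE {..<n} (\<lambda>_. {0..1})"
    proof (rule PiE_I)
      fix j assume j: "j \<in> {..<n}"
      then have "0 \<le> w j * (v j / w j)" "w j * (v j / w j) \<le> 1" using v by (auto simp: unscale_def)
      then show "v j \<in> {0..1}" using w_pos[of j] j by simp
    qed (use v in \<open>auto simp: space_PiM PiE_def extensional_def\<close>)
  next
    fix v assume v: "v \<in> PiE {..<n} (\<lambda>_. {0..1::real})"
    have "w j * (v j / w j) = v j" if "j < n" for j using w_pos[OF that] by simp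
    then show "v \<in> unscale -` ?B \<inter> space ?M"
      using v by (auto simp: unscale_def space_PiM PiE_def)
  qed
  also have "\<dots> = 1" by (subst emeasure_PiM) auto
  finally show "emeasure leb ?B = 1" .
  have C: "?C \<in> sets seqM"
  proof -
    have "{x \<in> space seqM. \<forall>j<n. \<bar>x j\<bar> \<le> r} \<in> sets seqM" by measurable
    then show ?thesis by simp
  qed
  have "emeasure leb ?C = emeasure ?M (PiE {..<n} (\<lambda>j. {- (r * w j)..r * w j}))"
    unfolding emeasure_leb[OF C]
  proof (rule arg_cong[where f="emeasure ?M"], intro set_eqI iffI)
    fix v assume v: "v \<in> unscale -` ?C \<inter> space ?M"
    show "v \<in> PiE {..<n} (\<lambda>j. {- (r * w j)..r * w j})"
    proof (rule PiE_I)
      fix j assume j: "j \<in> {..<n}"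
      then have "\<bar>v j / w j\<bar> \<le> r" using v by (auto simp: unscale_def)
      then show "v j \<in> {- (r * w j)..r * w j}" using w_pos[of j] j by (simp add: abs_le_iff field_simps)
    qed (use v in \<open>auto simp: space_PiM PiE_def extensional_def\<close>)
  next
    fix v assume v: "v \<in> PiE {..<n} (\<lambda>j. {- (r * w j)..r * w j})"
    have "\<bar>v j / w j\<bar> \<le> r" if "j < n" for j
      using v w_pos[OF that] that by (auto simp: PiE_def Pi_def abs_le_iff field_simps)
    then show "v \<in> unscale -` ?C \<inter> space ?M"
      using v by (auto simp: unscale_def space_PiM PiE_def)
  qed
  also have "\<dots> = (\<Prod>j<n. ennreal (2 * (r * w j)))"
    using r w_pos by (subst emeasure_PiM) (auto intro!: prod.cong simp: less_imp_le)
  also have "\<dots> < \<infinity>" by (simp add: less_top[symmetric] ennreal_prod_eq_top)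
  finally show "emeasure leb ?C < \<infinity>" .
qed

lemma emeasure_sliced:
  assumes [measurable]: "E \<in> sets seqM"
  shows "emeasure sliced E = (\<integral>\<^sup>+s. emeasure \<nu> (point s -` E) \<partial>lborel)"
proof -
  have 1: "(\<lambda>(s, y). point s y) \<in> measurable (lborel \<Otimes>\<^sub>M \<nu>) seqM" by measurable
  show ?thesis
    unfolding emeasure_distr[OF 1 assms] \<nu>.emeasure_pair_measure_alt[OF measurable_sets[OF 1 assms]]
    by (intro nn_integral_cong arg_cong[where f="emeasure \<nu>"]) (auto simp: space_pair_measure)
qed

text \<open>A translation by \<open>z\<close> splits into a shift of s by \<open>s0\<close>, the
  linear statistic of w z, and a kernel vector \<open>y0\<close>. The latter is absorbed by
  invariance of \<nu> within each slice, the former by invariance of Lebesgue measure in s.\<close>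

lemma sliced_invariant:
  assumes z: "z \<in> full" and E [measurable]: "E \<in> sets seqM"
  shows "emeasure sliced ((\<lambda>x i. z i + x i) -` E) = emeasure sliced E"
proof -
  define s0 where "s0 = (\<Sum>j<n. (w j * z j) *\<^sub>R a j)"
  define y0 where "y0 j = (if j < n then z j - (a j \<bullet> s0) / w j else 0)" for j
  have y0: "y0 \<in> V"
  proof -
    have "(\<Sum>j<n. (w j * y0 j) *\<^sub>R a j) = (\<Sum>j<n. (w j * z j) *\<^sub>R a j - (a j \<bullet> s0) *\<^sub>R a j)"
    proof (rule sum.cong[OF refl])
      fix j assume "j \<in> {..<n}"
      then have "w j * y0 j = w j * z j - a j \<bullet> s0" using w_pos[of j] by (simp add: y0_def field_simps)
      then show "(w j * y0 j) *\<^sub>R a j = (w j * z j) *\<^sub>R a j - (a j \<bullet> s0) *\<^sub>R a j"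
        by (simp add: scaleR_diff_left)
    qed
    also have "\<dots> = 0" using isotropic[of s0] by (simp add: sum_subtractf s0_def)
    finally show ?thesis by (simp add: V_iff y0_def)
  qed
  have pt: "(\<lambda>i. z i + point s y i) = point (s0 + s) (\<lambda>i. y0 i + y i)" for s y
    using z w_pos by (auto simp: point_def y0_def full_def fun_eq_iff inner_add_right add_divide_distrib diff_divide_distrib)
  have "emeasure sliced ((\<lambda>x i. z i + x i) -` E) = (\<integral>\<^sup>+s. emeasure \<nu> (point s -` ((\<lambda>x i. z i + x i) -` E)) \<partial>lborel)"
    using measurable_sets[OF measurable_seqM_shift E, of z] by (intro emeasure_sliced) simp
  also have "\<dots> = (\<integral>\<^sup>+s. emeasure \<nu> (point (s0 + s) -` E) \<partial>lborel)"
  proof (rule nn_integral_cong)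
    fix s
    have "point s -` ((\<lambda>x i. z i + x i) -` E) = (\<lambda>x i. y0 i + x i) -` (point (s0 + s) -` E)"
      by (auto simp: pt)
    then show "emeasure \<nu> (point s -` ((\<lambda>x i. z i + x i) -` E)) = emeasure \<nu> (point (s0 + s) -` E)"
      using invariant[OF y0, of "point (s0 + s) -` E"] measurable_sets[OF measurable_point2 E, of "s0 + s"] by simp
  qed
  also have "\<dots> = (\<integral>\<^sup>+s. emeasure \<nu> (point s -` E) \<partial>(distr lborel borel ((+) s0)))"
  proof -
    have "(\<lambda>s. emeasure \<nu> (Pair s -` {(s, y). point s y \<in> E})) \<in> borel_measurable borel"
    proof (rule \<nu>.measurable_emeasure_Pair)
      have "{p \<in> space (borel \<Otimes>\<^sub>M seqM). point (fst p) (snd p) \<in> E} \<in> sets (borel \<Otimes>\<^sub>M seqM)"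
        using measurable_sets[OF measurable_point E] by (simp add: vimage_def case_prod_unfold Int_def conj_commute)
      also have "sets (borel \<Otimes>\<^sub>M seqM) = sets (borel \<Otimes>\<^sub>M \<nu>)"
        by (rule sets_pair_measure_cong) (simp_all add: sets_\<nu>)
      finally show "{(s, y). point s y \<in> E} \<in> sets ((borel :: (real^'m) measure) \<Otimes>\<^sub>M \<nu>)"
        by (simp add: space_pair_measure case_prod_unfold)
    qed
    then have "(\<lambda>s. emeasure \<nu> (point s -` E)) \<in> borel_measurable (borel :: (real^'m) measure)"
      by (simp add: vimage_def)
    then show ?thesis by (subst nn_integral_distr) auto
  qed
  also have "\<dots> = emeasure sliced E" by (simp add: lborel_distr_plus emeasure_sliced)
  finally show ?thesis .
qed

lemma point_bound:
  assumes y: "y \<in> V" and j: "j < n" and s: "norm s \<le> \<rho>" and x: "\<bar>point s y j\<bar> \<le> r"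
  shows "\<bar>y j\<bar> \<le> r + (\<Sum>i<n. (1 + norm (a i) * \<rho>) / w i)"
proof -
  have "0 \<le> \<rho>" using s norm_ge_zero order_trans by blast
  have "\<bar>a j \<bullet> s\<bar> \<le> norm (a j) * \<rho>"
    using Cauchy_Schwarz_ineq2[of "a j" s] mult_left_mono[OF s, of "norm (a j)"] by simp
  then have "\<bar>(1 + a j \<bullet> s) / w j\<bar> \<le> (1 + norm (a j) * \<rho>) / w j"
    using w_pos[OF j] by (simp add: abs_divide divide_right_mono)
  also have "\<dots> \<le> (\<Sum>i<n. (1 + norm (a i) * \<rho>) / w i)"
    using j w_pos \<open>0 \<le> \<rho>\<close> by (intro member_le_sum) (auto intro!: divide_nonneg_pos add_nonneg_nonneg)
  finally show ?thesis using x j unfolding point_def by (simp only: if_True)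
qed

text \<open>The coordinates (s, y) stay bounded on a box: s is the statistic of the point, hence of
  norm at most \<rho>, and y is the point minus a bounded vector. So the mass is at most that of a
  box under \<nu> times the volume of a ball.\<close>

lemma sliced_box:
  assumes r: "0 < r"
  shows "emeasure sliced {x. \<forall>j<n. \<bar>x j\<bar> \<le> r} < \<infinity>" (is "emeasure sliced ?C < _")
proof -
  define \<rho> where "\<rho> = (\<Sum>j<n. (w j * r + 1) * norm (a j))"
  define r' where "r' = r + (\<Sum>i<n. (1 + norm (a i) * \<rho>) / w i)"
  have \<rho>: "0 \<le> \<rho>" unfolding \<rho>_def using w_pos r by (intro sum_nonneg) (auto intro!: mult_nonneg_nonneg add_nonneg_nonneg intro: less_imp_le)
  have r': "0 < r'" unfolding r'_def using r w_pos \<rho>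
    by (intro add_pos_nonneg sum_nonneg) (auto intro!: divide_nonneg_pos add_nonneg_nonneg)
  let ?D = "{y. \<forall>j<n. \<bar>y j\<bar> \<le> r'}"
  have C: "?C \<in> sets seqM" "?D \<in> sets seqM"
  proof -
    have "{x \<in> space seqM. \<forall>j<n. \<bar>x j\<bar> \<le> c} \<in> sets seqM" for c by measurable
    then show "?C \<in> sets seqM" "?D \<in> sets seqM" by simp_all
  qed
  have "emeasure sliced ?C = (\<integral>\<^sup>+s. emeasure \<nu> (point s -` ?C) \<partial>lborel)" by (rule emeasure_sliced[OF C(1)])
  also have "\<dots> \<le> (\<integral>\<^sup>+s. emeasure \<nu> ?D * indicator (cball (0::real^'m) \<rho>) s \<partial>lborel)"
  proof (rule nn_integral_mono)
    fix s :: "real^'m"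
    have sub: "norm s \<le> \<rho> \<and> y \<in> ?D" if y: "y \<in> V" "point s y \<in> ?C" for y
    proof -
      have "norm s = norm (\<Sum>j<n. (w j * point s y j - 1) *\<^sub>R a j)"
        using stat_point[OF y(1), of s] by (simp add: stat_def)
      also have "\<dots> \<le> (\<Sum>j<n. norm ((w j * point s y j - 1) *\<^sub>R a j))" by (rule norm_sum)
      also have "\<dots> \<le> \<rho>" unfolding \<rho>_def
      proof (rule sum_mono)
        fix j assume j: "j \<in> {..<n}"
        have "\<bar>w j * point s y j - 1\<bar> \<le> \<bar>w j * point s y j\<bar> + 1" by linarith
        also have "\<bar>w j * point s y j\<bar> \<le> w j * r"
          using y(2) j w_pos[of j] by (auto simp: abs_mult intro!: mult_left_mono)
        finally show "norm ((w j * point s y j - 1) *\<^sub>R a j) \<le> (w j * r + 1) * norm (a j)"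
          by (simp add: mult_right_mono)
      qed
      finally have s: "norm s \<le> \<rho>" .
      moreover have "y \<in> ?D"
        unfolding r'_def using point_bound[OF y(1) _ s] y(2) by blast
      ultimately show ?thesis by blast
    qed
    have "emeasure \<nu> (point s -` ?C) \<le> emeasure \<nu> (if norm s \<le> \<rho> then ?D else {})"
      using AE_V sub C by (intro emeasure_mono_AE) (auto simp: sets_\<nu> elim!: eventually_mono)
    then show "emeasure \<nu> (point s -` ?C) \<le> emeasure \<nu> ?D * indicator (cball 0 \<rho>) s"
      by (auto split: if_splits simp: indicator_def)
  qed
  also have "\<dots> = emeasure \<nu> ?D * emeasure lborel (cball (0::real^'m) \<rho>)"
    by (rule nn_integral_cmult_indicator) simp
  also have "\<dots> < \<infinity>"
    using bounded_finite[OF r'] emeasure_bounded_finite[of "cball (0::real^'m) \<rho>"]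
    by (simp add: ennreal_mult_less_top)
  finally show ?thesis .
qed

text \<open>Uniqueness of the invariant measure, tested on the box w x in [0,1]^n, whose Lebesgue
  mass in the unscaled coordinates is 1. The constant is thus the sliced mass of the reflected box:
  finite because the box is bounded, and nonzero because otherwise the sliced measure would
  vanish.\<close>

lemma slicing:
  obtains c :: ennreal where "c \<noteq> 0" "c < \<infinity>"
    "\<And>F. F \<in> borel_measurable seqM \<Longrightarrow>
       (\<integral>\<^sup>+s. (\<integral>\<^sup>+y. F (point s y) \<partial>\<nu>) \<partial>lborel) = c * (\<integral>\<^sup>+v. F (unscale v) \<partial>PiM {..<n} (\<lambda>_. lborel))"
proof -
  let ?B = "{x. \<forall>j<n. 0 \<le> w j * x j \<and> w j * x j \<le> 1}"
  let ?nB = "(\<lambda>x i. - x i) -` ?B"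
  have sfl: "sigma_finite_measure leb"
    by (rule sigma_finite_seqM[where n=n]) (use leb_box(2) in auto)
  have sfs: "sigma_finite_measure sliced"
    by (rule sigma_finite_seqM[where n=n]) (use sliced_box in auto)
  have full: "{x. \<forall>j\<ge>n. x j = 0} \<in> sets seqM"
  proof -
    have "{x \<in> space seqM. \<forall>j\<ge>n. x j = 0} \<in> sets seqM" by measurable
    then show ?thesis by simp
  qed
  have B: "?B \<in> sets seqM" 
  proof -
    have "{x \<in> space seqM. \<forall>j<n. 0 \<le> w j * x j \<and> w j * x j \<le> 1} \<in> sets seqM" by measurable
    then show ?thesis by simp
  qed
  have nB: "?nB \<in> sets seqM"
  proof -
    have "(\<lambda>x i. - x i) \<in> measurable seqM seqM" by (rule measurable_into_seqM) measurable
    from measurable_sets[OF this B] show ?thesis by simp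
  qed
  define c where "c = emeasure sliced ?nB"
  have eq: "emeasure sliced E = c * emeasure leb E" if E: "E \<in> sets seqM" for E
  proof -
    have "emeasure sliced E * emeasure leb ?B = emeasure leb E * emeasure sliced ?nB"
    proof (rule translation_invariant_unique[OF _ _ sfl sfs leb_invariant sliced_invariant _ _ _ E B])
      show "AE x in leb. x \<in> full"
        unfolding full_def by (subst AE_distr_iff) (auto simp: unscale_def full intro: full)
      show "AE x in sliced. x \<in> full"
        unfolding full_def by (subst AE_distr_iff) (auto simp: point_def full case_prod_unfold intro: full)
    qed (auto simp: full_def)
    then show ?thesis using leb_box(1)[of 0] by (simp add: c_def mult.commute)
  qed
  show ?thesis
  proof (rule that[of c])
    show "c \<noteq> 0"
    proof
      assume "c = 0"
      then have "emeasure sliced UNIV = 0" using eq[of UNIV] sets.top[of seqM] by simp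
      \<comment> \<open>The total sliced mass is the infinite Lebesgue mass of R^m times the nonzero
        total mass of \<nu>, which cannot be 0.\<close>
      then have "nn_integral (lborel :: (real^'m) measure) (\<lambda>s. emeasure \<nu> UNIV) = 0" using emeasure_sliced[of UNIV] sets.top[of seqM] by simp
      then show False using nontrivial by (simp add: ennreal_top_mult)
    qed
    have "?nB \<subseteq> {x. \<forall>j<n. \<bar>x j\<bar> \<le> (\<Sum>i<n. 1 / w i) + 1}"
    proof safe
      fix x j assume x: "\<forall>j<n. 0 \<le> w j * - x j \<and> w j * - x j \<le> 1" and j: "j < n"
      then have *: "0 \<le> w j * - x j" "w j * - x j \<le> 1" by blast+
      then have "x j \<le> 0" using w_pos[OF j] by (simp add: zero_le_mult_iff mult_le_0_iff)
      then have "\<bar>x j\<bar> \<le> 1 / w j" using w_pos[OF j] *(2) by (simp add: pos_le_divide_eq mult.commute)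
      also have "\<dots> \<le> (\<Sum>i<n. 1 / w i)" using j w_pos by (intro member_le_sum) (auto simp: less_imp_le)
      finally show "\<bar>x j\<bar> \<le> (\<Sum>i<n. 1 / w i) + 1" by simp
    qed
    moreover have "0 < (\<Sum>i<n. 1 / w i) + 1"
      using w_pos by (intro add_nonneg_pos sum_nonneg) (auto simp: less_imp_le)
    ultimately show "c < \<infinity>" unfolding c_def
      by (intro order_le_less_trans[OF emeasure_mono sliced_box]) (auto intro: sets_seqM_box)
  next
    fix F :: "(nat \<Rightarrow> real) \<Rightarrow> ennreal" assume F [measurable]: "F \<in> borel_measurable seqM"
    have "sliced = scale_measure c leb"
      by (rule measure_eqI) (auto simp: eq)
    then have "(\<integral>\<^sup>+x. F x \<partial>sliced) = c * (\<integral>\<^sup>+x. F x \<partial>leb)"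
      by (simp add: nn_integral_scale_measure)
    also have "(\<integral>\<^sup>+x. F x \<partial>leb) = (\<integral>\<^sup>+v. F (unscale v) \<partial>PiM {..<n} (\<lambda>_. lborel))"
      by (rule nn_integral_distr) measurable
    also have "(\<integral>\<^sup>+x. F x \<partial>sliced) = (\<integral>\<^sup>+p. F (point (fst p) (snd p)) \<partial>(lborel \<Otimes>\<^sub>M \<nu>))"
      by (subst nn_integral_distr) (auto simp: case_prod_unfold)
    also have "\<dots> = (\<integral>\<^sup>+s. (\<integral>\<^sup>+y. F (point s y) \<partial>\<nu>) \<partial>lborel)"
      by (subst \<nu>.nn_integral_fst[symmetric]) auto
    finally show "(\<integral>\<^sup>+s. (\<integral>\<^sup>+y. F (point s y) \<partial>\<nu>) \<partial>lborel) = c * (\<integral>\<^sup>+v. F (unscale v) \<partial>PiM {..<n} (\<lambda>_. lborel))" .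
  qed
qed

end

section \<open>The slice through the centre\<close>

context affine_slice begin

text \<open>Up to a constant factor, the density of V expressed in x = V / w, multiplied by the test
  function of the selected coordinates of V.\<close>

definition wt :: "(real^'k::finite \<Rightarrow> real) \<Rightarrow> ('k \<Rightarrow> nat) \<Rightarrow> (nat \<Rightarrow> real) \<Rightarrow> real" where
  "wt f jj x = (if \<forall>j<n. 0 \<le> x j then f (\<chi> i. w (jj i) * x (jj i)) * exp (- (\<Sum>j<n. w j * x j)) else 0)"

definition slice :: "(real^'k::finite \<Rightarrow> real) \<Rightarrow> ('k \<Rightarrow> nat) \<Rightarrow> real^'m \<Rightarrow> ennreal" where
  "slice f jj s = (\<integral>\<^sup>+y. ennreal (wt f jj (point s y)) \<partial>\<nu>)"

lemma measurable_wt [measurable]: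
  assumes [measurable]: "f \<in> borel_measurable borel"
  shows "wt f jj \<in> borel_measurable seqM"
  unfolding wt_def[abs_def] by measurable

lemma wt_bounds:
  assumes w: "\<And>x. 0 \<le> f x" "\<And>x. f x \<le> M"
  shows "0 \<le> wt f jj x" "wt f jj x \<le> M"
proof -
  show "0 \<le> wt f jj x" using w by (simp add: wt_def)
  have M: "0 \<le> M" using w order_trans by blast
  have "f z * exp (- (\<Sum>j<n. w j * x j)) \<le> M * 1" if x: "\<forall>j<n. 0 \<le> x j" for z
  proof -
    have "0 \<le> (\<Sum>j<n. w j * x j)"
      using x w_pos by (intro sum_nonneg mult_nonneg_nonneg) (auto intro: less_imp_le)
    then show ?thesis using w M by (intro mult_mono) auto
  qed
  with M show "wt f jj x \<le> M" by (simp add: wt_def)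
qed

text \<open>On the slice s the total of the w_j x_j is n + (sum of the a_j . s), hence bounded
  uniformly for |s| <= \<rho>. Nonnegative points with bounded total lie in a fixed box, and off the
  orthant the weight is 0; one box therefore serves all these slices.\<close>

lemma slice_dominated:
  assumes f: "\<And>x. 0 \<le> f x" "\<And>x. f x \<le> M" and \<rho>: "0 \<le> \<rho>"
  obtains R where "0 < R"
    "\<And>s. norm s \<le> \<rho> \<Longrightarrow> AE y in \<nu>. ennreal (wt f jj (point s y)) \<le> ennreal M * indicator {y. \<forall>j<n. \<bar>y j\<bar> \<le> R} y"
proof -
  define C where "C = real n + (\<Sum>j<n. norm (a j) * \<rho>)"
  have C: "0 \<le> C" using \<rho> by (auto simp: C_def intro!: add_nonneg_nonneg sum_nonneg)
  define r where "r = C * (\<Sum>j<n. 1 / w j)"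
  define R where "R = 1 + (r + (\<Sum>i<n. (1 + norm (a i) * \<rho>) / w i))"
  have w1: "0 \<le> (\<Sum>j<n. 1 / w j)" using w_pos by (intro sum_nonneg) (auto simp: less_imp_le)
  have R: "0 < R"
    unfolding R_def r_def using C w1 w_pos \<rho>
    by (intro add_pos_nonneg add_nonneg_nonneg sum_nonneg mult_nonneg_nonneg) (auto intro!: divide_nonneg_pos add_nonneg_nonneg intro: less_imp_le)
  show ?thesis
  proof (rule that[OF R])
    fix s :: "real^'m" assume s: "norm s \<le> \<rho>"
    show "AE y in \<nu>. ennreal (wt f jj (point s y)) \<le> ennreal M * indicator {y. \<forall>j<n. \<bar>y j\<bar> \<le> R} y"
      using AE_V
    proof eventually_elim
      fix y assume y: "y \<in> V"
      show "ennreal (wt f jj (point s y)) \<le> ennreal M * indicator {y. \<forall>j<n. \<bar>y j\<bar> \<le> R} y"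
      proof (cases "\<forall>j<n. 0 \<le> point s y j")
        case True
        have "(\<Sum>j<n. w j * point s y j) = (\<Sum>j<n. (1 + a j \<bullet> s) + w j * y j)"
        proof (rule sum.cong[OF refl])
          fix j assume "j \<in> {..<n}"
          then show "w j * point s y j = (1 + a j \<bullet> s) + w j * y j"
            using w_pos[of j] by (simp add: point_def field_simps)
        qed
        also have "\<dots> = real n + (\<Sum>j<n. a j \<bullet> s)" by (simp add: sum.distrib V_sum[OF y])
        also have "\<dots> \<le> C"
          unfolding C_def
        proof (intro add_left_mono sum_mono)
          fix j show "a j \<bullet> s \<le> norm (a j) * \<rho>"
            using Cauchy_Schwarz_ineq2[of "a j" s] mult_left_mono[OF s, of "norm (a j)"] by simp
        qed
        finally have tot: "(\<Sum>j<n. w j * point s y j) \<le> C" .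
        have "\<bar>y j\<bar> \<le> R" if j: "j < n" for j
        proof -
          have "w j * point s y j \<le> (\<Sum>j<n. w j * point s y j)"
            using j True w_pos by (intro member_le_sum mult_nonneg_nonneg) (auto intro: less_imp_le)
          then have "w j * point s y j \<le> C" using tot by linarith
          then have "point s y j \<le> C * (1 / w j)" using w_pos[OF j] by (simp add: field_simps)
          also have "\<dots> \<le> r" unfolding r_def
            using C j w_pos by (intro mult_left_mono member_le_sum) (auto simp: less_imp_le)
          finally have "\<bar>point s y j\<bar> \<le> r" using True j by simp
          from point_bound[OF y j s this] show ?thesis by (simp add: R_def)
        qed
        then show ?thesis using wt_bounds(2)[of f M jj "point s y"] f by (simp add: ennreal_leI)
      next
        case False
        then have "wt f jj (point s y) = 0" by (auto simp: wt_def)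
        then show ?thesis by simp
      qed
    qed
  qed
qed

lemma box_integral:
  assumes "0 < R"
  shows "(\<integral>\<^sup>+y. ennreal M * indicator {y. \<forall>j<n. \<bar>y j\<bar> \<le> R} y \<partial>\<nu>) < \<infinity>"
  using bounded_finite[OF assms] sets_seqM_box[of n R]
  by (subst nn_integral_cmult_indicator) (auto simp: sets_\<nu> ennreal_mult_less_top)

text \<open>A coordinate hyperplane either misses the slice or has a continuum of disjoint translates of equal mass.\<close>

lemma boundary_null:
  assumes j: "j < n"
  shows "AE y in \<nu>. point 0 y j \<noteq> 0"
proof (cases "\<exists>u\<in>V. u j \<noteq> 0")
  case True
  then obtain u where u: "u \<in> V" "u j \<noteq> 0" by auto
  let ?Z = "{y. y j = - (1 / w j)}"
  have Z: "?Z \<in> sets seqM"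
  proof -
    have "{y \<in> space seqM. y j = - (1 / w j)} \<in> sets seqM" by measurable
    then show ?thesis by simp
  qed
  interpret pair_sigma_finite "lborel :: real measure" \<nu> by standard
  have tu: "(\<lambda>i. t * u i) \<in> V" for t
  proof -
    have "(\<Sum>j<n. (w j * (t * u j)) *\<^sub>R a j) = t *\<^sub>R (\<Sum>j<n. (w j * u j) *\<^sub>R a j)"
      by (simp add: scaleR_sum_right mult_ac)
    then show ?thesis using u(1) by (simp add: V_iff)
  qed
  \<comment> \<open>All translates of \<open>?Z\<close> along the line through \<open>u\<close> have
    the same mass, so integrating it over t gives infinitely many copies; by Fubini the integral is
    0, because for given y a single t solves the equation.\<close>
  have "emeasure \<nu> ?Z * \<infinity> = (\<integral>\<^sup>+t. emeasure \<nu> ?Z \<partial>(lborel :: real measure))" by simp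
  also have "\<dots> = (\<integral>\<^sup>+t. (\<integral>\<^sup>+y. indicator {(t, y). t * u j + y j = - (1 / w j)} (t, y) \<partial>\<nu>) \<partial>(lborel :: real measure))"
  proof (rule nn_integral_cong)
    fix t :: real
    have "emeasure \<nu> ?Z = emeasure \<nu> ((\<lambda>x i. t * u i + x i) -` ?Z)"
      by (rule invariant[OF tu Z, symmetric])
    also have "\<dots> = (\<integral>\<^sup>+y. indicator ((\<lambda>x i. t * u i + x i) -` ?Z) y \<partial>\<nu>)"
      using measurable_sets[OF measurable_seqM_shift Z] by (intro nn_integral_indicator[symmetric]) (simp add: sets_\<nu>)
    finally show "emeasure \<nu> ?Z = (\<integral>\<^sup>+y. indicator {(t, y). t * u j + y j = - (1 / w j)} (t, y) \<partial>\<nu>)"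
      by (simp add: indicator_def)
  qed
  also have "\<dots> = (\<integral>\<^sup>+y. (\<integral>\<^sup>+t. indicator {(t, y). t * u j + y j = - (1 / w j)} (t, y) \<partial>(lborel :: real measure)) \<partial>\<nu>)"
  proof (rule Fubini'[symmetric])
    have "{p \<in> space (lborel \<Otimes>\<^sub>M \<nu>). fst p * u j + snd p j = - (1 / w j)} \<in> sets (lborel \<Otimes>\<^sub>M \<nu>)"
      by measurable
    then have "{(t, y). t * u j + y j = - (1 / w j)} \<in> sets (lborel \<Otimes>\<^sub>M \<nu>)"
      by (simp add: space_pair_measure case_prod_unfold)
    then show "(\<lambda>(t, y). indicator {(t, y). t * u j + y j = - (1 / w j)} (t, y)) \<in> borel_measurable (lborel \<Otimes>\<^sub>M \<nu>)"
      by (simp add: case_prod_eta)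
  qed
  also have "\<dots> = (\<integral>\<^sup>+y. 0 \<partial>\<nu>)"
  proof (rule nn_integral_cong)
    fix y
    have "(\<integral>\<^sup>+t. indicator {(t, y). t * u j + y j = - (1 / w j)} (t, y) \<partial>(lborel :: real measure))
       = (\<integral>\<^sup>+t. indicator {(- (1 / w j) - y j) / u j} t \<partial>lborel)"
      using u(2) by (intro nn_integral_cong) (auto simp: indicator_def field_simps)
    then show "(\<integral>\<^sup>+t. indicator {(t, y). t * u j + y j = - (1 / w j)} (t, y) \<partial>(lborel :: real measure)) = 0" by simp
  qed
  finally have "emeasure \<nu> ?Z = 0" by (simp add: ennreal_mult_eq_top_iff ennreal_zero_less_mult_iff)
  then have "AE y in \<nu>. y \<notin> ?Z" using Z by (intro AE_not_in) (simp add: null_sets_def sets_\<nu>)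
  then show ?thesis by eventually_elim (use j in \<open>auto simp: point_def\<close>)
next
  case False
  \<comment> \<open>Every vector of \<open>V\<close> vanishes in coordinate \<open>j\<close>, so on
    the central slice this coordinate is constantly \<open>1 / w j\<close>.\<close>
  show ?thesis using AE_V by eventually_elim (use False j w_pos[OF j] in \<open>auto simp: point_def\<close>)
qed

text \<open>The weight jumps only across the boundary of the orthant, which is null in the central
  slice. At every other point the signs are stable as s tends to 0, and dominated convergence
  applies. Continuity is obtained at s = 0 only, the one place where it is used.\<close>

lemma slice_tendsto:
  assumes f: "continuous_on UNIV f" "\<And>x. 0 \<le> f x" "\<And>x. f x \<le> M" and jj: "\<And>i. jj i < n"
    and s: "s \<longlonglongrightarrow> 0" "\<And>N. norm (s N) \<le> \<rho>"
  shows "(\<lambda>N. slice f jj (s N)) \<longlonglongrightarrow> slice f jj 0"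
proof -
  have [measurable]: "f \<in> borel_measurable borel" using f(1) by (rule borel_measurable_continuous_onI)
  have \<rho>: "0 \<le> \<rho>" using s(2)[of 0] norm_ge_zero order_trans by blast
  obtain R where R: "0 < R" "\<And>s. norm s \<le> \<rho> \<Longrightarrow> AE y in \<nu>. ennreal (wt f jj (point s y)) \<le> ennreal M * indicator {y. \<forall>j<n. \<bar>y j\<bar> \<le> R} y"
    by (rule slice_dominated[where f=f and M=M and jj=jj, OF f(2,3) \<rho>]) blast
  have bd: "AE y in \<nu>. \<forall>j<n. point 0 y j \<noteq> 0"
    using boundary_null by (subst AE_all_countable; intro allI)+ (auto simp: AE_conj_iff)
  show ?thesis
    unfolding slice_def
  proof (rule nn_integral_dominated_convergence)
    show "(\<integral>\<^sup>+y. ennreal M * indicator {y. \<forall>j<n. \<bar>y j\<bar> \<le> R} y \<partial>\<nu>) < \<infinity>" by (rule box_integral[OF R(1)])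
    show "AE y in \<nu>. ennreal (wt f jj (point (s N) y)) \<le> ennreal M * indicator {y. \<forall>j<n. \<bar>y j\<bar> \<le> R} y" for N
      by (rule R(2)[OF s(2)])
    show "AE y in \<nu>. (\<lambda>N. ennreal (wt f jj (point (s N) y))) \<longlonglongrightarrow> ennreal (wt f jj (point 0 y))"
      using bd
    proof eventually_elim
      fix y assume y: "\<forall>j<n. point 0 y j \<noteq> 0"
      have pt: "(\<lambda>N. point (s N) y j) \<longlonglongrightarrow> point 0 y j" for j
        unfolding point_def using s(1) w_pos[of j] by (cases "j < n") (auto intro!: tendsto_eq_intros)
      show "(\<lambda>N. ennreal (wt f jj (point (s N) y))) \<longlonglongrightarrow> ennreal (wt f jj (point 0 y))"
      proof (cases "\<forall>j<n. 0 \<le> point 0 y j")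
        case True
        then have "\<forall>j<n. \<forall>\<^sub>F N in sequentially. 0 < point (s N) y j"
          using y order_tendstoD(1)[OF pt] by (metis order_le_less)
        then have "\<forall>\<^sub>F N in sequentially. \<forall>j\<in>{..<n}. 0 < point (s N) y j"
          by (intro eventually_ball_finite) auto
        then have ev: "\<forall>\<^sub>F N in sequentially. f (\<chi> i. w (jj i) * point (s N) y (jj i)) * exp (- (\<Sum>j<n. w j * point (s N) y j))
             = wt f jj (point (s N) y)"
          by eventually_elim (auto simp: wt_def less_imp_le)
        have "(\<lambda>N. (\<chi> i. w (jj i) * point (s N) y (jj i))) \<longlonglongrightarrow> (\<chi> i. w (jj i) * point 0 y (jj i))"
          by (intro tendsto_vec_lambda tendsto_intros pt)
        then have "(\<lambda>N. f (\<chi> i. w (jj i) * point (s N) y (jj i))) \<longlonglongrightarrow> f (\<chi> i. w (jj i) * point 0 y (jj i))"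
          using f(1) by (intro continuous_on_tendsto_compose[OF f(1)]) auto
        then have "(\<lambda>N. f (\<chi> i. w (jj i) * point (s N) y (jj i)) * exp (- (\<Sum>j<n. w j * point (s N) y j)))
            \<longlonglongrightarrow> f (\<chi> i. w (jj i) * point 0 y (jj i)) * exp (- (\<Sum>j<n. w j * point 0 y j))"
          by (intro tendsto_intros pt)
        also have "f (\<chi> i. w (jj i) * point 0 y (jj i)) * exp (- (\<Sum>j<n. w j * point 0 y j)) = wt f jj (point 0 y)"
          using True by (simp add: wt_def)
        finally show ?thesis
          using ev by (intro tendsto_ennrealI) (rule Lim_transform_eventually)
      next
        case False
        then obtain j where j: "j < n" "point 0 y j < 0" by (auto simp: not_le)
        have "\<forall>\<^sub>F N in sequentially. point (s N) y j < 0"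
          using order_tendstoD(2)[OF pt j(2)] .
        then have "\<forall>\<^sub>F N in sequentially. 0 = ennreal (wt f jj (point (s N) y))"
          by eventually_elim (use j in \<open>auto simp: wt_def not_le[symmetric]\<close>)
        moreover have "wt f jj (point 0 y) = 0" using False by (auto simp: wt_def)
        ultimately show ?thesis using Lim_transform_eventually[OF tendsto_const[of 0]] by simp
      qed
    qed
  qed (use sets_seqM_box[of n R] in measurable)
qed

lemma slice_bounded:
  assumes f: "\<And>x. 0 \<le> f x" "\<And>x. f x \<le> M"
  obtains B where "B < \<infinity>" "\<And>s. norm s \<le> 1 \<Longrightarrow> slice f jj s \<le> B"
proof -
  obtain R where R: "0 < R" "\<And>s. norm s \<le> 1 \<Longrightarrow> AE y in \<nu>. ennreal (wt f jj (point s y)) \<le> ennreal M * indicator {y. \<forall>j<n. \<bar>y j\<bar> \<le> R} y"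
    by (rule slice_dominated[where f=f and M=M and jj=jj and \<rho>=1, OF f]) auto
  show ?thesis
    by (rule that[OF box_integral[OF R(1), of M]]) (auto simp: slice_def intro!: nn_integral_mono_AE R(2))
qed

lemma measurable_slice [measurable]:
  assumes [measurable]: "f \<in> borel_measurable borel"
  shows "slice f jj \<in> borel_measurable borel"
proof -
  have "(\<lambda>s. \<integral>\<^sup>+y. ennreal (wt f jj (point s y)) \<partial>\<nu>) \<in> borel_measurable borel"
    by measurable
  then show ?thesis unfolding slice_def[abs_def] .
qed

text \<open>N^m gauss(N s) is an approximate identity; the substitution \<sigma> = N s moves the
  concentration into the argument of the slice. The cutoff to the unit ball confines s to the range
  where \<open>slice_bounded\<close> gives a uniform bound.\<close>

lemma mollified_slice_tendsto:
  assumes f: "continuous_on UNIV f" "\<And>x. 0 \<le> f x" "\<And>x. f x \<le> M" and jj: "\<And>i. jj i < n"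
  shows "(\<lambda>N. \<integral>\<^sup>+s. ennreal (real (Suc N) ^ CARD('m) * gauss (real (Suc N) *\<^sub>R s) * indicator (cball 0 1) s) * slice f jj s \<partial>lborel)
           \<longlonglongrightarrow> slice f jj 0"
proof -
  have [measurable]: "f \<in> borel_measurable borel" using f(1) by (rule borel_measurable_continuous_onI)
  obtain B where B: "B < \<infinity>" "\<And>s. norm s \<le> 1 \<Longrightarrow> slice f jj s \<le> B"
    by (rule slice_bounded[where f=f and M=M and jj=jj, OF f(2,3)]) blast
  let ?g = "\<lambda>N \<sigma>. ennreal (gauss \<sigma>) * (indicator (cball 0 1) (\<sigma> /\<^sub>R real (Suc N)) * slice f jj (\<sigma> /\<^sub>R real (Suc N)))"
  have sl [measurable]: "slice f jj \<in> borel_measurable borel" by (rule measurable_slice) fact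
  have sls [measurable]: "(\<lambda>\<sigma>. slice f jj (\<sigma> /\<^sub>R real (Suc N))) \<in> borel_measurable borel" for N
    by (rule measurable_compose[OF _ sl]) simp
  have g: "?g N \<in> borel_measurable borel" for N
  proof -
    have "(\<lambda>\<sigma>::real^'m. indicator (cball 0 1) (\<sigma> /\<^sub>R real (Suc N)) :: ennreal) \<in> borel_measurable borel"
      by (rule measurable_compose[of "\<lambda>\<sigma>. \<sigma> /\<^sub>R real (Suc N)" borel borel])
         (auto intro: borel_measurable_indicator borel_closed)
    then show ?thesis by (intro borel_measurable_times_ennreal sls) simp_all
  qed
  have tot: "(\<integral>\<^sup>+\<sigma>. ennreal (gauss \<sigma>) \<partial>(lborel :: (real^'m) measure)) = 1"
    using integral_gauss[where ?'m='m] by (subst nn_integral_eq_integral[OF integrable_gauss]) (auto simp: gauss_pos less_imp_le)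
  have "(\<lambda>N. \<integral>\<^sup>+\<sigma>. ?g N \<sigma> \<partial>lborel) \<longlonglongrightarrow> (\<integral>\<^sup>+\<sigma>. ennreal (gauss \<sigma>) * slice f jj 0 \<partial>(lborel :: (real^'m) measure))"
  proof (rule nn_integral_dominated_convergence)
    show "(\<integral>\<^sup>+\<sigma>. ennreal (gauss \<sigma>) * B \<partial>(lborel :: (real^'m) measure)) < \<infinity>"
      using B(1) by (simp add: nn_integral_multc tot)
    show "AE \<sigma> in lborel. ?g N \<sigma> \<le> ennreal (gauss \<sigma>) * B" for N
      using B(2) by (intro AE_I2 mult_left_mono) (auto simp: indicator_def)
    show "AE \<sigma> in lborel. (\<lambda>N. ?g N \<sigma>) \<longlonglongrightarrow> ennreal (gauss \<sigma>) * slice f jj 0"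
    proof (rule AE_I2)
      fix \<sigma> :: "real^'m"
      have inv0: "(\<lambda>N. inverse (real (Suc N))) \<longlonglongrightarrow> 0" by (rule LIMSEQ_inverse_real_of_nat)
      then have s0: "(\<lambda>N. \<sigma> /\<^sub>R real (Suc N)) \<longlonglongrightarrow> 0"
        using tendsto_scaleR[OF inv0 tendsto_const[of \<sigma>]] by simp
      have "norm (\<sigma> /\<^sub>R real (Suc N)) \<le> norm \<sigma>" for N
        by (simp add: divide_le_eq mult_le_cancel_left1 field_simps)
      from slice_tendsto[OF f jj s0 this]
      have sl: "(\<lambda>N. slice f jj (\<sigma> /\<^sub>R real (Suc N))) \<longlonglongrightarrow> slice f jj 0" .
      have "\<forall>\<^sub>F N in sequentially. norm (\<sigma> /\<^sub>R real (Suc N)) < 1"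
        using order_tendstoD(2)[OF tendsto_norm[OF s0], of 1] by simp
      then have ev: "\<forall>\<^sub>F N in sequentially. ennreal (gauss \<sigma>) * slice f jj (\<sigma> /\<^sub>R real (Suc N)) = ?g N \<sigma>"
        by eventually_elim (auto simp: indicator_def)
      have "(\<lambda>N. ennreal (gauss \<sigma>) * slice f jj (\<sigma> /\<^sub>R real (Suc N))) \<longlonglongrightarrow> ennreal (gauss \<sigma>) * slice f jj 0"
        by (intro ennreal_tendsto_cmult sl) simp
      then show "(\<lambda>N. ?g N \<sigma>) \<longlonglongrightarrow> ennreal (gauss \<sigma>) * slice f jj 0"
        using ev by (rule Lim_transform_eventually)
    qed
  qed (use g in simp_all)
  also have "(\<integral>\<^sup>+\<sigma>. ennreal (gauss \<sigma>) * slice f jj 0 \<partial>(lborel :: (real^'m) measure)) = slice f jj 0"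
    by (simp add: nn_integral_multc tot)
  also have "(\<lambda>N. \<integral>\<^sup>+\<sigma>. ?g N \<sigma> \<partial>lborel)
     = (\<lambda>N. \<integral>\<^sup>+s. ennreal (real (Suc N) ^ CARD('m) * gauss (real (Suc N) *\<^sub>R s) * indicator (cball 0 1) s) * slice f jj s \<partial>lborel)"
  proof
    fix N
    have "(\<integral>\<^sup>+\<sigma>. ?g N \<sigma> \<partial>lborel) = (\<integral>\<^sup>+s. ennreal (real (Suc N) ^ DIM(real^'m)) * ?g N (real (Suc N) *\<^sub>R s) \<partial>lborel)"
      by (rule nn_integral_lborel_scale) (simp, rule g)
    also have "\<dots> = (\<integral>\<^sup>+s. ennreal (real (Suc N) ^ CARD('m) * gauss (real (Suc N) *\<^sub>R s) * indicator (cball 0 1) s) * slice f jj s \<partial>lborel)"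
    proof (rule nn_integral_cong)
      fix s :: "real^'m"
      have "(real (Suc N) *\<^sub>R s) /\<^sub>R real (Suc N) = s" by simp
      then show "ennreal (real (Suc N) ^ DIM(real^'m)) * ?g N (real (Suc N) *\<^sub>R s)
          = ennreal (real (Suc N) ^ CARD('m) * gauss (real (Suc N) *\<^sub>R s) * indicator (cball 0 1) s) * slice f jj s"
        using gauss_pos[of "real (Suc N) *\<^sub>R s"]
        by (simp only:) (auto simp: indicator_def ennreal_mult less_imp_le mult.assoc)
    qed
    finally show "(\<integral>\<^sup>+\<sigma>. ?g N \<sigma> \<partial>lborel) = \<dots>" .
  qed
  finally show ?thesis .
qed

section \<open>From slices to independent exponential variables\<close>

abbreviation "EXP \<equiv> PiM {..<n} (\<lambda>_. expo)"

lemma EXP_density: "EXP = density (PiM {..<n} (\<lambda>_. lborel)) (\<lambda>x. \<Prod>j<n. ennreal (exponential_density 1 (x j)))"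
proof (rule PiM_density_lborel)
  show "sigma_finite_measure expo" using prob_space_expo prob_space_imp_sigma_finite by blast
qed auto

lemma sets_EXP: "sets EXP = sets (PiM {..<n} (\<lambda>_. borel))"
  by (rule sets_PiM_cong) auto

lemma wt_unscale:
  assumes f: "\<And>x. 0 \<le> f x" and jj: "\<And>i. jj i < n"
  shows "ennreal (wt f jj (unscale v)) = ennreal (f (\<chi> i. v (jj i))) * (\<Prod>j<n. ennreal (exponential_density 1 (v j)))"
proof (cases "\<forall>j<n. 0 \<le> v j")
  case True
  have "(\<Prod>j<n. ennreal (exponential_density 1 (v j))) = ennreal (\<Prod>j<n. exponential_density 1 (v j))"
    by (intro prod_ennreal) (auto simp: exponential_density_nonneg)
  also have "(\<Prod>j<n. exponential_density 1 (v j)) = exp (- (\<Sum>j<n. v j))"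
    using True by (auto simp: exponential_density_def exp_sum sum_negf[symmetric] intro!: prod.cong)
  finally have e: "(\<Prod>j<n. ennreal (exponential_density 1 (v j))) = ennreal (exp (- (\<Sum>j<n. v j)))" .
  have wu: "w j * unscale v j = v j" "0 \<le> unscale v j" if "j < n" for j
    using that w_pos[OF that] True by (auto simp: unscale_def)
  have "wt f jj (unscale v) = f (\<chi> i. v (jj i)) * exp (- (\<Sum>j<n. v j))"
    using wu jj by (simp add: wt_def)
  then show ?thesis unfolding e using f by (simp add: ennreal_mult)
next
  case False
  then obtain j where j: "j < n" "v j < 0" by (auto simp: not_le)
  then have "exponential_density 1 (v j) = 0" by (simp add: exponential_density_def)
  then have "(\<Prod>j<n. ennreal (exponential_density 1 (v j))) = 0" using j by (intro prod_zero) auto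
  moreover have "unscale v j < 0" using j w_pos[OF j(1)] by (simp add: unscale_def divide_neg_pos)
  then have "wt f jj (unscale v) = 0" using j by (auto simp: wt_def not_le[symmetric])
  ultimately show ?thesis by simp
qed

text \<open>Slicing is applied to h(statistic) times the weight; on the slice s the first factor is
  the constant h(s). The constant \<open>c\<close> is fixed before \<open>h\<close>,
  \<open>f\<close> and \<open>jj\<close>, so that it can cancel between test functions.\<close>

lemma slice_EXP:
  obtains c :: ennreal where "c \<noteq> 0" "c < \<infinity>"
    "\<And>h f jj. h \<in> borel_measurable borel \<Longrightarrow> continuous_on UNIV f \<Longrightarrow> (\<And>x. 0 \<le> f x) \<Longrightarrow> (\<And>i. jj i < n) \<Longrightarrow>
       (\<integral>\<^sup>+s. h s * slice (f :: real^'k::finite \<Rightarrow> real) jj s \<partial>lborel) = c * (\<integral>\<^sup>+v. h (stat v) * ennreal (f (\<chi> i. v (jj i))) \<partial>EXP)"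
proof -
  obtain c where c: "c \<noteq> 0" "c < \<infinity>"
    "\<And>F. F \<in> borel_measurable seqM \<Longrightarrow>
       (\<integral>\<^sup>+s. (\<integral>\<^sup>+y. F (point s y) \<partial>\<nu>) \<partial>lborel) = c * (\<integral>\<^sup>+v. F (unscale v) \<partial>PiM {..<n} (\<lambda>_. lborel))"
    by (rule slicing) blast
  show ?thesis
  proof (rule that[OF c(1,2)])
    fix h :: "real^'m \<Rightarrow> ennreal" and f :: "real^'k \<Rightarrow> real" and jj :: "'k \<Rightarrow> nat"
    assume h [measurable]: "h \<in> borel_measurable borel" and f: "continuous_on UNIV f" "\<And>x. 0 \<le> f x" and jj: "\<And>i. jj i < n"
    have [measurable]: "f \<in> borel_measurable borel" using f(1) by (rule borel_measurable_continuous_onI)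
    define F where "F x = h (stat (\<lambda>j. w j * x j)) * ennreal (wt f jj x)" for x
    have [measurable]: "(\<lambda>x. stat (\<lambda>j. w j * x j)) \<in> borel_measurable seqM"
      unfolding stat_def by measurable
    have F: "F \<in> borel_measurable seqM" unfolding F_def[abs_def] by measurable
    have "(\<integral>\<^sup>+s. h s * slice f jj s \<partial>lborel) = (\<integral>\<^sup>+s. (\<integral>\<^sup>+y. F (point s y) \<partial>\<nu>) \<partial>lborel)"
    proof (rule nn_integral_cong)
      fix s
      have "h s * slice f jj s = (\<integral>\<^sup>+y. h s * ennreal (wt f jj (point s y)) \<partial>\<nu>)"
        unfolding slice_def by (rule nn_integral_cmult[symmetric]) measurable
      also have "\<dots> = (\<integral>\<^sup>+y. F (point s y) \<partial>\<nu>)"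
        using AE_V by (intro nn_integral_cong_AE, eventually_elim) (simp add: F_def stat_point)
      finally show "h s * slice f jj s = (\<integral>\<^sup>+y. F (point s y) \<partial>\<nu>)" .
    qed
    also have "\<dots> = c * (\<integral>\<^sup>+v. F (unscale v) \<partial>PiM {..<n} (\<lambda>_. lborel))" by (rule c(3)[OF F])
    also have "(\<integral>\<^sup>+v. F (unscale v) \<partial>PiM {..<n} (\<lambda>_. lborel)) = (\<integral>\<^sup>+v. h (stat v) * ennreal (f (\<chi> i. v (jj i))) \<partial>EXP)"
    proof -
      have st: "stat (\<lambda>j. w j * unscale v j) = stat v" for v
        unfolding stat_def
      proof (rule sum.cong[OF refl])
        fix j assume "j \<in> {..<n}"
        then show "(w j * unscale v j - 1) *\<^sub>R a j = (v j - 1) *\<^sub>R a j" using w_pos[of j] by (simp add: unscale_def)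
      qed
      have Mc [measurable_cong]: "sets (PiM {..<n} (\<lambda>_. lborel :: real measure)) = sets (PiM {..<n} (\<lambda>_. borel :: real measure))"
        by (rule sets_PiM_cong) auto
      have comp [measurable]: "(\<lambda>v. v j) \<in> borel_measurable (PiM {..<n} (\<lambda>_. borel :: real measure))" if "j \<in> {..<n}" for j
        by (rule measurable_component_singleton[OF that])
      have [measurable]: "(\<lambda>v. f (\<chi> i. v (jj i))) \<in> borel_measurable (PiM {..<n} (\<lambda>_. borel :: real measure))"
        using comp jj by (intro measurable_compose[OF measurable_vec_lambda]) auto
      have [measurable]: "(\<lambda>x. \<Prod>j<n. ennreal (exponential_density 1 (x j))) \<in> borel_measurable (PiM {..<n} (\<lambda>_. borel :: real measure))"
        by (intro borel_measurable_prod_ennreal measurable_compose[OF comp]) auto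
      show ?thesis
        unfolding EXP_density
        by (subst nn_integral_density) (auto simp: F_def st wt_unscale[OF f(2) jj] mult_ac intro!: nn_integral_cong)
    qed
    finally show "(\<integral>\<^sup>+s. h s * slice f jj s \<partial>lborel) = c * (\<integral>\<^sup>+v. h (stat v) * ennreal (f (\<chi> i. v (jj i))) \<partial>EXP)" .
  qed
qed

end

context affine_slice begin

definition cf :: "(real^'k::finite \<Rightarrow> real) \<Rightarrow> ('k \<Rightarrow> nat) \<Rightarrow> real^'m \<Rightarrow> complex" where
  "cf f jj t = (\<integral>v. iexp (t \<bullet> stat v) * complex_of_real (f (\<chi> i. v (jj i))) \<partial>EXP)"

lemma prob_space_EXP: "prob_space EXP"
  by (rule prob_space_PiM) (rule prob_space_expo)

lemma measurable_EXP_sel: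
  assumes f: "f \<in> borel_measurable borel" and jj: "\<And>i. jj i < n"
  shows "(\<lambda>v. f (\<chi> i. v (jj i))) \<in> borel_measurable EXP"
proof -
  have "(\<lambda>v. v (jj i)) \<in> borel_measurable EXP" for i
    using measurable_component_singleton[of "jj i" "{..<n}" "\<lambda>_. expo"] jj by simp
  then show ?thesis by (intro measurable_compose[OF measurable_vec_lambda f]) auto
qed

lemma measurable_EXP_stat [measurable]: "stat \<in> borel_measurable EXP"
  using measurable_stat measurable_cong_sets[OF sets_EXP refl] by blast

text \<open>The kernel r^m exp(-|r x|^2/2) is the Fourier transform of t \<mapsto> gauss(t / r).
  Fubini turns the expectation into the integral of gauss(t / r) times the characteristic function;
  as r grows the Gaussian rises to \<open>gauss 0\<close>, and integrability of \<open>cf\<close>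
  gives the domination.\<close>

lemma mollified_EXP_tendsto:
  fixes f :: "real^'k::finite \<Rightarrow> real"
  assumes f: "continuous_on UNIV f" "\<And>x. 0 \<le> f x" "\<And>x. f x \<le> M" and jj: "\<And>i. jj i < n"
    and int: "integrable lborel (cf f jj)"
  shows "(\<lambda>N. \<integral>v. real (Suc N) ^ CARD('m) * exp (- (norm (real (Suc N) *\<^sub>R stat v))\<^sup>2 / 2) * f (\<chi> i. v (jj i)) \<partial>EXP)
     \<longlonglongrightarrow> gauss (0::real^'m) * Re (\<integral>t. cf f jj t \<partial>lborel)"
proof -
  have fm: "f \<in> borel_measurable borel" using f(1) by (rule borel_measurable_continuous_onI)
  note [measurable] = measurable_EXP_sel[OF fm jj]
  have M: "0 \<le> M" using f(2,3) order_trans by blast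
  interpret EXP: prob_space EXP by (rule prob_space_EXP)
  interpret pair_sigma_finite EXP "lborel :: (real^'m) measure" by standard
  let ?F = "\<lambda>v. complex_of_real (f (\<chi> i. v (jj i)))"
  have step: "complex_of_real (\<integral>v. real (Suc N) ^ CARD('m) * exp (- (norm (real (Suc N) *\<^sub>R stat v))\<^sup>2 / 2) * f (\<chi> i. v (jj i)) \<partial>EXP)
     = (\<integral>t. gauss (t /\<^sub>R real (Suc N)) *\<^sub>R cf f jj t \<partial>lborel)" for N
  proof -
    define r where "r = real (Suc N)"
    have r: "0 < r" by (simp add: r_def)
    have inner: "(\<integral>t. gauss (t /\<^sub>R r) *\<^sub>R iexp (t \<bullet> x) \<partial>lborel) = complex_of_real (r ^ CARD('m) * exp (- (norm (r *\<^sub>R x))\<^sup>2 / 2))" for x :: "real^'m"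
    proof -
      have [measurable]: "(\<lambda>t::real^'m. gauss (t /\<^sub>R r)) \<in> borel_measurable borel"
        by (rule measurable_compose[OF _ measurable_gauss]) simp
      have "(\<integral>t. gauss (t /\<^sub>R r) *\<^sub>R iexp (t \<bullet> x) \<partial>lborel)
          = (\<integral>t. r ^ DIM(real^'m) *\<^sub>R (gauss ((r *\<^sub>R t) /\<^sub>R r) *\<^sub>R iexp ((r *\<^sub>R t) \<bullet> x)) \<partial>lborel)"
        by (rule integral_lborel_scale[OF r]) measurable
      also have "\<dots> = (\<integral>t. r ^ CARD('m) *\<^sub>R (gauss t *\<^sub>R iexp (t \<bullet> (r *\<^sub>R x))) \<partial>lborel)"
        using r by (intro Bochner_Integration.integral_cong) auto
      also have "\<dots> = r ^ CARD('m) *\<^sub>R (\<integral>t. gauss t *\<^sub>R iexp (t \<bullet> (r *\<^sub>R x)) \<partial>lborel)"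
        by (rule integral_scaleR_right)
      also have "\<dots> = complex_of_real (r ^ CARD('m) * exp (- (norm (r *\<^sub>R x))\<^sup>2 / 2))"
        by (subst gauss_fourier) (simp add: scaleR_conv_of_real)
      finally show ?thesis .
    qed
    have gr: "integrable lborel (\<lambda>t::real^'m. gauss (t /\<^sub>R r))"
    proof -
      have "integrable (density (distr lborel borel (\<lambda>x::real^'m. r *\<^sub>R x)) (\<lambda>_. ennreal (r ^ DIM(real^'m)))) (\<lambda>t. gauss (t /\<^sub>R r))"
        using integrable_gauss[where ?'m='m] r
        by (subst integrable_density) (auto simp: integrable_distr_eq)
      then show ?thesis by (subst lborel_scale[OF r])
    qed
    have meas2: "(\<lambda>(v, t). gauss (t /\<^sub>R r) *\<^sub>R (iexp (t \<bullet> stat v) * ?F v)) \<in> borel_measurable (EXP \<Otimes>\<^sub>M (lborel :: (real^'m) measure))"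
    proof -
      have f1 [measurable]: "(\<lambda>p. gauss (snd p /\<^sub>R r)) \<in> borel_measurable (EXP \<Otimes>\<^sub>M (lborel :: (real^'m) measure))"
        by (rule measurable_compose[OF _ measurable_gauss]) measurable
      have f2 [measurable]: "(\<lambda>p. stat (fst p)) \<in> borel_measurable (EXP \<Otimes>\<^sub>M (lborel :: (real^'m) measure))"
        by (rule measurable_compose[OF _ measurable_EXP_stat]) measurable
      have f3 [measurable]: "(\<lambda>p. f (\<chi> i. fst p (jj i))) \<in> borel_measurable (EXP \<Otimes>\<^sub>M (lborel :: (real^'m) measure))"
        by (rule measurable_compose[OF _ measurable_EXP_sel[OF fm jj]]) measurable
      show ?thesis unfolding case_prod_unfold by measurable
    qed
    have prodint: "integrable (EXP \<Otimes>\<^sub>M lborel) (\<lambda>(v, t). gauss (t /\<^sub>R r) *\<^sub>R (iexp (t \<bullet> stat v) * ?F v))"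
    proof (rule Fubini_integrable)
      have nrm: "norm (gauss (t /\<^sub>R r) *\<^sub>R (iexp (t \<bullet> stat v) * ?F v)) = gauss (t /\<^sub>R r) * f (\<chi> i. v (jj i))" for t :: "real^'m" and v
        using f(2) gauss_pos[of "t /\<^sub>R r"] by (simp add: norm_mult less_imp_le)
      have "integrable EXP (\<lambda>v. (\<integral>t. gauss (t /\<^sub>R r) \<partial>(lborel :: (real^'m) measure)) * f (\<chi> i. v (jj i)))"
        using f(2,3) by (intro integrable_mult_right EXP.integrable_const_bound[of _ M]) auto
      then show "integrable EXP (\<lambda>v. \<integral>t. norm (case (v, t) of (v, t) \<Rightarrow> gauss (t /\<^sub>R r) *\<^sub>R (iexp (t \<bullet> stat v) * ?F v)) \<partial>(lborel :: (real^'m) measure))"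
        unfolding prod.case nrm by simp
      show "AE v in EXP. integrable lborel (\<lambda>t. case (v, t) of (v, t) \<Rightarrow> gauss (t /\<^sub>R r) *\<^sub>R (iexp (t \<bullet> stat v) * ?F v))"
      proof (rule AE_I2)
        fix v
        have "integrable lborel (\<lambda>t::real^'m. gauss (t /\<^sub>R r) *\<^sub>R (iexp (t \<bullet> stat v) * ?F v))"
        proof (rule Bochner_Integration.integrable_bound[OF integrable_mult_left[OF gr, of "f (\<chi> i. v (jj i))"]])
          show "AE t in lborel. norm (gauss (t /\<^sub>R r) *\<^sub>R (iexp (t \<bullet> stat v) * ?F v)) \<le> norm (gauss (t /\<^sub>R r) * f (\<chi> i. v (jj i)))"
            unfolding nrm by (intro AE_I2) simp
        qed (use gr in auto)
        then show "integrable lborel (\<lambda>t. case (v, t) of (v, t) \<Rightarrow> gauss (t /\<^sub>R r) *\<^sub>R (iexp (t \<bullet> stat v) * ?F v))" by simp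
      qed
    qed (rule meas2)
    have "complex_of_real (\<integral>v. r ^ CARD('m) * exp (- (norm (r *\<^sub>R stat v))\<^sup>2 / 2) * f (\<chi> i. v (jj i)) \<partial>EXP)
       = (\<integral>v. complex_of_real (r ^ CARD('m) * exp (- (norm (r *\<^sub>R stat v))\<^sup>2 / 2)) * ?F v \<partial>EXP)"
      unfolding of_real_mult[symmetric] by (rule integral_complex_of_real[symmetric])
    also have "\<dots> = (\<integral>v. (\<integral>t. gauss (t /\<^sub>R r) *\<^sub>R (iexp (t \<bullet> stat v) * ?F v) \<partial>lborel) \<partial>EXP)"
    proof (rule Bochner_Integration.integral_cong[OF refl])
      fix v
      have "(\<integral>t. gauss (t /\<^sub>R r) *\<^sub>R (iexp (t \<bullet> stat v) * ?F v) \<partial>lborel)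
         = (\<integral>t. (gauss (t /\<^sub>R r) *\<^sub>R iexp (t \<bullet> stat v)) * ?F v \<partial>lborel)" by simp
      also have "\<dots> = (\<integral>t. gauss (t /\<^sub>R r) *\<^sub>R iexp (t \<bullet> stat v) \<partial>lborel) * ?F v"
        by (rule integral_mult_left_zero)
      finally show "complex_of_real (r ^ CARD('m) * exp (- (norm (r *\<^sub>R stat v))\<^sup>2 / 2)) * ?F v
         = (\<integral>t. gauss (t /\<^sub>R r) *\<^sub>R (iexp (t \<bullet> stat v) * ?F v) \<partial>lborel)" by (simp only: inner)
    qed
    also have "\<dots> = (\<integral>t. (\<integral>v. gauss (t /\<^sub>R r) *\<^sub>R (iexp (t \<bullet> stat v) * ?F v) \<partial>EXP) \<partial>lborel)"
      by (rule Fubini_integral[OF prodint, symmetric])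
    also have "\<dots> = (\<integral>t. gauss (t /\<^sub>R r) *\<^sub>R cf f jj t \<partial>lborel)"
      by (simp add: cf_def)
    finally show ?thesis by (simp add: r_def)
  qed
  have "(\<lambda>N. \<integral>t. gauss (t /\<^sub>R real (Suc N)) *\<^sub>R cf f jj t \<partial>(lborel :: (real^'m) measure)) \<longlonglongrightarrow> (\<integral>t. gauss (0::real^'m) *\<^sub>R cf f jj t \<partial>lborel)"
  proof (rule integral_dominated_convergence)
    show "integrable lborel (\<lambda>t. gauss (0::real^'m) * norm (cf f jj t))"
      using int by (intro integrable_mult_right integrable_norm)
    show "AE t in lborel. (\<lambda>N. gauss (t /\<^sub>R real (Suc N)) *\<^sub>R cf f jj t) \<longlonglongrightarrow> gauss (0::real^'m) *\<^sub>R cf f jj t"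
    proof (rule AE_I2)
      fix t :: "real^'m"
      have "(\<lambda>N. inverse (real (Suc N))) \<longlonglongrightarrow> 0" by (rule LIMSEQ_inverse_real_of_nat)
      then have T: "(\<lambda>N. t /\<^sub>R real (Suc N)) \<longlonglongrightarrow> 0 *\<^sub>R t" by (rule tendsto_scaleR[OF _ tendsto_const])
      have "(\<lambda>N. gauss (0::real^'m) * exp (- (norm (t /\<^sub>R real (Suc N)))\<^sup>2 / 2)) \<longlonglongrightarrow> gauss (0::real^'m) * exp (- (norm (0 *\<^sub>R t))\<^sup>2 / 2)"
        by (intro tendsto_mult tendsto_const tendsto_exp tendsto_divide tendsto_minus tendsto_power tendsto_norm T) simp
      then have "(\<lambda>N. gauss (t /\<^sub>R real (Suc N))) \<longlonglongrightarrow> gauss (0::real^'m)"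
        by (subst gauss_eq) simp
      then show "(\<lambda>N. gauss (t /\<^sub>R real (Suc N)) *\<^sub>R cf f jj t) \<longlonglongrightarrow> gauss (0::real^'m) *\<^sub>R cf f jj t"
        by (intro tendsto_intros)
    qed
    show "AE t in lborel. norm (gauss (t /\<^sub>R real (Suc N)) *\<^sub>R cf f jj t) \<le> gauss (0::real^'m) * norm (cf f jj t)" for N
      by (intro AE_I2) (auto intro!: mult_right_mono simp: abs_of_pos[OF gauss_pos] gauss_le)
    show "(\<lambda>t. gauss (t /\<^sub>R real (Suc N)) *\<^sub>R cf f jj t) \<in> borel_measurable (lborel :: (real^'m) measure)" for N
    proof -
      have "(\<lambda>t::real^'m. gauss (t /\<^sub>R real (Suc N))) \<in> borel_measurable borel"
        by (rule measurable_compose[OF _ measurable_gauss]) simp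
      then show ?thesis using int by (intro borel_measurable_scaleR) auto
    qed
  qed (use int in auto)
  then have "(\<lambda>N. Re (complex_of_real (\<integral>v. real (Suc N) ^ CARD('m) * exp (- (norm (real (Suc N) *\<^sub>R stat v))\<^sup>2 / 2) * f (\<chi> i. v (jj i)) \<partial>EXP)))
     \<longlonglongrightarrow> Re (\<integral>t. gauss (0::real^'m) *\<^sub>R cf f jj t \<partial>lborel)"
    unfolding step by (rule tendsto_Re)
  then show ?thesis by simp
qed

text \<open>Since (x - 1)^2 >= 0, -x^2/2 is at most 1/2 - x, which leaves a power against
  exp(-x).\<close>

lemma power_exp_tendsto_0: "(\<lambda>N. real (Suc N) ^ k * exp (- (real (Suc N))\<^sup>2 / 2)) \<longlonglongrightarrow> 0"
proof (rule tendsto_sandwich[where f="\<lambda>_. 0"])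
  have "((\<lambda>x::real. exp (1/2) * (x ^ k / exp x)) \<longlongrightarrow> exp (1/2) * 0) at_top"
    by (intro tendsto_intros tendsto_power_div_exp_0)
  from filterlim_compose[OF this filterlim_compose[OF filterlim_real_sequentially filterlim_Suc]]
  show "(\<lambda>N. exp (1/2) * (real (Suc N) ^ k / exp (real (Suc N)))) \<longlonglongrightarrow> 0"
    by simp
  show "\<forall>\<^sub>F N in sequentially. real (Suc N) ^ k * exp (- (real (Suc N))\<^sup>2 / 2) \<le> exp (1/2) * (real (Suc N) ^ k / exp (real (Suc N)))"
  proof (rule always_eventually, rule allI)
    fix N
    have "- (real (Suc N))\<^sup>2 / 2 \<le> 1 / 2 - real (Suc N)"
      using zero_le_power2[of "real (Suc N) - 1"] by (simp add: power2_eq_square field_simps)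
    then have "exp (- (real (Suc N))\<^sup>2 / 2) \<le> exp (1 / 2 - real (Suc N))" by simp
    also have "\<dots> = exp (1/2) / exp (real (Suc N))" by (rule exp_diff)
    finally have "real (Suc N) ^ k * exp (- (real (Suc N))\<^sup>2 / 2) \<le> real (Suc N) ^ k * (exp (1/2) / exp (real (Suc N)))"
      by (intro mult_left_mono) auto
    then show "real (Suc N) ^ k * exp (- (real (Suc N))\<^sup>2 / 2) \<le> exp (1/2) * (real (Suc N) ^ k / exp (real (Suc N)))"
      by (simp add: mult.commute)
  qed
qed (auto intro!: always_eventually)

text \<open>Two limits of the mollified quantity are compared: through slices, with the cutoff |s|
  <= 1, and through the Fourier integral, without it. The cutoff costs nothing in the limit, as
  outside the unit ball the kernel is at most N^m exp(-N^2/2).\<close>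

lemma slice_zero:
  obtains \<kappa> :: ennreal where "\<kappa> \<noteq> 0" "\<kappa> < \<infinity>"
    "\<And>f M jj. continuous_on UNIV (f :: real^'k::finite \<Rightarrow> real) \<Longrightarrow> (\<And>x. 0 \<le> f x) \<Longrightarrow> (\<And>x. f x \<le> M) \<Longrightarrow> (\<And>i. jj i < n) \<Longrightarrow>
       integrable lborel (cf f jj) \<Longrightarrow> slice f jj 0 = \<kappa> * ennreal (Re (\<integral>t. cf f jj t \<partial>lborel))"
proof -
  obtain c where c: "c \<noteq> 0" "c < \<infinity>"
    "\<And>h f jj. h \<in> borel_measurable borel \<Longrightarrow> continuous_on UNIV f \<Longrightarrow> (\<And>x. 0 \<le> f x) \<Longrightarrow> (\<And>i. jj i < n) \<Longrightarrow>
       (\<integral>\<^sup>+s. h s * slice (f :: real^'k::finite \<Rightarrow> real) jj s \<partial>lborel) = c * (\<integral>\<^sup>+v. h (stat v) * ennreal (f (\<chi> i. v (jj i))) \<partial>EXP)"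
    by (rule slice_EXP) blast
  let ?g0 = "gauss (0::real^'m)"
  have g0: "0 < ?g0" by (rule gauss_pos)
  \<comment> \<open>One factor \<open>gauss 0\<close> converts the Gaussian density into the plain
    exponential kernel, the other is the constant in the limit of the Fourier side; neither depends
    on the test function.\<close>
  show ?thesis
  proof (rule that[of "c * ennreal (?g0 * ?g0)"])
    show "c * ennreal (?g0 * ?g0) \<noteq> 0" using c(1) g0 by simp
    show "c * ennreal (?g0 * ?g0) < \<infinity>" using c(2) by (simp add: ennreal_mult_less_top)
  next
    fix f :: "real^'k \<Rightarrow> real" and M jj
    assume f: "continuous_on UNIV f" "\<And>x. 0 \<le> f x" "\<And>x. f x \<le> M" and jj: "\<And>i. jj i < n"
      and int: "integrable lborel (cf f jj)"
    have fm: "f \<in> borel_measurable borel" using f(1) by (rule borel_measurable_continuous_onI)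
    note [measurable] = measurable_EXP_sel[OF fm jj]
    have M: "0 \<le> M" using f(2,3) order_trans by blast
    interpret EXP: prob_space EXP by (rule prob_space_EXP)
    define E where "E N v = real (Suc N) ^ CARD('m) * exp (- (norm (real (Suc N) *\<^sub>R stat v))\<^sup>2 / 2)" for N v
    have E0: "0 \<le> E N v" for N v by (simp add: E_def)
    have [measurable]: "E N \<in> borel_measurable EXP" for N unfolding E_def[abs_def] by measurable
    let ?I = "\<lambda>v. indicator (cball 0 1) (stat v) :: real"
    let ?F = "\<lambda>v. f (\<chi> i. v (jj i))"
    have [measurable]: "?I \<in> borel_measurable EXP"
      by (rule measurable_compose[OF measurable_EXP_stat]) (auto intro: borel_measurable_indicator borel_closed)
    have intE: "integrable EXP (\<lambda>v. E N v * ?F v)" for N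
    proof (rule EXP.integrable_const_bound[of _ "real (Suc N) ^ CARD('m) * M"])
      have "E N v \<le> real (Suc N) ^ CARD('m) * 1" for v unfolding E_def by (intro mult_left_mono) auto
      then show "AE v in EXP. norm (E N v * ?F v) \<le> real (Suc N) ^ CARD('m) * M"
        using f(2,3) E0 by (intro AE_I2) (auto simp: abs_mult intro!: mult_mono)
    qed measurable
    have intEI: "integrable EXP (\<lambda>v. E N v * ?F v * ?I v)" for N
      by (rule Bochner_Integration.integrable_bound[OF intE[of N]]) (auto simp: indicator_def)
    define T where "T N = (\<integral>v. E N v * ?F v * ?I v \<partial>EXP)" for N
    have lim1: "(\<lambda>N. \<integral>v. E N v * ?F v \<partial>EXP) \<longlonglongrightarrow> ?g0 * Re (\<integral>t. cf f jj t \<partial>lborel)"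
      unfolding E_def by (rule mollified_EXP_tendsto[OF f jj int])
    have lim2: "(\<lambda>N. (\<integral>v. E N v * ?F v \<partial>EXP) - T N) \<longlonglongrightarrow> 0"
    proof (rule tendsto_sandwich[where f="\<lambda>_. 0"])
      show "(\<lambda>N. M * (real (Suc N) ^ CARD('m) * exp (- (real (Suc N))\<^sup>2 / 2))) \<longlonglongrightarrow> 0"
        using tendsto_mult_right_zero[OF power_exp_tendsto_0] .
      have diff: "(\<integral>v. E N v * ?F v \<partial>EXP) - T N = (\<integral>v. E N v * ?F v - E N v * ?F v * ?I v \<partial>EXP)" for N
        unfolding T_def by (rule Bochner_Integration.integral_diff[symmetric]) (rule intE, rule intEI)
      have pt: "E N v * ?F v - E N v * ?F v * ?I v \<le> M * (real (Suc N) ^ CARD('m) * exp (- (real (Suc N))\<^sup>2 / 2))"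
        "0 \<le> E N v * ?F v - E N v * ?F v * ?I v" for N v
      proof -
        show "0 \<le> E N v * ?F v - E N v * ?F v * ?I v" using E0 f(2) by (auto simp: indicator_def)
        show "E N v * ?F v - E N v * ?F v * ?I v \<le> M * (real (Suc N) ^ CARD('m) * exp (- (real (Suc N))\<^sup>2 / 2))"
        proof (cases "norm (stat v) \<le> 1")
          case False
          then have "real (Suc N) * 1 \<le> norm (real (Suc N) *\<^sub>R stat v)"
            unfolding norm_scaleR by (intro mult_mono) auto
          then have "(real (Suc N))\<^sup>2 \<le> (norm (real (Suc N) *\<^sub>R stat v))\<^sup>2" by (intro power_mono) auto
          then have "E N v \<le> real (Suc N) ^ CARD('m) * exp (- (real (Suc N))\<^sup>2 / 2)"
            unfolding E_def by (intro mult_left_mono) auto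
          then have "E N v * ?F v \<le> (real (Suc N) ^ CARD('m) * exp (- (real (Suc N))\<^sup>2 / 2)) * M"
            using f(2,3) by (intro mult_mono) auto
          then show ?thesis using False by (simp add: indicator_def mult_ac)
        qed (use M in \<open>simp add: indicator_def\<close>)
      qed
      show "\<forall>\<^sub>F N in sequentially. 0 \<le> (\<integral>v. E N v * ?F v \<partial>EXP) - T N"
        unfolding diff by (intro always_eventually allI Bochner_Integration.integral_nonneg pt)
      show "\<forall>\<^sub>F N in sequentially. (\<integral>v. E N v * ?F v \<partial>EXP) - T N \<le> M * (real (Suc N) ^ CARD('m) * exp (- (real (Suc N))\<^sup>2 / 2))"
        unfolding diff by (intro always_eventually allI EXP.integral_le_const AE_I2 pt) (auto intro: intE intEI)
    qed simp
    have "(\<lambda>N. (\<integral>v. E N v * ?F v \<partial>EXP) - ((\<integral>v. E N v * ?F v \<partial>EXP) - T N)) \<longlonglongrightarrow> ?g0 * Re (\<integral>t. cf f jj t \<partial>lborel) - 0"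
      by (rule tendsto_diff[OF lim1 lim2])
    then have limT: "(\<lambda>N. c * ennreal (?g0 * T N)) \<longlonglongrightarrow> c * ennreal (?g0 * (?g0 * Re (\<integral>t. cf f jj t \<partial>lborel)))"
      using c(2) by (intro ennreal_tendsto_cmult tendsto_ennrealI tendsto_mult tendsto_const) auto
    have "c * ennreal (?g0 * T N) =
       (\<integral>\<^sup>+s. ennreal (real (Suc N) ^ CARD('m) * gauss (real (Suc N) *\<^sub>R s) * indicator (cball 0 1) s) * slice f jj s \<partial>lborel)" for N
    proof -
      let ?h = "\<lambda>s::real^'m. ennreal (real (Suc N) ^ CARD('m) * gauss (real (Suc N) *\<^sub>R s) * indicator (cball 0 1) s)"
      have "(\<lambda>s::real^'m. gauss (real (Suc N) *\<^sub>R s)) \<in> borel_measurable borel"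
        by (rule measurable_compose[OF _ measurable_gauss]) simp
      moreover have "(indicator (cball 0 1) :: real^'m \<Rightarrow> real) \<in> borel_measurable borel"
        by (intro borel_measurable_indicator borel_closed closed_cball)
      ultimately have h: "?h \<in> borel_measurable borel"
        by (intro measurable_compose[OF _ measurable_ennreal] borel_measurable_times) simp_all
      have "(\<integral>\<^sup>+s. ?h s * slice f jj s \<partial>lborel) = c * (\<integral>\<^sup>+v. ?h (stat v) * ennreal (?F v) \<partial>EXP)"
        by (rule c(3)[OF h f(1,2) jj])
      also have "(\<integral>\<^sup>+v. ?h (stat v) * ennreal (?F v) \<partial>EXP) = (\<integral>\<^sup>+v. ennreal (?g0 * (E N v * ?F v * ?I v)) \<partial>EXP)"
      proof (rule nn_integral_cong)
        fix v
        have "real (Suc N) ^ CARD('m) * gauss (real (Suc N) *\<^sub>R stat v) = ?g0 * E N v"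
          by (subst gauss_eq) (simp add: E_def)
        then have "?h (stat v) * ennreal (?F v) = ennreal (?g0 * E N v * ?I v) * ennreal (?F v)" by (simp only:)
        also have "\<dots> = ennreal (?g0 * (E N v * ?F v * ?I v))"
          using g0 E0 f(2) by (subst ennreal_mult[symmetric]) (auto simp: mult_ac)
        finally show "?h (stat v) * ennreal (?F v) = ennreal (?g0 * (E N v * ?F v * ?I v))" .
      qed
      also have "\<dots> = ennreal (\<integral>v. ?g0 * (E N v * ?F v * ?I v) \<partial>EXP)"
        using g0 E0 f(2) by (intro nn_integral_eq_integral integrable_mult_right intEI) auto
      also have "(\<integral>v. ?g0 * (E N v * ?F v * ?I v) \<partial>EXP) = ?g0 * T N" by (simp add: T_def)
      finally show ?thesis by simp
    qed
    then have "(\<lambda>N. c * ennreal (?g0 * T N)) \<longlonglongrightarrow> slice f jj 0"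
      using mollified_slice_tendsto[OF f jj] by simp
    from LIMSEQ_unique[OF this limT]
    show "slice f jj 0 = c * ennreal (?g0 * ?g0) * ennreal (Re (\<integral>t. cf f jj t \<partial>lborel))"
      using g0 by (simp add: ennreal_mult' mult.assoc)
  qed
qed

end

context affine_slice begin

text \<open>Independence: the phase t . S is a sum over coordinates and \<open>f\<close> sees only
  the selected ones, so the product measure is split into the unselected block, which factors
  completely, and the selected block.\<close>

lemma cf_factor:
  fixes f :: "real^'k::finite \<Rightarrow> real"
  assumes fm: "f \<in> borel_measurable borel" and f0: "\<And>x. 0 \<le> f x" and fM: "\<And>x. f x \<le> M"
    and inj: "inj jj" and jj: "\<And>i. jj i < n"
  shows "cf f jj t = (\<Prod>j\<in>{..<n} - range jj. ecf (a j \<bullet> t)) * sel_cf (\<lambda>i. a (jj i)) f t"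
proof -
  let ?I = "{..<n} - range jj" and ?J = "range jj"
  interpret product_sigma_finite "\<lambda>_::nat. expo"
    using prob_space_expo prob_space_imp_sigma_finite by (auto simp: product_sigma_finite_def)
  interpret EXP: prob_space EXP by (rule prob_space_EXP)
  have IJ: "?I \<union> ?J = {..<n}" "?I \<inter> ?J = {}" using jj by auto
  define g where "g v = iexp (t \<bullet> stat v) * complex_of_real (f (\<chi> i. v (jj i)))" for v
  have gm: "g \<in> borel_measurable EXP"
  proof -
    note [measurable] = measurable_EXP_sel[OF fm jj]
    show ?thesis unfolding g_def[abs_def] by measurable
  qed
  have ig: "integrable EXP g"
    using f0 fM by (intro EXP.integrable_const_bound[of _ M] gm) (auto simp: g_def norm_mult)
  have st: "iexp (t \<bullet> stat v) = (\<Prod>j<n. iexp ((a j \<bullet> t) * (v j - 1)))" for v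
    by (simp add: stat_def inner_sum_right exp_sum[symmetric] sum_distrib_left inner_commute mult.commute)
  define B where "B y = iexp (\<Sum>i\<in>UNIV. (a (jj i) \<bullet> t) * (y (jj i) - 1)) * complex_of_real (f (\<chi> i. y (jj i)))" for y
  have gmerge: "g (merge ?I ?J (x, y)) = (\<Prod>j\<in>?I. iexp ((a j \<bullet> t) * (x j - 1))) * B y" for x y
  proof -
    have m1: "merge ?I ?J (x, y) j = x j" if "j \<in> ?I" for j using that by (simp add: merge_def)
    have m2: "merge ?I ?J (x, y) (jj i) = y (jj i)" for i by (simp add: merge_def)
    have "(\<Prod>j<n. iexp ((a j \<bullet> t) * (merge ?I ?J (x, y) j - 1)))
      = (\<Prod>j\<in>?I. iexp ((a j \<bullet> t) * (merge ?I ?J (x, y) j - 1))) * (\<Prod>j\<in>?J. iexp ((a j \<bullet> t) * (merge ?I ?J (x, y) j - 1)))"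
      using jj by (intro prod.subset_diff) auto
    also have "(\<Prod>j\<in>?J. iexp ((a j \<bullet> t) * (merge ?I ?J (x, y) j - 1))) = iexp (\<Sum>i\<in>UNIV. (a (jj i) \<bullet> t) * (y (jj i) - 1))"
      by (simp only: prod.reindex[OF inj] o_def m2) (simp add: exp_sum sum_distrib_left)
    also have "(\<Prod>j\<in>?I. iexp ((a j \<bullet> t) * (merge ?I ?J (x, y) j - 1))) = (\<Prod>j\<in>?I. iexp ((a j \<bullet> t) * (x j - 1)))"
      by (intro prod.cong refl) (simp only: m1)
    finally show ?thesis unfolding g_def st B_def m2 by (simp only: mult.assoc)
  qed
  have int1: "integrable expo (\<lambda>x. iexp (\<theta> * (x - 1)))" for \<theta>
  proof -
    interpret prob_space expo by (rule prob_space_expo)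
    show ?thesis by (intro integrable_const_bound[of _ 1]) auto
  qed
  have "cf f jj t = (\<integral>v. g v \<partial>PiM (?I \<union> ?J) (\<lambda>_. expo))" unfolding cf_def g_def IJ ..
  also have "\<dots> = (\<integral>x. (\<integral>y. g (merge ?I ?J (x, y)) \<partial>PiM ?J (\<lambda>_. expo)) \<partial>PiM ?I (\<lambda>_. expo))"
    using ig IJ by (intro product_integral_fold) auto
  also have "\<dots> = (\<integral>x. (\<Prod>j\<in>?I. iexp ((a j \<bullet> t) * (x j - 1))) * (\<integral>y. B y \<partial>PiM ?J (\<lambda>_. expo)) \<partial>PiM ?I (\<lambda>_. expo))"
    by (simp only: gmerge integral_mult_right_zero)
  also have "\<dots> = (\<integral>x. (\<Prod>j\<in>?I. iexp ((a j \<bullet> t) * (x j - 1))) \<partial>PiM ?I (\<lambda>_. expo)) * (\<integral>y. B y \<partial>PiM ?J (\<lambda>_. expo))"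
    by (rule integral_mult_left_zero)
  also have "(\<integral>x. (\<Prod>j\<in>?I. iexp ((a j \<bullet> t) * (x j - 1))) \<partial>PiM ?I (\<lambda>_. expo)) = (\<Prod>j\<in>?I. ecf (a j \<bullet> t))"
    unfolding expo_centred_cf[symmetric] by (rule product_integral_prod) (simp, rule int1)
  also have "(\<integral>y. B y \<partial>PiM ?J (\<lambda>_. expo)) = sel_cf (\<lambda>i. a (jj i)) f t"
  proof -
    let ?K = "PiM ?J (\<lambda>_. expo)" and ?U = "PiM (UNIV :: 'k set) (\<lambda>_. expo)"
    \<comment> \<open>Injectivity of \<open>jj\<close> makes the relabelled selected coordinates
      independent, which identifies their law with the product over the index type.\<close>
    have re: "distr ?K ?U (\<lambda>\<omega>. \<lambda>i\<in>UNIV. \<omega> (jj i)) = ?U"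
      by (rule distr_PiM_reindex[of ?J "\<lambda>_. expo" jj UNIV]) (use inj prob_space_expo in auto)
    have "sel_cf (\<lambda>i. a (jj i)) f t = (\<integral>y. iexp (\<Sum>i\<in>UNIV. (a (jj i) \<bullet> t) * (y i - 1)) * complex_of_real (f (\<chi> i. y i)) \<partial>distr ?K ?U (\<lambda>\<omega>. \<lambda>i\<in>UNIV. \<omega> (jj i)))"
      unfolding re sel_cf_def ..
    also have "\<dots> = (\<integral>\<omega>. iexp (\<Sum>i\<in>UNIV. (a (jj i) \<bullet> t) * ((\<lambda>i\<in>UNIV. \<omega> (jj i)) i - 1)) * complex_of_real (f (\<chi> i. (\<lambda>i\<in>UNIV. \<omega> (jj i)) i)) \<partial>?K)"
    proof (rule integral_distr)
      show "(\<lambda>\<omega>. \<lambda>i\<in>UNIV. \<omega> (jj i)) \<in> measurable ?K ?U"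
        by (intro measurable_restrict measurable_component_singleton) auto
      show "(\<lambda>y. iexp (\<Sum>i\<in>UNIV. (a (jj i) \<bullet> t) * (y i - 1)) * complex_of_real (f (\<chi> i. y i))) \<in> borel_measurable ?U"
        by (rule measurable_sel_integrand1[OF fm])
    qed
    finally show ?thesis by (simp add: B_def)
  qed
  finally show ?thesis .
qed

end

section \<open>The uniform distribution on the polytope\<close>

definition A_hat_col :: "nat \<Rightarrow> ('m::finite \<Rightarrow> nat \<Rightarrow> real) \<Rightarrow> ('m \<Rightarrow> real) \<Rightarrow> nat \<Rightarrow> real^'m" where
  "A_hat_col n A b j = (\<chi> l. A_hat n A b l j)"

lemma sum_scaleR_matrix:
  fixes Q :: "real^'m^'l"
  shows "(\<Sum>j\<in>S. c j *\<^sub>R (Q *v t j)) = Q *v (\<Sum>j\<in>S. c j *\<^sub>R t j)"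
  by (induction S rule: infinite_finite_induct)
     (simp_all add: matrix_vector_right_distrib matrix_vector_mult_scaleR)

lemma ker_set_measurable: "ker_set n A \<in> sets seqM"
proof -
  have "{y \<in> space seqM. (\<forall>j\<ge>n. y j = 0) \<and> (\<forall>l. (\<Sum>j<n. A l j * y j) = 0)} \<in> sets seqM"
    by measurable
  then show ?thesis by (simp add: ker_set_def)
qed

lemma emeasure_hausdorff_ker:
  "E \<in> sets seqM \<Longrightarrow> emeasure (hausdorff_on n s (ker_set n A)) E = hausdorff_n n s (E \<inter> ker_set n A)"
  by (rule emeasure_hausdorff_on) (auto simp: ker_set_def)

lemma ker_set_add: "y \<in> ker_set n A \<Longrightarrow> z \<in> ker_set n A \<Longrightarrow> (\<lambda>i. z i + y i) \<in> ker_set n A"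
  by (simp add: ker_set_def distrib_left sum.distrib)

lemma ker_set_diff: "y \<in> ker_set n A \<Longrightarrow> z \<in> ker_set n A \<Longrightarrow> (\<lambda>i. y i - z i) \<in> ker_set n A"
  by (simp add: ker_set_def right_diff_distrib sum_subtractf)

context
  fixes n :: nat and A :: "'m::finite \<Rightarrow> nat \<Rightarrow> real" and b :: "'m \<Rightarrow> real"
  assumes n: "CARD('m) < n" and rank: "full_rank n A" and K: "compact (K_set n A b)"
    and int: "\<exists>x\<in>K_set n A b. \<forall>i<n. 0 < x i"
begin

lemmas weights = w_vec[OF rank K int]

abbreviation (input) "W \<equiv> w_vec n A b"
abbreviation (input) "At \<equiv> A_tilde n A b"
abbreviation (input) "R \<equiv> matrix_inv (mat_sqrt (gram n At))"
abbreviation (input) "Hm \<equiv> hausdorff_on n (real n - real CARD('m)) (ker_set n A)"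

lemma full_rank_At: "full_rank n At"
  unfolding full_rank_def
proof (intro allI impI)
  fix c l assume c: "\<forall>i<n. (\<Sum>l\<in>UNIV. c l * At l i) = 0"
  have "\<forall>i<n. (\<Sum>l\<in>UNIV. c l * A l i) = 0"
  proof safe
    fix i assume i: "i < n"
    have "(\<Sum>l\<in>UNIV. c l * A l i) = W i * (\<Sum>l\<in>UNIV. c l * At l i)"
      using weights(1)[OF i] by (simp add: A_tilde_def sum_distrib_left)
    then show "(\<Sum>l\<in>UNIV. c l * A l i) = 0" using c i by simp
  qed
  then show "c l = 0" using rank unfolding full_rank_def by (metis (no_types))
qed

lemma mat_sqrt_gram: "pos_def_mat (mat_sqrt (gram n At))" "mat_sqrt (gram n At) ** mat_sqrt (gram n At) = gram n At"
  "invertible (mat_sqrt (gram n At))"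
  using mat_sqrt[OF pos_def_gram[OF full_rank_At]] pos_def_mat_invertible by auto

lemma A_hat_col_eq: "A_hat_col n A b j = R *v (\<chi> l. At l j)"
  by (simp add: A_hat_col_def A_hat_def Let_def gram_def matrix_vector_mult_def vec_eq_iff)

text \<open>\<open>R\<close> is the inverse square root of the Gram matrix G; being the inverse of a
  symmetric matrix it is symmetric, so R G R = 1.\<close>

lemma R_gram: "R *v (gram n At *v (transpose R *v s)) = s"
proof -
  let ?S = "mat_sqrt (gram n At)"
  have S: "transpose ?S = ?S" using mat_sqrt_gram(1) by (simp add: pos_def_mat_def)
  have "transpose R = transpose R ** (?S ** R)" by (simp add: matrix_inv_right[OF mat_sqrt_gram(3)])
  also have "\<dots> = transpose (?S ** R) ** R" by (simp add: matrix_transpose_mul S matrix_mul_assoc)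
  also have "\<dots> = R" by (simp add: matrix_inv_right[OF mat_sqrt_gram(3)] transpose_mat)
  finally have RT: "transpose R = R" .
  have "R ** (gram n At ** R) = (R ** ?S) ** (?S ** R)"
    by (subst mat_sqrt_gram(2)[symmetric]) (simp add: matrix_mul_assoc)
  also have "\<dots> = mat 1" by (simp add: matrix_inv_right[OF mat_sqrt_gram(3)] matrix_inv_left[OF mat_sqrt_gram(3)])
  finally show ?thesis unfolding RT by (simp add: matrix_vector_mul_assoc)
qed

text \<open>The columns are R applied to the columns of \<open>A_tilde\<close>, whose outer products
  sum to the Gram matrix G; the sum in question is therefore R G R^t s.\<close>

lemma isotropic: "(\<Sum>j<n. (A_hat_col n A b j \<bullet> s) *\<^sub>R A_hat_col n A b j) = s"
proof -
  let ?t = "\<lambda>j. (\<chi> l. At l j) :: real^'m"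
  have ip: "A_hat_col n A b j \<bullet> s = ?t j \<bullet> (transpose R *v s)" for j
    unfolding A_hat_col_eq by (metis dot_lmul_matrix inner_commute transpose_matrix_vector)
  have gr: "(\<Sum>j<n. (?t j \<bullet> v) *\<^sub>R ?t j) = gram n At *v v" for v
  proof (simp add: vec_eq_iff, intro allI)
    fix p
    have "(gram n At *v v) $ p = axis p 1 \<bullet> (gram n At *v v)" by (simp add: inner_axis')
    also have "\<dots> = (\<Sum>i<n. At p i * (\<Sum>q\<in>UNIV. v $ q * At q i))"
      unfolding inner_gram by (simp add: axis_def if_distrib[of "\<lambda>x. x * _"] cong: if_cong)
    finally show "(\<Sum>j<n. (?t j \<bullet> v) * At p j) = (gram n At *v v) $ p"
      by (simp add: inner_vec_def mult.commute)
  qed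
  have "(\<Sum>j<n. (A_hat_col n A b j \<bullet> s) *\<^sub>R A_hat_col n A b j) = (\<Sum>j<n. (?t j \<bullet> (transpose R *v s)) *\<^sub>R (R *v ?t j))"
    unfolding ip unfolding A_hat_col_eq ..
  also have "\<dots> = s" by (simp only: sum_scaleR_matrix gr R_gram)
  finally show ?thesis .
qed

text \<open>The weights cancel against the denominators of \<open>A_tilde\<close>, so the vector on
  the right is R applied to A y, and R is injective.\<close>

lemma ker_iff: "y \<in> ker_set n A \<longleftrightarrow> (\<forall>j\<ge>n. y j = 0) \<and> (\<Sum>j<n. (W j * y j) *\<^sub>R A_hat_col n A b j) = 0"
proof -
  let ?x = "\<Sum>j<n. (W j * y j) *\<^sub>R ((\<chi> l. At l j) :: real^'m)"
  have "R *v ?x = 0 \<longleftrightarrow> ?x = 0"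
  proof
    assume "R *v ?x = 0"
    then have "mat_sqrt (gram n At) *v (R *v ?x) = 0" by simp
    then show "?x = 0" by (simp only: matrix_vector_mul_assoc matrix_inv_right[OF mat_sqrt_gram(3)] matrix_vector_mul_lid)
  qed simp
  moreover have "?x = 0 \<longleftrightarrow> (\<forall>l. (\<Sum>j<n. A l j * y j) = 0)"
  proof -
    have "(\<Sum>j<n. W j * y j * At l j) = (\<Sum>j<n. A l j * y j)" for l
    proof (rule sum.cong[OF refl])
      fix j assume "j \<in> {..<n}"
      then have "0 < W j" using weights(1) by simp
      then show "W j * y j * At l j = A l j * y j" by (simp add: A_tilde_def)
    qed
    then show ?thesis by (simp add: vec_eq_iff)
  qed
  ultimately show ?thesis unfolding A_hat_col_eq sum_scaleR_matrix by (simp add: ker_set_def)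
qed

lemma affine_slice_ker: "affine_slice n W (A_hat_col n A b) (ker_set n A) Hm"
proof
  show "0 < W j" if "j < n" for j by (rule weights(1)[OF that])
  show "(\<Sum>j<n. (A_hat_col n A b j \<bullet> s) *\<^sub>R A_hat_col n A b j) = s" for s by (rule isotropic)
  show "(y \<in> ker_set n A) = ((\<forall>j\<ge>n. y j = 0) \<and> (\<Sum>j<n. (W j * y j) *\<^sub>R A_hat_col n A b j) = 0)" for y
    by (rule ker_iff)
  show "(\<Sum>j<n. W j * y j) = 0" if "y \<in> ker_set n A" for y
  proof -
    \<comment> \<open>A combination of rows annihilates the kernel.\<close>
    obtain c where c: "\<forall>j<n. W j = (\<Sum>l\<in>UNIV. c l * A l j)" using weights(3) by blast
    have "(\<Sum>j<n. W j * y j) = (\<Sum>j<n. \<Sum>l\<in>UNIV. c l * (A l j * y j))"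
      using c by (intro sum.cong refl) (simp add: sum_distrib_right mult.assoc)
    also have "\<dots> = (\<Sum>l\<in>UNIV. c l * (\<Sum>j<n. A l j * y j))"
      by (subst sum.swap) (simp only: sum_distrib_left)
    finally show ?thesis using that by (simp add: ker_set_def)
  qed
  show "sets Hm = sets seqM" by (rule sets_hausdorff_on)
  show "AE y in Hm. y \<in> ker_set n A"
  proof (rule AE_I)
    show "{y \<in> space Hm. y \<notin> ker_set n A} \<subseteq> - ker_set n A" by auto
    have c: "- ker_set n A \<in> sets seqM" using sets.compl_sets[OF ker_set_measurable[of n A]] by (simp add: Compl_eq_Diff_UNIV)
    then show "- ker_set n A \<in> sets Hm" by (simp add: sets_hausdorff_on)
    show "emeasure Hm (- ker_set n A) = 0" by (simp add: emeasure_hausdorff_ker[OF c])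
  qed
  show "emeasure Hm ((\<lambda>x i. z i + x i) -` E) = emeasure Hm E" if z: "z \<in> ker_set n A" and E: "E \<in> sets seqM" for z E
  proof -
    have E': "(\<lambda>x i. z i + x i) -` E \<in> sets seqM" using measurable_sets[OF measurable_seqM_shift E, of z] by simp
    have "(\<lambda>x i. z i + x i) ` (((\<lambda>x i. z i + x i) -` E) \<inter> ker_set n A) = E \<inter> ker_set n A"
    proof safe
      fix x assume x: "x \<in> E" "x \<in> ker_set n A"
      show "x \<in> (\<lambda>x i. z i + x i) ` (((\<lambda>x i. z i + x i) -` E) \<inter> ker_set n A)"
        using x ker_set_diff[OF x(2) z] by (intro image_eqI[of _ _ "\<lambda>i. x i - z i"]) auto
    qed (use ker_set_add z in auto)
    then show ?thesis
      using hausdorff_n_translate[of n "real n - real CARD('m)" z "((\<lambda>x i. z i + x i) -` E) \<inter> ker_set n A"]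
      by (simp add: emeasure_hausdorff_ker[OF E'] emeasure_hausdorff_ker[OF E])
  qed
  show "emeasure Hm {y. \<forall>j<n. \<bar>y j\<bar> \<le> r} < \<infinity>" if "0 < r" for r
  proof -
    have "{y. \<forall>j<n. \<bar>y j\<bar> \<le> r} \<inter> ker_set n A = {y \<in> ker_set n A. \<forall>j<n. \<bar>y j\<bar> \<le> r}" by auto
    then show ?thesis using hausdorff_n_ker_bounded[OF rank n that] by (simp add: emeasure_hausdorff_ker[OF sets_seqM_box])
  qed
  show "emeasure Hm UNIV \<noteq> 0"
    using hausdorff_n_ker_pos[OF rank n]
    by (simp add: emeasure_hausdorff_ker[OF sets.top[of seqM, unfolded space_seqM]])
qed

interpretation S: affine_slice n W "A_hat_col n A b" "ker_set n A" Hm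
  by (rule affine_slice_ker)

lemma K_measurable: "K_set n A b \<in> sets seqM"
proof -
  have "{x \<in> space seqM. (\<forall>j\<ge>n. x j = 0) \<and> (\<forall>j<n. 0 \<le> x j) \<and> (\<forall>l. (\<Sum>j<n. A l j * x j) = b l)} \<in> sets seqM"
    by measurable
  then show ?thesis by (simp add: K_set_def)
qed

lemma point0: "S.point 0 y j = (if j < n then 1 / W j + y j else 0)"
  by (simp add: S.point_def)

text \<open>The moment equations of \<open>W\<close> say that the reciprocals 1 / W solve A x = b,
  so the central slice is the affine solution space and the polytope is its part in the
  orthant.\<close>

lemma point0_K: "y \<in> ker_set n A \<Longrightarrow> S.point 0 y \<in> K_set n A b \<longleftrightarrow> (\<forall>j<n. 0 \<le> S.point 0 y j)"
proof -
  assume y: "y \<in> ker_set n A"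
  have "(\<Sum>j<n. A l j * S.point 0 y j) = (\<Sum>j<n. A l j / W j) + (\<Sum>j<n. A l j * y j)" for l
    unfolding sum.distrib[symmetric] by (intro sum.cong) (simp_all add: point0 distrib_left)
  then have "(\<Sum>j<n. A l j * S.point 0 y j) = b l" for l using y weights(4) by (simp add: ker_set_def)
  then show ?thesis by (auto simp: K_set_def point0)
qed

lemma K_slice:
  assumes x: "x \<in> K_set n A b"
  obtains y where "y \<in> ker_set n A" "S.point 0 y = x"
proof
  let ?y = "\<lambda>j. if j < n then x j - 1 / W j else 0"
  have "(\<Sum>j<n. A l j * ?y j) = (\<Sum>j<n. A l j * x j) - (\<Sum>j<n. A l j / W j)" for l
    unfolding sum_subtractf[symmetric] by (intro sum.cong) (simp_all add: right_diff_distrib)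
  then show "?y \<in> ker_set n A" using x weights(4) by (simp add: ker_set_def K_set_def)
  show "S.point 0 ?y = x" using x by (auto simp: point0 K_set_def fun_eq_iff)
qed

text \<open>On the kernel \<open>S.point 0\<close> is translation by the analytic centre, which
  preserves Hausdorff measure.\<close>

lemma emeasure_point0:
  assumes E: "E \<in> sets seqM" "E \<subseteq> K_set n A b"
  shows "emeasure (distr Hm seqM (S.point 0)) E = hausdorff_n n (real n - real CARD('m)) E"
proof -
  have m: "S.point 0 \<in> measurable Hm seqM" by measurable
  have E': "S.point 0 -` E \<in> sets seqM" using measurable_sets[OF S.measurable_point2 E(1), of 0] by simp
  let ?x = "\<lambda>j. if j < n then 1 / W j else 0"
  have pt: "S.point 0 y = (\<lambda>i. ?x i + y i)" if "y \<in> ker_set n A" for y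
    using that by (auto simp: point0 fun_eq_iff ker_set_def)
  have "(\<lambda>y i. ?x i + y i) ` (S.point 0 -` E \<inter> ker_set n A) = E"
  proof safe
    fix y assume "S.point 0 y \<in> E" "y \<in> ker_set n A"
    then show "(\<lambda>i. ?x i + y i) \<in> E" by (simp only: pt)
  next
    fix x assume x: "x \<in> E"
    then obtain y where y: "y \<in> ker_set n A" "S.point 0 y = x" using E(2) by (auto intro: K_slice)
    then show "x \<in> (\<lambda>y i. ?x i + y i) ` (S.point 0 -` E \<inter> ker_set n A)"
      using x pt[OF y(1)] by (intro image_eqI[of _ _ y]) auto
  qed
  then have "hausdorff_n n (real n - real CARD('m)) (S.point 0 -` E \<inter> ker_set n A) = hausdorff_n n (real n - real CARD('m)) E"
    using hausdorff_n_translate[of n "real n - real CARD('m)" ?x "S.point 0 -` E \<inter> ker_set n A"] by simp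
  then show ?thesis
    using emeasure_distr[OF m E(1)] by (simp add: emeasure_hausdorff_ker[OF E'])
qed

text \<open>\<open>measure_of\<close> takes the prescribed values only if they form a measure.
  Rewriting them as the restriction of a scaled image of \<open>Hm\<close> supplies this and gives
  access to the integration rules.\<close>

lemma P_unif_eq:
  "P_unif n A b = restrict_space (scale_measure (inverse (hausdorff_n n (real n - real CARD('m)) (K_set n A b))) (distr Hm seqM (S.point 0))) (K_set n A b)"
  (is "_ = ?P")
proof -
  let ?K = "K_set n A b"
  have sp: "space ?P = ?K" by (simp add: space_restrict_space space_scale_measure)
  have st: "sets ?P = sets (restrict_space seqM ?K)" by (intro sets_restrict_space_cong) simp
  have st2: "sets (restrict_space seqM ?K) \<subseteq> Pow ?K" by (auto simp: sets_restrict_space)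
  have "?P = measure_of (space ?P) (sets ?P) (emeasure ?P)" by (rule measure_of_of_measure[symmetric])
  also have "\<dots> = measure_of ?K (sets (restrict_space seqM ?K)) (emeasure ?P)" by (simp only: sp st)
  also have "\<dots> = measure_of ?K (sets (restrict_space seqM ?K))
      (\<lambda>E. hausdorff_n n (real n - real CARD('m)) E / hausdorff_n n (real n - real CARD('m)) ?K)"
  proof (rule measure_of_eq[OF st2])
    fix E assume "E \<in> sigma_sets ?K (sets (restrict_space seqM ?K))"
    then have "E \<in> sets (restrict_space seqM ?K)"
      using sets.sigma_sets_eq[of "restrict_space seqM ?K"] by (simp add: space_restrict_space)
    then have E: "E \<in> sets seqM" "E \<subseteq> ?K"
      using K_measurable by (auto simp: sets_restrict_space_iff)
    have "emeasure ?P E = inverse (hausdorff_n n (real n - real CARD('m)) ?K) * emeasure (distr Hm seqM (S.point 0)) E"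
      using E K_measurable by (subst emeasure_restrict_space) auto
    then show "emeasure ?P E = hausdorff_n n (real n - real CARD('m)) E / hausdorff_n n (real n - real CARD('m)) ?K"
      using emeasure_point0[OF E] by (simp add: divide_ennreal_def mult.commute)
  qed
  finally show ?thesis unfolding P_unif_def by simp
qed

lemma sets_P_unif: "sets (P_unif n A b) = sets (restrict_space seqM (K_set n A b))"
  unfolding P_unif_eq by (intro sets_restrict_space_cong) simp

lemma measurable_P_unif: "f \<in> measurable seqM N \<Longrightarrow> f \<in> measurable (P_unif n A b) N"
  using measurable_restrict_space1[of f seqM N] measurable_cong_sets[OF sets_P_unif refl] by blast

text \<open>On the central slice the w_j x_j add up to n, so the exponential weight is the constant
  exp(-n). It cancels in the quotient, in which the slice of the test function 1 accounts for the
  Hausdorff measure of the polytope.\<close>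

lemma nn_integral_P_unif:
  fixes f :: "real^'k::finite \<Rightarrow> real" and jj :: "'k \<Rightarrow> nat"
  assumes fm: "f \<in> borel_measurable borel" and f0: "\<And>x. 0 \<le> f x"
  shows "(\<integral>\<^sup>+x. ennreal (f (\<chi> i. W (jj i) * x (jj i))) \<partial>P_unif n A b) = S.slice f jj 0 / S.slice (\<lambda>_::real^'k. 1) jj 0"
proof -
  let ?K = "K_set n A b"
  let ?H = "hausdorff_n n (real n - real CARD('m)) ?K"
  let ?G = "\<lambda>f::real^'k \<Rightarrow> real. \<integral>\<^sup>+y. ennreal (f (\<chi> i. W (jj i) * S.point 0 y (jj i))) * indicator ?K (S.point 0 y) \<partial>Hm"
  note [measurable] = K_measurable
  have sl: "S.slice f jj 0 = ennreal (exp (- real n)) * ?G f" if [measurable]: "f \<in> borel_measurable borel" and f0: "\<And>x. 0 \<le> f x" for f :: "real^'k \<Rightarrow> real"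
  proof -
    have "S.slice f jj 0 = (\<integral>\<^sup>+y. ennreal (exp (- real n)) * (ennreal (f (\<chi> i. W (jj i) * S.point 0 y (jj i))) * indicator ?K (S.point 0 y)) \<partial>Hm)"
      unfolding S.slice_def
    proof (rule nn_integral_cong_AE)
      show "AE y in Hm. ennreal (S.wt f jj (S.point 0 y)) =
           ennreal (exp (- real n)) * (ennreal (f (\<chi> i. W (jj i) * S.point 0 y (jj i))) * indicator ?K (S.point 0 y))"
        using S.AE_V
      proof eventually_elim
        fix y assume y: "y \<in> ker_set n A"
        have "(\<Sum>j<n. W j * S.point 0 y j) = (\<Sum>j<n. 1 + W j * y j)"
        proof (rule sum.cong[OF refl])
          fix j assume "j \<in> {..<n}"
          then show "W j * S.point 0 y j = 1 + W j * y j" using weights(1)[of j] by (simp add: point0 field_simps)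
        qed
        then have s: "(\<Sum>j<n. W j * S.point 0 y j) = real n" using S.V_sum[OF y] by (simp add: sum.distrib)
        show "ennreal (S.wt f jj (S.point 0 y)) =
           ennreal (exp (- real n)) * (ennreal (f (\<chi> i. W (jj i) * S.point 0 y (jj i))) * indicator ?K (S.point 0 y))"
          using point0_K[OF y] f0 unfolding S.wt_def s by (simp add: indicator_def ennreal_mult mult.commute)
      qed
    qed
    also have "\<dots> = ennreal (exp (- real n)) * ?G f"
      by (rule nn_integral_cmult) measurable
    finally show ?thesis .
  qed
  have G1: "?G (\<lambda>_. 1) = ?H"
  proof -
    have m: "S.point 0 -` ?K \<in> sets Hm" using measurable_sets[OF S.measurable_point2 K_measurable, of 0] by (simp add: sets_hausdorff_on)
    have "?G (\<lambda>_. 1) = (\<integral>\<^sup>+y. indicator (S.point 0 -` ?K) y \<partial>Hm)" by (intro nn_integral_cong) (simp add: indicator_def)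
    also have "\<dots> = emeasure Hm (S.point 0 -` ?K)" by (rule nn_integral_indicator[OF m])
    also have "\<dots> = emeasure (distr Hm seqM (S.point 0)) ?K"
      by (subst emeasure_distr) (auto simp: K_measurable)
    finally show ?thesis by (simp add: emeasure_point0[OF K_measurable])
  qed
  have fK [measurable]: "(\<lambda>x. ennreal (f (\<chi> i. W (jj i) * x (jj i)))) \<in> borel_measurable seqM"
    using fm by measurable
  have "(\<integral>\<^sup>+x. ennreal (f (\<chi> i. W (jj i) * x (jj i))) \<partial>P_unif n A b)
     = inverse ?H * (\<integral>\<^sup>+x. ennreal (f (\<chi> i. W (jj i) * x (jj i))) * indicator ?K x \<partial>distr Hm seqM (S.point 0))"
    unfolding P_unif_eq
    by (subst nn_integral_restrict_space) (auto simp: K_measurable nn_integral_scale_measure)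
  also have "(\<integral>\<^sup>+x. ennreal (f (\<chi> i. W (jj i) * x (jj i))) * indicator ?K x \<partial>distr Hm seqM (S.point 0)) = ?G f"
    by (subst nn_integral_distr) auto
  also have "inverse ?H * ?G f = S.slice f jj 0 / S.slice (\<lambda>_::real^'k. 1) jj 0"
  proof -
    have e: "ennreal (exp (- real n)) \<noteq> 0" "ennreal (exp (- real n)) \<noteq> top" by auto
    have "S.slice (\<lambda>_::real^'k. 1) jj 0 = ?H * ennreal (exp (- real n))"
      using sl[of "\<lambda>_. 1"] unfolding G1 by (simp add: mult.commute)
    moreover have "S.slice f jj 0 = ?G f * ennreal (exp (- real n))"
      using sl[OF fm f0] by (simp add: mult.commute)
    ultimately have "S.slice f jj 0 / S.slice (\<lambda>_::real^'k. 1) jj 0 = ?G f / ?H"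
      using divide_mult_eq[of "ennreal (exp (- real n))" "?G f" ?H] e by simp
    then show ?thesis by (simp add: divide_ennreal_def mult.commute)
  qed
  finally show ?thesis .
qed

text \<open>The factor \<kappa> of the Fourier representation is common to \<open>f\<close> and the
  constant 1, nonzero and finite, and hence cancels in \<open>ennreal\<close>.\<close>

lemma nn_integral_P_unif_cf:
  fixes f :: "real^'k::finite \<Rightarrow> real" and jj :: "'k \<Rightarrow> nat"
  defines "F \<equiv> \<lambda>f t. (\<Prod>j\<in>{..<n} - range jj. ecf (A_hat_col n A b j \<bullet> t)) * sel_cf (\<lambda>i. A_hat_col n A b (jj i)) f t"
  assumes f: "continuous_on UNIV f" "\<And>x. 0 \<le> f x" "\<And>x. f x \<le> M"
    and jj: "inj jj" "\<And>i. jj i < n"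
    and int: "integrable lborel (F f)" "integrable lborel (F (\<lambda>_. 1))"
  shows "(\<integral>\<^sup>+x. ennreal (f (\<chi> i. W (jj i) * x (jj i))) \<partial>P_unif n A b)
     = ennreal (Re (\<integral>t. F f t \<partial>lborel)) / ennreal (Re (\<integral>t. F (\<lambda>_. 1) t \<partial>lborel))"
proof -
  obtain \<kappa> where \<kappa>: "\<kappa> \<noteq> 0" "\<kappa> < \<infinity>"
    "\<And>f M jj. continuous_on UNIV (f :: real^'k \<Rightarrow> real) \<Longrightarrow> (\<And>x. 0 \<le> f x) \<Longrightarrow> (\<And>x. f x \<le> M) \<Longrightarrow> (\<And>i. jj i < n) \<Longrightarrow>
       integrable lborel (S.cf f jj) \<Longrightarrow> S.slice f jj 0 = \<kappa> * ennreal (Re (\<integral>t. S.cf f jj t \<partial>lborel))"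
    by (rule S.slice_zero) blast
  have fm: "f \<in> borel_measurable borel" using f(1) by (rule borel_measurable_continuous_onI)
  have cf: "S.cf f jj = F f" if "f \<in> borel_measurable borel" "\<And>x. 0 \<le> f x" "\<And>x. f x \<le> M" for f :: "real^'k \<Rightarrow> real" and M
    unfolding F_def by (rule ext, rule S.cf_factor[OF that jj])
  have "S.slice f jj 0 = \<kappa> * ennreal (Re (\<integral>t. F f t \<partial>lborel))"
    using \<kappa>(3)[OF f jj(2)] int(1) by (simp add: cf[OF fm f(2,3)])
  moreover have c1: "S.cf (\<lambda>_::real^'k. 1) jj = F (\<lambda>_. 1)" by (rule cf[of "\<lambda>_. 1" 1]) auto
  have "S.slice (\<lambda>_::real^'k. 1) jj 0 = \<kappa> * ennreal (Re (\<integral>t. F (\<lambda>_. 1) t \<partial>lborel))"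
    using \<kappa>(3)[of "\<lambda>_. 1" 1 jj] int(2) jj(2) by (simp add: c1)
  moreover have "\<kappa> * x / (\<kappa> * y) = x / y" for x y
    using divide_mult_eq[of \<kappa> x y] \<kappa>(1,2) by (simp add: mult.commute)
  ultimately show ?thesis
    unfolding nn_integral_P_unif[OF fm f(2), of jj] by (simp only:)
qed

end

lemma norm_A_hat_col_le:
  assumes "j < n"
  shows "norm (A_hat_col n A b j :: real^'m::finite) \<le> real CARD('m) * max_norm n (A_hat n A b)"
proof -
  have fin: "finite {\<bar>A_hat n A b l j\<bar> | l j. j < n}"
  proof -
    have "{\<bar>A_hat n A b l j\<bar> | l j. j < n} = (\<lambda>(l, j). \<bar>A_hat n A b l j\<bar>) ` (UNIV \<times> {..<n})" by auto
    then show ?thesis by simp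
  qed
  have "norm (A_hat_col n A b j :: real^'m) \<le> (\<Sum>l\<in>UNIV. \<bar>A_hat_col n A b j $ l\<bar>)" by (rule norm_le_l1_cart)
  also have "\<dots> \<le> (\<Sum>l\<in>(UNIV :: 'm set). max_norm n (A_hat n A b))"
    unfolding max_norm_def A_hat_col_def using assms by (intro sum_mono Max_ge[OF fin]) auto
  finally show ?thesis by simp
qed

theorem theorem2p2:
  fixes A :: "nat \<Rightarrow> 'm::finite \<Rightarrow> nat \<Rightarrow> real"
    and b :: "nat \<Rightarrow> 'm \<Rightarrow> real"
    and j :: "nat \<Rightarrow> 'k::finite \<Rightarrow> nat"
  assumes rank: "\<And>n c. n > CARD('m) \<Longrightarrow> (\<forall>i<n. (\<Sum>l\<in>UNIV. c l * A n l i) = 0) \<Longrightarrow> \<forall>l. c l = 0"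
    and compact: "\<And>n. n > CARD('m) \<Longrightarrow>
        compact (K_set n (A n) (b n))"
    and interior: "\<And>n. n > CARD('m) \<Longrightarrow> \<exists>x\<in>K_set n (A n) (b n). \<forall>i<n. x i > 0"
    and small: "(\<lambda>n. max_norm n (A_hat n (A n) (b n))) \<longlonglongrightarrow> 0"
    and j_ok: "\<forall>\<^sub>F n in sequentially. inj (j n) \<and> (\<forall>i. j n i < n)"
  shows "conv_distr
           (\<lambda>n. distr (P_unif n (A n) (b n)) borel
                   (\<lambda>x. \<chi> i. w_vec n (A n) (b n) (j n i) * x (j n i)))
           iid_exp_law"
  unfolding conv_distr_def
proof (intro allI impI)
  fix f :: "real^'k \<Rightarrow> real" assume f: "continuous_on UNIV f \<and> bounded (range f)"
  obtain B where B: "\<And>x. \<bar>f x\<bar> \<le> B" using f by (auto simp: bounded_iff)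
  \<comment> \<open>The shift makes the test function nonnegative, as the slice formulas require;
    \<open>B\<close> is subtracted again after normalisation.\<close>
  define g where "g x = f x + B" for x
  have g: "continuous_on UNIV g" "\<And>x. 0 \<le> g x" "\<And>x. g x \<le> 2 * B"
  proof -
    show "continuous_on UNIV g" using f unfolding g_def[abs_def] by (auto intro!: continuous_intros)
    show "0 \<le> g x" "g x \<le> 2 * B" for x using B[of x] unfolding g_def by linarith+
  qed
  have gm: "g \<in> borel_measurable borel" using g(1) by (rule borel_measurable_continuous_onI)
  have fm: "f \<in> borel_measurable borel" using f by (auto intro: borel_measurable_continuous_onI)
  have fr: "full_rank n (A n)" if "CARD('m) < n" for n
    unfolding full_rank_def using rank[OF that] by (metis (no_types))
  let ?a = "\<lambda>n. A_hat_col n (A n) (b n) :: nat \<Rightarrow> real^'m"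
  let ?\<delta> = "\<lambda>n. real CARD('m) * max_norm n (A_hat n (A n) (b n))"
  let ?F = "\<lambda>f n t. rest_cf ?a j n t * sel_cf (\<lambda>i. ?a n (j n i)) f t"
  let ?E = "PiM (UNIV :: 'k set) (\<lambda>_. expo)"
  interpret E: prob_space ?E by (rule prob_space_PiM_expo)
  have big: "\<forall>\<^sub>F n in sequentially. CARD('m) < n" by (rule eventually_gt_at_top)
  have iso: "\<forall>\<^sub>F n in sequentially. \<forall>s. (\<Sum>j<n. (?a n j \<bullet> s) *\<^sub>R ?a n j) = s"
    using big by eventually_elim (use isotropic[OF _ fr compact interior] in blast)
  have sm: "\<forall>\<^sub>F n in sequentially. \<forall>j<n. norm (?a n j) \<le> ?\<delta> n"
    by (intro always_eventually allI impI norm_A_hat_col_le)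
  have \<delta>: "?\<delta> \<longlonglongrightarrow> 0" using tendsto_mult_right_zero[OF small] .
  note lim_g = cf_integral_tendsto[OF iso sm \<delta> j_ok gm g(2,3)]
  note lim_1 = cf_integral_tendsto[OF iso sm \<delta> j_ok borel_measurable_const, of 1 1, simplified]
  let ?g0 = "gauss (0::real^'m)"
  have g0: "0 < ?g0" by (rule gauss_pos)
  let ?I = "\<lambda>f n. Re (\<integral>t. ?F f n t \<partial>lborel)"
  have I1: "?I (\<lambda>_. 1) \<longlonglongrightarrow> 1 / ?g0" using lim_1(2) by (simp add: E.prob_space)
  then have pos: "\<forall>\<^sub>F n in sequentially. 0 < ?I (\<lambda>_. 1) n" using g0 by (intro order_tendstoD(1)[OF I1]) simp
  let ?X = "\<lambda>n x. \<chi> i. w_vec n (A n) (b n) (j n i) * x (j n i)"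
  \<comment> \<open>\<open>ennreal\<close> truncates negative reals to 0, whence the
    \<open>max 0\<close>; it is harmless because the limit of \<open>?I g\<close> is
    nonnegative.\<close>
  have ev: "\<forall>\<^sub>F n in sequentially. max 0 (?I g n) / ?I (\<lambda>_. 1) n - B
      = integral\<^sup>L (distr (P_unif n (A n) (b n)) borel (?X n)) f"
    using big lim_g(1) lim_1(1) pos j_ok
  proof eventually_elim
    fix n
    assume n: "CARD('m) < n" and ig: "integrable lborel (?F g n)" and i1: "integrable lborel (?F (\<lambda>_. 1) n)"
      and pos: "0 < ?I (\<lambda>_. 1) n" and jn: "inj (j n) \<and> (\<forall>i. j n i < n)"
    let ?P = "P_unif n (A n) (b n)"
    have [measurable]: "?X n \<in> borel_measurable ?P"
      by (rule measurable_P_unif[OF n fr[OF n] compact[OF n] interior[OF n]]) measurable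
    note cf = nn_integral_P_unif_cf[OF n fr[OF n] compact[OF n] interior[OF n], of _ _ "j n"]
    have ng: "(\<integral>\<^sup>+x. ennreal (g (?X n x)) \<partial>?P) = ennreal (?I g n) / ennreal (?I (\<lambda>_. 1) n)"
      using cf[of g "2 * B"] g jn ig i1 by (simp add: rest_cf_def)
    \<comment> \<open>The test function 1 shows that \<open>?P\<close> has mass 1; in particular the
      polytope has positive and finite Hausdorff measure for these n.\<close>
    have "(\<integral>\<^sup>+x. ennreal 1 \<partial>?P) = ennreal (?I (\<lambda>_. 1) n) / ennreal (?I (\<lambda>_. 1) n)"
      using cf[of "\<lambda>_. 1" 1] jn i1 by (simp add: rest_cf_def)
    also have "\<dots> = 1" using pos by (simp add: divide_ennreal)
    finally have "emeasure ?P (space ?P) = 1" by simp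
    then interpret P: prob_space ?P by (rule prob_spaceI)
    have gX: "(\<lambda>x. g (?X n x)) \<in> borel_measurable ?P" by (rule measurable_compose[OF _ gm]) measurable
    have "(\<integral>x. g (?X n x) \<partial>?P) = enn2real (ennreal (?I g n) / ennreal (?I (\<lambda>_. 1) n))"
      unfolding ng[symmetric] using g(2) by (intro integral_eq_nn_integral gX) auto
    also have "ennreal (?I g n) = ennreal (max 0 (?I g n))" by (cases "0 \<le> ?I g n") (auto simp: max_def ennreal_neg)
    also have "\<dots> / ennreal (?I (\<lambda>_. 1) n) = ennreal (max 0 (?I g n) / ?I (\<lambda>_. 1) n)"
      using pos by (intro divide_ennreal) auto
    also have "enn2real \<dots> = max 0 (?I g n) / ?I (\<lambda>_. 1) n"
      using pos by (intro enn2real_ennreal divide_nonneg_pos) auto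
    finally have Eg: "(\<integral>x. g (?X n x) \<partial>?P) = max 0 (?I g n) / ?I (\<lambda>_. 1) n" .
    have "integrable ?P (\<lambda>x. g (?X n x))"
      using g(2,3) gX by (intro P.integrable_const_bound[of _ "2 * B"]) auto
    then have "(\<integral>x. g (?X n x) - B \<partial>?P) = (\<integral>x. g (?X n x) \<partial>?P) - B" by (simp add: P.prob_space)
    then have "(\<integral>x. f (?X n x) \<partial>?P) = max 0 (?I g n) / ?I (\<lambda>_. 1) n - B" unfolding Eg by (simp add: g_def)
    moreover have "integral\<^sup>L (distr ?P borel (?X n)) f = (\<integral>x. f (?X n x) \<partial>?P)"
      by (rule integral_distr) (use fm in measurable)
    ultimately show "max 0 (?I g n) / ?I (\<lambda>_. 1) n - B = integral\<^sup>L (distr ?P borel (?X n)) f" by simp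
  qed
  let ?Eg = "\<integral>y. g (\<chi> i. y i) \<partial>?E"
  have Eg0: "0 \<le> ?Eg" using g(2) by (intro Bochner_Integration.integral_nonneg) auto
  \<comment> \<open>Numerator and denominator both carry the factor 1 / \<open>gauss 0\<close>,
    which drops out of the limit and leaves the expectation of \<open>g\<close> under the
    exponential product law.\<close>
  have "(\<lambda>n. max 0 (?I g n) / ?I (\<lambda>_. 1) n - B) \<longlonglongrightarrow> max 0 (?Eg / ?g0) / (1 / ?g0) - B"
    using g0 by (intro tendsto_intros lim_g(2) I1) auto
  also have "max 0 (?Eg / ?g0) / (1 / ?g0) - B = integral\<^sup>L iid_exp_law f"
  proof -
    have mE: "(\<lambda>y. \<chi> i. y i) \<in> measurable ?E (borel :: (real^'k) measure)"
    proof (rule measurable_vec_lambda)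
      show "(\<lambda>y. y i) \<in> borel_measurable ?E" for i
        using measurable_component_singleton[of i UNIV "\<lambda>_. expo"] by simp
    qed
    have "integrable ?E (\<lambda>y. g (\<chi> i. y i))"
      using g(2,3) measurable_PiM_expo_f[OF gm] by (intro E.integrable_const_bound[of _ "2 * B"]) auto
    then have "(\<integral>y. g (\<chi> i. y i) - B \<partial>?E) = ?Eg - B" by (simp add: E.prob_space)
    then have "(\<integral>y. f (\<chi> i. y i) \<partial>?E) = ?Eg - B" by (simp add: g_def)
    moreover have "integral\<^sup>L iid_exp_law f = (\<integral>y. f (\<chi> i. y i) \<partial>?E)"
      unfolding iid_exp_law_def by (rule integral_distr[OF mE fm])
    ultimately show ?thesis using g0 Eg0 by (simp add: max_def)
  qed
  finally show "(\<lambda>n. integral\<^sup>L (distr (P_unif n (A n) (b n)) borel (?X n)) f) \<longlonglongrightarrow> integral\<^sup>L iid_exp_law f"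
    using ev by (rule Lim_transform_eventually)
qed

end
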